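(* Let $H$ and $U$ be Hilbert spaces, let $A$ generate a $C_0$ semigroup on $H$, let $B\in\mathcal{L}(U;H)$, and let $T>0$. Let $\mathcal{G}$ be a closed vector subspace of $L^2(0,T;U)$ and $\mathcal{W}$ a closed vector subspace of $L^2(0,T;H)$. Assume the following observability inequality: there exists a constant $C>0$ such that for all $(z_T,g,w,f)\in H\times\mathcal{G}\times\mathcal{W}\times L^2(0,T;H)$, the solution $z$ of $z'+A^*z=f$ for $t\in(0,T)$, $z(T)=z_T$, satisfies $$\|(z(0),g,w,f)\|_{H\times\mathcal{G}\times\mathcal{W}\times L^2(0,T;H)}\le C\left(\|B^*z+g\|_{L^2(0,T;U)}+\|f+w\|_{L^2(0,T;H)}\right).$$ Then, for any $y_0\in H$, $g_*\in\mathcal{G}$ and $w_*\in\mathcal{W}$, there exists a control function $u\in L^2(0,T;U)$ such that $\mathbb{P}_{\mathcal{G}}u=g_*$ and the solution $y$ of $$y'=Ay+Bu \ \text{ for } t\in(0,T),\qquad y(0)=y_0,$$ satisfies $y(T)=0$ and $\mathbb{P}_{\mathcal{W}}y=w_*$.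
   Context: $\mathbb{P}_{\mathcal{G}}$ denotes the orthogonal projection onto $\mathcal{G}$ in $L^2(0,T;U)$ and $\mathbb{P}_{\mathcal{W}}$ the orthogonal projection onto $\mathcal{W}$ in $L^2(0,T;H)$. $\mathcal{G}$ and $\mathcal{W}$ carry the norms of $L^2(0,T;U)$ and $L^2(0,T;H)$. Solutions of the evolution equations are the usual mild (semigroup) solutions, which belong to $C^0([0,T];H)$; the equation for $z$ is solved backward in time from $z(T)=z_T$. $A^*$, $B^*$ denote adjoints. *)

theory Defs
  imports "HOL-Analysis.Analysis"
begin

text \<open>
  Hilbert spaces are types of sort \<open>{real_inner, banach}\<close>; separability is not assumed.  The
  library's Bochner integral is restricted to second-countable spaces, so strong (Bochner)
  measurability is spelled out here, and vector-valued integrals are Henstock-Kurzweil integrals,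
  which exist and agree with the Bochner integral for every Bochner integrable function.
\<close>

definition strongly_measurable :: "'a measure \<Rightarrow> ('a \<Rightarrow> 'b::real_normed_vector) \<Rightarrow> bool" where
  "strongly_measurable M f \<longleftrightarrow>
     (\<exists>s. (\<forall>n::nat. simple_function M (s n)) \<and> (AE x in M. (\<lambda>n. s n x) \<longlonglongrightarrow> f x))"

text \<open>
  Elements of \<open>L\<^sup>2(0,T;H)\<close> are represented by functions, of which only the values on \<open>[0,T]\<close> matter;
  equality in \<open>L\<^sup>2\<close> is equality almost everywhere.
\<close>

definition L2 :: "real \<Rightarrow> (real \<Rightarrow> 'a::real_normed_vector) set" where
  "L2 T = {f. strongly_measurable (lebesgue_on {0..T}) f \<and>
              integrable (lebesgue_on {0..T}) (\<lambda>t. (norm (f t))\<^sup>2)}"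

definition L2_norm :: "real \<Rightarrow> (real \<Rightarrow> 'a::real_normed_vector) \<Rightarrow> real" where
  "L2_norm T f = sqrt (LINT t|lebesgue_on {0..T}. (norm (f t))\<^sup>2)"

definition L2_inner :: "real \<Rightarrow> (real \<Rightarrow> 'a::real_inner) \<Rightarrow> (real \<Rightarrow> 'a) \<Rightarrow> real" where
  "L2_inner T f g = (LINT t|lebesgue_on {0..T}. inner (f t) (g t))"

definition L2_eq :: "real \<Rightarrow> (real \<Rightarrow> 'a) \<Rightarrow> (real \<Rightarrow> 'a) \<Rightarrow> bool" where
  "L2_eq T f g \<longleftrightarrow> (AE t in lebesgue_on {0..T}. f t = g t)"

text \<open>
  The last condition, applied to constant sequences, also makes \<open>G\<close> invariant under changes on null
  sets, so these sets of functions correspond exactly to the closed subspaces of the quotient space.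
\<close>

definition closed_L2_subspace :: "real \<Rightarrow> (real \<Rightarrow> 'a::real_normed_vector) set \<Rightarrow> bool" where
  "closed_L2_subspace T G \<longleftrightarrow>
     G \<subseteq> L2 T \<and>
     (\<lambda>t. 0) \<in> G \<and>
     (\<forall>f\<in>G. \<forall>g\<in>G. (\<lambda>t. f t + g t) \<in> G) \<and>
     (\<forall>c::real. \<forall>f\<in>G. (\<lambda>t. c *\<^sub>R f t) \<in> G) \<and>
     (\<forall>h. \<forall>f\<in>L2 T. (\<forall>n::nat. h n \<in> G) \<and> (\<lambda>n. L2_norm T (\<lambda>t. h n t - f t)) \<longlonglongrightarrow> 0
        \<longrightarrow> f \<in> G)"

text \<open>A representative of the orthogonal projection of \<open>u\<close> onto \<open>G\<close>; it is unique up to \<^const>\<open>L2_eq\<close>.\<close>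

definition L2_proj :: "real \<Rightarrow> (real \<Rightarrow> 'a::real_inner) set \<Rightarrow> (real \<Rightarrow> 'a) \<Rightarrow> real \<Rightarrow> 'a" where
  "L2_proj T G u = (SOME p. p \<in> G \<and> (\<forall>g\<in>G. L2_inner T (\<lambda>t. u t - p t) g = 0))"

definition C0_semigroup :: "(real \<Rightarrow> 'a::real_normed_vector \<Rightarrow>\<^sub>L 'a) \<Rightarrow> bool" where
  "C0_semigroup S \<longleftrightarrow>
     S 0 = id_blinfun \<and>
     (\<forall>s\<ge>0. \<forall>t\<ge>0. S (s + t) = S s o\<^sub>L S t) \<and>
     (\<forall>x. ((\<lambda>t. blinfun_apply (S t) x) \<longlongrightarrow> x) (at_right 0))"

text \<open>Unbounded operators are represented by their graphs.\<close>

definition generator :: "(real \<Rightarrow> 'a::real_normed_vector \<Rightarrow>\<^sub>L 'a) \<Rightarrow> ('a \<times> 'a) set" where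
  "generator S = {(x, y). ((\<lambda>h. (blinfun_apply (S h) x - x) /\<^sub>R h) \<longlongrightarrow> y) (at_right 0)}"

definition generates_C0_semigroup :: "('a::real_normed_vector \<times> 'a) set \<Rightarrow> bool" where
  "generates_C0_semigroup A \<longleftrightarrow> (\<exists>S. C0_semigroup S \<and> generator S = A)"

text \<open>
  The generated semigroup is determined by \<open>A\<close> at nonnegative times; the values at negative times
  are arbitrary and never used.
\<close>

definition semigroup_of :: "('a::real_normed_vector \<times> 'a) set \<Rightarrow> real \<Rightarrow> 'a \<Rightarrow>\<^sub>L 'a" where
  "semigroup_of A = (SOME S. C0_semigroup S \<and> generator S = A)"

text \<open>The graph of the Hilbert space adjoint of a densely defined operator.\<close>

definition op_adjoint :: "('a::real_inner \<times> 'a) set \<Rightarrow> ('a \<times> 'a) set" where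
  "op_adjoint A = {(y, z). \<forall>(x, v)\<in>A. inner v y = inner x z}"

text \<open>The mild solution of \<open>y' = A y + f\<close>, \<open>y(0) = y\<^sub>0\<close>.\<close>

definition mild_solution ::
  "('a::real_normed_vector \<times> 'a) set \<Rightarrow> 'a \<Rightarrow> (real \<Rightarrow> 'a) \<Rightarrow> real \<Rightarrow> 'a" where
  "mild_solution A y0 f t =
     blinfun_apply (semigroup_of A t) y0 +
     integral {0..t} (\<lambda>s. blinfun_apply (semigroup_of A (t - s)) (f s))"

text \<open>
  The mild solution of \<open>z' + A z = f\<close>, \<open>z(T) = z\<^sub>T\<close>: the time reversal \<open>v(t) = z(T - t)\<close> solves
  \<open>v' = A v - f(T - t)\<close>, \<open>v(0) = z\<^sub>T\<close>.
\<close>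

definition backward_mild_solution ::
  "('a::real_normed_vector \<times> 'a) set \<Rightarrow> real \<Rightarrow> 'a \<Rightarrow> (real \<Rightarrow> 'a) \<Rightarrow> real \<Rightarrow> 'a" where
  "backward_mild_solution A T zT f t =
     blinfun_apply (semigroup_of A (T - t)) zT -
     integral {t..T} (\<lambda>s. blinfun_apply (semigroup_of A (s - t)) (f s))"

end

theory Submission
  imports Defs
begin

text \<open>
  The observability inequality says that the linear map
  \<open>L (z\<^sub>T, g, w, f) = (B\<^sup>* z + g, f + w)\<close>, with values in \<open>L\<^sup>2(0,T; U \<times> H)\<close>, controls \<open>z(0)\<close>, \<open>g\<close>
  and \<open>w\<close>.  Hence the number \<open>-\<langle>y\<^sub>0, z(0)\<rangle> + \<langle>g, g\<^sub>*\<rangle> + \<langle>w, w\<^sub>*\<rangle>\<close> is a bounded linear function of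
  \<open>L (z\<^sub>T, g, w, f)\<close>, and the Riesz representation theorem yields \<open>(u, v)\<close> in \<open>L\<^sup>2(0,T; U \<times> H)\<close> with
  \<open>\<langle>u, B\<^sup>* z + g\<rangle> + \<langle>v, f + w\<rangle> = -\<langle>y\<^sub>0, z(0)\<rangle> + \<langle>g, g\<^sub>*\<rangle> + \<langle>w, w\<^sub>*\<rangle>\<close>
  for all data.  Data with only \<open>g\<close> nonzero show that \<open>u\<close> projects to \<open>g\<^sub>*\<close>, data with only \<open>w\<close>
  nonzero that \<open>v\<close> projects to \<open>w\<^sub>*\<close>.  For \<open>g = w = 0\<close> the identity is compared with the duality
  \<open>\<langle>y(T), z\<^sub>T\<rangle> - \<langle>y\<^sub>0, z(0)\<rangle> = \<langle>B u, z\<rangle> + \<langle>y, f\<rangle>\<close> between forward and backward mild solutions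
  (\<open>mild_solution_duality\<close>): this leaves \<open>\<langle>y(T), z\<^sub>T\<rangle> = \<langle>y - v, f\<rangle>\<close> for all \<open>z\<^sub>T\<close> and \<open>f\<close>, so that
  \<open>y(T) = 0\<close> and \<open>y\<close> has the same projection as \<open>v\<close>.

  Three ingredients carry the argument.

  The Riesz theorem (\<open>riesz_on_graph\<close>) is proved for complete semi-inner products and for a
  functional given by its graph.  It then applies to square integrable functions, as opposed to
  classes of them, once these are known to be complete (\<open>L2_complete\<close>), and it makes the
  functional on the range of \<open>L\<close> well defined.

  The adjoint \<open>A\<^sup>*\<close> generates the semigroup of adjoints (\<open>semigroup_of_adjoint\<close>).  Strong continuity
  of the adjoints comes from density: averages over \<open>[0, r]\<close> of adjoint orbits are strongly continuous
  vectors, and only \<open>0\<close> is orthogonal to all of them.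

  The duality follows by inserting the Duhamel formulas and exchanging the two time integrals over
  the triangle \<open>s \<le> t\<close>.  The integrals of vector-valued functions are reduced to scalar Lebesgue
  integrals by taking inner products (\<open>inner_integral\<close>), which leaves a scalar Fubini theorem for
  strongly measurable data (\<open>Fubini_strongly_measurable\<close>).
\<close>

section \<open>Riesz representation for semi-inner products\<close>

lemma quadratic_nonneg_imp_discriminant:
  fixes A B D :: real
  assumes "\<And>r. 0 \<le> A + 2 * r * B + r\<^sup>2 * D"
  shows "B\<^sup>2 \<le> A * D"
proof (cases "D = 0")
  case True
  have "B = 0"
  proof (rule ccontr)
    assume "B \<noteq> 0"
    then show False using assms[of "-(A + 1) / (2 * B)"] True by (simp add: field_simps)
  qed
  then show ?thesis using True by simp
next
  case False
  have "0 < D"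
  proof (rule ccontr)
    assume "\<not> 0 < D"
    then have D: "D < 0" using False by simp
    \<comment> \<open>a value at which the quadratic with leading coefficient \<open>D < 0\<close> is negative\<close>
    define r where "r = 1 - (\<bar>A\<bar> + 2 * \<bar>B\<bar> + 1) / D"
    have r1: "1 \<le> r" unfolding r_def using D by (simp add: divide_nonneg_neg divide_nonpos_neg divide_le_0_iff)
    have "r * (-D) = \<bar>A\<bar> + 2 * \<bar>B\<bar> + 1 + (-D)" unfolding r_def using D by (simp add: field_simps)
    then have *: "2 * \<bar>B\<bar> + \<bar>A\<bar> + 1 \<le> r * (-D)" using D by simp
    have "r * (2 * \<bar>B\<bar> + \<bar>A\<bar> + 1) \<le> r * (r * (-D))"
      by (rule mult_left_mono[OF *]) (use r1 in simp)
    moreover have "\<bar>A\<bar> + 1 \<le> r * (\<bar>A\<bar> + 1)" using r1 by (simp add: mult_le_cancel_right1)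
    moreover have "2 * r * B \<le> 2 * r * \<bar>B\<bar>" using r1 by simp
    ultimately show False using assms[of r] by (simp add: algebra_simps power2_eq_square)
  qed
  then show ?thesis using assms[of "-B / D"] by (simp add: field_simps power2_eq_square)
qed

text \<open>
  All axioms concern values of \<open>ip\<close>, never equality of elements: in this way functions that agree
  almost everywhere can stay distinct, and no quotient is formed. The operation \<open>comb r a b\<close>
  stands for \<open>a + r b\<close>, and \<open>comb (-1) a b\<close> for \<open>a - b\<close>.
\<close>

locale semi_inner =
  fixes V :: "'v set" and comb :: "real \<Rightarrow> 'v \<Rightarrow> 'v \<Rightarrow> 'v" and ip :: "'v \<Rightarrow> 'v \<Rightarrow> real"
  assumes comb_closed: "a \<in> V \<Longrightarrow> b \<in> V \<Longrightarrow> comb r a b \<in> V"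
    and ip_comb: "a \<in> V \<Longrightarrow> b \<in> V \<Longrightarrow> c \<in> V \<Longrightarrow> ip (comb r a b) c = ip a c + r * ip b c"
    and ip_commute: "a \<in> V \<Longrightarrow> b \<in> V \<Longrightarrow> ip a b = ip b a"
    and ip_nonneg: "a \<in> V \<Longrightarrow> 0 \<le> ip a a"
begin

lemma ip_comb_right: "a \<in> V \<Longrightarrow> b \<in> V \<Longrightarrow> c \<in> V \<Longrightarrow> ip c (comb r a b) = ip c a + r * ip c b"
  by (simp add: ip_comb ip_commute[of c] comb_closed)

lemma ip_comb_self:
  assumes "a \<in> V" "b \<in> V"
  shows "ip (comb r a b) (comb r a b) = ip a a + 2 * r * ip a b + r\<^sup>2 * ip b b"
  using assms by (simp add: ip_comb ip_comb_right comb_closed ip_commute[of b a]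
      power2_eq_square algebra_simps)

lemma cauchy_schwarz:
  assumes "a \<in> V" "b \<in> V"
  shows "\<bar>ip a b\<bar> \<le> sqrt (ip a a) * sqrt (ip b b)"
proof -
  have "(ip a b)\<^sup>2 \<le> ip a a * ip b b"
    by (rule quadratic_nonneg_imp_discriminant)
       (metis ip_comb_self[OF assms] ip_nonneg comb_closed assms)
  then show ?thesis
    by (metis real_sqrt_abs real_sqrt_le_mono real_sqrt_mult)
qed

lemma triangle_comb:
  assumes "a \<in> V" "b \<in> V"
  shows "sqrt (ip (comb r a b) (comb r a b)) \<le> sqrt (ip a a) + \<bar>r\<bar> * sqrt (ip b b)"
proof (rule real_le_lsqrt)
  have "r * ip a b \<le> \<bar>r\<bar> * \<bar>ip a b\<bar>" by (simp flip: abs_mult)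
  also have "\<dots> \<le> \<bar>r\<bar> * (sqrt (ip a a) * sqrt (ip b b))"
    by (intro mult_left_mono cauchy_schwarz assms) simp
  finally show "ip (comb r a b) (comb r a b) \<le> (sqrt (ip a a) + \<bar>r\<bar> * sqrt (ip b b))\<^sup>2"
    using ip_nonneg[OF assms(1)] ip_nonneg[OF assms(2)]
    by (simp add: ip_comb_self assms power2_sum power_mult_distrib mult_ac)
qed (simp add: ip_nonneg assms)

end

locale complete_semi_inner = semi_inner +
  assumes complete: "(\<And>n::nat. q n \<in> V) \<Longrightarrow>
      (\<And>e. e > 0 \<Longrightarrow> \<exists>N. \<forall>m\<ge>N. \<forall>n\<ge>N.
         ip (comb (-1) (q m) (q n)) (comb (-1) (q m) (q n)) < e) \<Longrightarrow>
      \<exists>u\<in>V. (\<lambda>n. ip (comb (-1) (q n) u) (comb (-1) (q n) u)) \<longlonglongrightarrow> 0"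
begin

text \<open>
  The direct method: \<open>\<Gamma>\<close> is the graph of a functional, and the representing element is the limit
  of a minimising sequence of \<open>\<parallel>a\<parallel>\<^sup>2 - 2 r\<close> over \<open>\<Gamma>\<close>, which is Cauchy by the parallelogram
  identity. A graph is given, instead of a function, with a view to functionals defined through
  parameters: the bound on the graph already forces the value to depend only on the element
  described. The minimising sequence itself is part of the conclusion because it shows that \<open>u\<close>
  lies in the closure of the domain of the functional.
\<close>

lemma riesz_on_graph:
  assumes sub: "\<And>a r. (a, r) \<in> \<Gamma> \<Longrightarrow> a \<in> V"
    and ne: "\<Gamma> \<noteq> {}"
    and closed: "\<And>a r b s c. (a, r) \<in> \<Gamma> \<Longrightarrow> (b, s) \<in> \<Gamma> \<Longrightarrow> (comb c a b, r + c * s) \<in> \<Gamma>"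
    and bound: "\<And>a r. (a, r) \<in> \<Gamma> \<Longrightarrow> \<bar>r\<bar> \<le> K * sqrt (ip a a)"
  obtains u p where "u \<in> V" "\<And>a r. (a, r) \<in> \<Gamma> \<Longrightarrow> ip u a = r"
    "\<And>n::nat. p n \<in> fst ` \<Gamma>" "(\<lambda>n. ip (comb (-1) (p n) u) (comb (-1) (p n) u)) \<longlonglongrightarrow> 0"
proof -
  define J where "J = (\<lambda>(a, r). ip a a - 2 * r)"
  define m where "m = Inf (J ` \<Gamma>)"
  have bdd: "bdd_below (J ` \<Gamma>)"
  proof (rule bdd_belowI2)
    fix x assume "x \<in> \<Gamma>"
    then obtain a r where x: "x = (a, r)" "(a, r) \<in> \<Gamma>" by (cases x) auto
    have "0 \<le> (sqrt (ip a a) - K)\<^sup>2" by simp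
    also have "\<dots> = ip a a - 2 * (K * sqrt (ip a a)) + K\<^sup>2"
      using ip_nonneg[OF sub[OF x(2)]] by (simp add: power2_diff algebra_simps)
    finally show "- (K\<^sup>2) \<le> J x" using bound[OF x(2)] by (simp add: J_def x(1))
  qed
  have m_le: "m \<le> ip a a - 2 * r" if "(a, r) \<in> \<Gamma>" for a r
    using cInf_lower[OF imageI[OF that, of J] bdd] by (simp add: m_def J_def)
  have "\<exists>x\<in>\<Gamma>. J x < m + 1 / real (Suc n)" for n
    using cInf_less_iff[of "J ` \<Gamma>" "m + 1 / real (Suc n)"] ne bdd by (auto simp: m_def)
  then obtain q where q: "\<And>n. q n \<in> \<Gamma>" "\<And>n. J (q n) < m + 1 / real (Suc n)" by metis
  define p where "p n = fst (q n)" for n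
  define s where "s n = snd (q n)" for n
  have pG: "(p n, s n) \<in> \<Gamma>" for n using q(1)[of n] by (simp add: p_def s_def)
  have pV: "p n \<in> V" for n using pG sub by blast
  have pJ: "ip (p n) (p n) - 2 * s n < m + 1 / real (Suc n)" for n
    using q(2)[of n] by (simp add: J_def p_def s_def case_prod_beta)
  \<comment> \<open>the midpoint of two near-minimisers cannot beat the infimum, so they are close to each other\<close>
  have close: "ip (comb (-1) (p i) (p j)) (comb (-1) (p i) (p j))
      < 2 * (1 / real (Suc i)) + 2 * (1 / real (Suc j))" for i j
  proof -
    have "(comb (1/2) (p i) (comb (-1) (p j) (p i)), s i + (1/2) * (s j + (-1) * s i)) \<in> \<Gamma>"
      by (intro closed pG)
    from m_le[OF this]
    have "m \<le> ip (p i) (p j) + ip (comb (-1) (p i) (p j)) (comb (-1) (p i) (p j)) / 4 - s i - s j"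
      by (simp add: ip_comb ip_comb_right comb_closed pV ip_commute[of "p j" "p i"] field_simps)
    moreover have "ip (comb (-1) (p i) (p j)) (comb (-1) (p i) (p j))
        = ip (p i) (p i) - 2 * ip (p i) (p j) + ip (p j) (p j)"
      by (simp add: ip_comb_self pV)
    ultimately show ?thesis using pJ[of i] pJ[of j] by linarith
  qed
  have cau: "\<exists>N. \<forall>i\<ge>N. \<forall>j\<ge>N. ip (comb (-1) (p i) (p j)) (comb (-1) (p i) (p j)) < e"
    if "e > 0" for e
  proof -
    have "0 < e / 4" using that by simp
    then obtain N where N: "1 / real (Suc N) < e / 4" by (rule nat_approx_posE)
    have *: "1 / real (Suc i) < e / 4" if "i \<ge> N" for i
    proof -
      have "1 / real (Suc i) \<le> 1 / real (Suc N)" using that by (intro divide_left_mono) auto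
      with N show ?thesis by simp
    qed
    show ?thesis
    proof (intro exI[of _ N] allI impI)
      fix i j assume "i \<ge> N" "j \<ge> N"
      from *[OF this(1)] *[OF this(2)] close[of i j]
      show "ip (comb (-1) (p i) (p j)) (comb (-1) (p i) (p j)) < e" by linarith
    qed
  qed
  from complete[OF pV cau] obtain u where u: "u \<in> V"
    and lim: "(\<lambda>n. ip (comb (-1) (p n) u) (comb (-1) (p n) u)) \<longlonglongrightarrow> 0" by blast
  have wlim: "(\<lambda>n. ip (p n) b) \<longlonglongrightarrow> ip u b" if "b \<in> V" for b
  proof -
    have "(\<lambda>n. sqrt (ip (comb (-1) (p n) u) (comb (-1) (p n) u)) * sqrt (ip b b)) \<longlonglongrightarrow> sqrt 0 * sqrt (ip b b)"
      by (intro tendsto_intros lim)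
    then have "(\<lambda>n. ip (p n) b - ip u b) \<longlonglongrightarrow> 0"
      by (rule_tac Lim_null_comparison[rotated])
         (use cauchy_schwarz[OF comb_closed[OF pV u] that, of "-1"] in
           \<open>auto simp: ip_comb pV u that\<close>)
    then show ?thesis by (simp add: LIM_zero_iff)
  qed
  have Jlim: "(\<lambda>n. ip (p n) (p n) - 2 * s n) \<longlonglongrightarrow> m"
  proof (rule tendsto_sandwich[of "\<lambda>_. m" _ _ "\<lambda>n. m + 1 / real (Suc n)"])
    show "(\<lambda>n. m + 1 / real (Suc n)) \<longlonglongrightarrow> m"
      using tendsto_add[OF tendsto_const lim_1_over_n[THEN LIMSEQ_Suc], of m] by simp
  qed (auto intro!: eventuallyI m_le[OF pG] less_imp_le[OF pJ, unfolded of_nat_Suc] pJ less_imp_le)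
  \<comment> \<open>the first variation of the functional at \<open>u\<close> vanishes in the direction of every element of \<open>\<Gamma>\<close>\<close>
  have "ip u b = r" if b: "(b, r) \<in> \<Gamma>" for b r
  proof -
    have bV: "b \<in> V" using sub b by blast
    have "0 \<le> 0 + 2 * t * (ip u b - r) + t\<^sup>2 * ip b b" for t
    proof -
      have "m \<le> (ip (p n) (p n) - 2 * s n) + 2 * t * (ip (p n) b - r) + t\<^sup>2 * ip b b" for n
        using m_le[OF closed[OF pG[of n] b, of t]] by (simp add: ip_comb_self pV bV algebra_simps)
      moreover have "(\<lambda>n. (ip (p n) (p n) - 2 * s n) + 2 * t * (ip (p n) b - r) + t\<^sup>2 * ip b b)
          \<longlonglongrightarrow> m + 2 * t * (ip u b - r) + t\<^sup>2 * ip b b"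
        by (intro tendsto_intros Jlim wlim bV)
      ultimately have "m \<le> m + 2 * t * (ip u b - r) + t\<^sup>2 * ip b b"
        by (intro LIMSEQ_le_const) auto
      then show ?thesis by simp
    qed
    from quadratic_nonneg_imp_discriminant[OF this] show ?thesis by simp
  qed
  moreover have "p n \<in> fst ` \<Gamma>" for n using pG[of n] by force
  ultimately show ?thesis using that u lim by blast
qed

end

interpretation hilbert: complete_semi_inner
  "UNIV :: 'h::{real_inner, banach} set" "\<lambda>r a b. a + r *\<^sub>R b" "inner"
proof
  fix a :: "nat \<Rightarrow> 'h"
  assume cau: "\<And>e. e > 0 \<Longrightarrow> \<exists>N. \<forall>m\<ge>N. \<forall>n\<ge>N.
      inner (a m + (-1) *\<^sub>R a n) (a m + (-1) *\<^sub>R a n) < e"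
  have "Cauchy a"
  proof (rule CauchyI)
    fix e :: real assume "0 < e"
    with cau[of "e\<^sup>2"] obtain N where "\<forall>m\<ge>N. \<forall>n\<ge>N. (norm (a m - a n))\<^sup>2 < e\<^sup>2"
      by (auto simp: power2_norm_eq_inner)
    then show "\<exists>N. \<forall>m\<ge>N. \<forall>n\<ge>N. norm (a m - a n) < e"
      using \<open>0 < e\<close> by (meson power_less_imp_less_base less_imp_le)
  qed
  then obtain u where "a \<longlonglongrightarrow> u" by (auto simp: Cauchy_convergent_iff convergent_def)
  then have "(\<lambda>n. inner (a n + (-1) *\<^sub>R u) (a n + (-1) *\<^sub>R u)) \<longlonglongrightarrow> inner (u + (-1) *\<^sub>R u) (u + (-1) *\<^sub>R u)"
    by (intro tendsto_intros)
  then show "\<exists>u\<in>UNIV. (\<lambda>n. inner (a n + (-1) *\<^sub>R u) (a n + (-1) *\<^sub>R u)) \<longlonglongrightarrow> 0" by auto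
qed (auto simp: inner_simps inner_commute)

lemma riesz_representation:
  fixes l :: "'h::{real_inner, banach} \<Rightarrow> real"
  assumes "bounded_linear l"
  obtains u where "\<And>x. l x = inner u x"
proof -
  interpret bounded_linear l by fact
  obtain K where K: "\<And>x. norm (l x) \<le> norm x * K" using bounded by blast
  show ?thesis
  proof (rule hilbert.riesz_on_graph[of "range (\<lambda>x. (x, l x))" K])
    show "\<bar>r\<bar> \<le> K * sqrt (inner a a)" if "(a, r) \<in> range (\<lambda>x. (x, l x))" for a r
      using that K by (auto simp: norm_eq_sqrt_inner mult.commute)
    fix u assume "\<And>a r. (a, r) \<in> range (\<lambda>x. (x, l x)) \<Longrightarrow> inner u a = r"
    then show ?thesis using that[of u] by (metis rangeI)
  qed (auto simp: add scaleR)
qed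

text \<open>
  The functional \<open>\<langle>x, \<cdot>\<rangle>\<close> on \<open>S\<close> is represented by some \<open>u\<close> in the closure of \<open>S\<close>; then \<open>x - u\<close> is
  orthogonal to \<open>S\<close>, so \<open>x = u\<close>.
\<close>

lemma dense_if_orthogonal_complement_trivial:
  fixes S :: "'h::{real_inner, banach} set"
  assumes S: "subspace S" and orth: "\<And>y. (\<And>x. x \<in> S \<Longrightarrow> inner y x = 0) \<Longrightarrow> y = 0"
  shows "closure S = UNIV"
proof -
  have "x \<in> closure S" for x
  proof (rule hilbert.riesz_on_graph[of "(\<lambda>a. (a, inner x a)) ` S" "norm x"])
    show "(\<lambda>a. (a, inner x a)) ` S \<noteq> {}" using subspace_0[OF S] by blast
    show "\<bar>r\<bar> \<le> norm x * sqrt (inner a a)" if "(a, r) \<in> (\<lambda>a. (a, inner x a)) ` S" for a r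
      using that Cauchy_Schwarz_ineq2[of x] by (auto simp: norm_eq_sqrt_inner)
    show "(a + c *\<^sub>R b, r + c * s) \<in> (\<lambda>a. (a, inner x a)) ` S"
      if "(a, r) \<in> (\<lambda>a. (a, inner x a)) ` S" "(b, s) \<in> (\<lambda>a. (a, inner x a)) ` S" for a r b s c
      using that S by (auto simp: inner_simps subspace_add subspace_scale intro!: image_eqI)
    fix u p
    assume u: "\<And>a r. (a, r) \<in> (\<lambda>a. (a, inner x a)) ` S \<Longrightarrow> inner u a = r"
      and p: "\<And>n::nat. p n \<in> fst ` (\<lambda>a. (a, inner x a)) ` S"
      and lim: "(\<lambda>n. inner (p n + (-1) *\<^sub>R u) (p n + (-1) *\<^sub>R u)) \<longlonglongrightarrow> 0"
    have "x - u = 0"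
    proof (rule orth)
      fix a assume "a \<in> S"
      then have "inner u a = inner x a" using u by blast
      then show "inner (x - u) a = 0" by (simp add: inner_diff_left)
    qed
    have "(\<lambda>n. norm (p n - u)) \<longlonglongrightarrow> 0"
      using tendsto_real_sqrt[OF lim] by (simp add: norm_eq_sqrt_inner)
    then have "p \<longlonglongrightarrow> u" by (simp add: LIM_zero_iff tendsto_norm_zero_iff)
    moreover have "p n \<in> S" for n using p[of n] by auto
    ultimately show "x \<in> closure S" using \<open>x - u = 0\<close> unfolding closure_sequential by auto
  qed auto
  then show ?thesis by blast
qed

text \<open>
  The constant \<^const>\<open>adjoint\<close> is defined by choice, so its characteristic property has to be derived
  from the existence of some adjoint, which the Riesz theorem provides.
\<close>

lemma adjoint_blinfun_works:
  fixes B :: "'a::{real_inner, banach} \<Rightarrow>\<^sub>L 'b::{real_inner, banach}"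
  shows "inner (blinfun_apply B x) y = inner x (adjoint (blinfun_apply B) y)"
proof -
  have "\<exists>v. \<forall>x. inner (blinfun_apply B x) y = inner x v" for y
  proof -
    have "bounded_linear (\<lambda>x. inner (blinfun_apply B x) y)"
      by (intro bounded_linear_compose[OF bounded_linear_inner_left] blinfun.bounded_linear_right)
    then show ?thesis using riesz_representation by (metis inner_commute)
  qed
  then have "\<exists>f'. \<forall>x y. inner (blinfun_apply B x) y = inner x (f' y)" by metis
  then show ?thesis unfolding adjoint_def by (rule someI2_ex) blast
qed

lemma bounded_linear_adjoint_blinfun:
  fixes B :: "'a::{real_inner, banach} \<Rightarrow>\<^sub>L 'b::{real_inner, banach}"
  shows "bounded_linear (adjoint (blinfun_apply B))"
    and "norm (adjoint (blinfun_apply B) y) \<le> norm B * norm y"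
proof -
  let ?A = "adjoint (blinfun_apply B)"
  have eqI: "u = v" if "\<And>x. inner x u = inner x v" for u v :: 'a
    using that vector_eq_ldot by blast
  have bnd: "norm (?A y) \<le> norm B * norm y" for y
  proof -
    have "norm (?A y) * norm (?A y) = inner (blinfun_apply B (?A y)) y"
      by (simp add: adjoint_blinfun_works flip: power2_norm_eq_inner power2_eq_square)
    also have "\<dots> \<le> norm (blinfun_apply B (?A y)) * norm y" by (rule norm_cauchy_schwarz)
    also have "\<dots> \<le> norm B * norm (?A y) * norm y"
      by (intro mult_right_mono norm_blinfun) auto
    finally show ?thesis
      by (cases "norm (?A y) = 0") (auto simp: mult_ac)
  qed
  show "norm (?A y) \<le> norm B * norm y" by (rule bnd)
  show "bounded_linear ?A"
  proof (rule bounded_linear_intro)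
    show "?A (x + y) = ?A x + ?A y" for x y
      by (rule eqI) (simp add: inner_add_right flip: adjoint_blinfun_works)
    show "?A (r *\<^sub>R x) = r *\<^sub>R ?A x" for r x
      by (rule eqI) (simp flip: adjoint_blinfun_works)
    show "norm (?A x) \<le> norm x * norm B" for x using bnd[of x] by (simp add: mult.commute)
  qed
qed

section \<open>Strong measurability\<close>

lemma simple_function_imp_strongly_measurable:
  "simple_function M f \<Longrightarrow> strongly_measurable M f"
  unfolding strongly_measurable_def by (intro exI[of _ "\<lambda>_. f"]) auto

lemma strongly_measurable_const: "strongly_measurable M (\<lambda>x. c)"
  by (simp add: simple_function_imp_strongly_measurable)

lemma strongly_measurable_cong_AE:
  assumes "strongly_measurable M f" "AE x in M. f x = g x"
  shows "strongly_measurable M g"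
proof -
  obtain s where s: "\<forall>n. simple_function M (s n)" "AE x in M. (\<lambda>n. s n x) \<longlonglongrightarrow> f x"
    using assms(1) unfolding strongly_measurable_def by blast
  have "AE x in M. (\<lambda>n. s n x) \<longlonglongrightarrow> g x" using s(2) assms(2) by eventually_elim simp
  with s(1) show ?thesis unfolding strongly_measurable_def by blast
qed

lemma strongly_measurable_Pair:
  assumes "strongly_measurable M f" "strongly_measurable M g"
  shows "strongly_measurable M (\<lambda>x. (f x, g x))"
proof -
  obtain s where s: "\<forall>n. simple_function M (s n)" "AE x in M. (\<lambda>n. s n x) \<longlonglongrightarrow> f x"
    using assms(1) unfolding strongly_measurable_def by blast
  obtain t where t: "\<forall>n. simple_function M (t n)" "AE x in M. (\<lambda>n. t n x) \<longlonglongrightarrow> g x"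
    using assms(2) unfolding strongly_measurable_def by blast
  have "AE x in M. (\<lambda>n. (s n x, t n x)) \<longlonglongrightarrow> (f x, g x)"
    using s(2) t(2) by eventually_elim (rule tendsto_Pair)
  moreover have "\<forall>n. simple_function M (\<lambda>x. (s n x, t n x))"
    using s(1) t(1) by (auto intro: simple_function_Pair)
  ultimately show ?thesis unfolding strongly_measurable_def by (intro exI[of _ "\<lambda>n x. (s n x, t n x)"]) auto
qed

lemma strongly_measurable_compose:
  assumes "continuous_on UNIV \<phi>" "strongly_measurable M f"
  shows "strongly_measurable M (\<lambda>x. \<phi> (f x))"
proof -
  obtain s where s: "\<forall>n. simple_function M (s n)" "AE x in M. (\<lambda>n. s n x) \<longlonglongrightarrow> f x"
    using assms(2) unfolding strongly_measurable_def by blast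
  have "AE x in M. (\<lambda>n. \<phi> (s n x)) \<longlonglongrightarrow> \<phi> (f x)"
    using s(2)
  proof eventually_elim
    case (elim x)
    have "isCont \<phi> (f x)" using assms(1) by (simp add: continuous_on_eq_continuous_at)
    then show ?case using elim by (rule isCont_tendsto_compose)
  qed
  moreover have "\<forall>n. simple_function M (\<lambda>x. \<phi> (s n x))"
    using s(1) by (auto intro: simple_function_compose1)
  ultimately show ?thesis unfolding strongly_measurable_def
    by (intro exI[of _ "\<lambda>n x. \<phi> (s n x)"]) auto
qed

lemma strongly_measurable_compose_Pair:
  assumes "continuous_on UNIV (\<lambda>p. \<phi> (fst p) (snd p))"
    and "strongly_measurable M f" "strongly_measurable M g"
  shows "strongly_measurable M (\<lambda>x. \<phi> (f x) (g x))"
  using strongly_measurable_compose[OF assms(1) strongly_measurable_Pair[OF assms(2,3)]] by simp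

lemma strongly_measurable_norm:
  "strongly_measurable M f \<Longrightarrow> strongly_measurable M (\<lambda>x. norm (f x))"
  by (rule strongly_measurable_compose) (auto intro!: continuous_intros)

lemma strongly_measurable_inner:
  fixes f g :: "'a \<Rightarrow> 'b::real_inner"
  shows "strongly_measurable M f \<Longrightarrow> strongly_measurable M g \<Longrightarrow>
    strongly_measurable M (\<lambda>x. inner (f x) (g x))"
  by (rule strongly_measurable_compose_Pair) (auto intro!: continuous_intros)

lemma strongly_measurable_comb:
  "strongly_measurable M f \<Longrightarrow> strongly_measurable M g \<Longrightarrow>
    strongly_measurable M (\<lambda>x. f x + r *\<^sub>R g x)"
  by (rule strongly_measurable_compose_Pair[where \<phi> = "\<lambda>a b. a + r *\<^sub>R b"])
     (auto intro!: continuous_intros)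

lemma strongly_measurable_diff:
  "strongly_measurable M f \<Longrightarrow> strongly_measurable M g \<Longrightarrow>
    strongly_measurable M (\<lambda>x. f x - g x)"
  using strongly_measurable_comb[of M f g "-1"] by simp

lemma strongly_measurable_If:
  assumes "strongly_measurable M f" "E \<in> sets M"
  shows "strongly_measurable M (\<lambda>x. if x \<in> E then f x else 0)"
proof -
  have "strongly_measurable M (\<lambda>x. indicat_real E x *\<^sub>R f x)"
    by (rule strongly_measurable_compose_Pair[where \<phi> = "\<lambda>a b. a *\<^sub>R b"])
       (auto intro!: continuous_intros simple_function_imp_strongly_measurable
         simple_function_indicator assms)
  then show ?thesis by (rule strongly_measurable_cong_AE) (auto simp: indicator_def)
qed

lemma borel_measurable_imp_strongly_measurable:
  fixes f :: "'a \<Rightarrow> 'b::{real_normed_vector, second_countable_topology}"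
  assumes "f \<in> borel_measurable M"
  shows "strongly_measurable M f"
proof -
  obtain F where "\<And>i. simple_function M (F i)" "\<And>x. x \<in> space M \<Longrightarrow> (\<lambda>i. F i x) \<longlonglongrightarrow> f x"
    using borel_measurable_implies_sequence_metric[OF assms, of 0] by metis
  then show ?thesis unfolding strongly_measurable_def by (intro exI[of _ F]) auto
qed

lemma complete_measure_lebesgue_on:
  assumes "S \<in> sets lebesgue"
  shows "complete_measure (lebesgue_on S)"
proof
  fix A B assume "A \<subseteq> B" "B \<in> null_sets (lebesgue_on S)"
  then have "B \<subseteq> S" "B \<in> null_sets lebesgue"
    using assms by (auto simp: null_sets_restrict_space)
  then have "A \<in> sets lebesgue" "A \<subseteq> S"
    using \<open>A \<subseteq> B\<close> completion.complete2 by blast+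
  then show "A \<in> sets (lebesgue_on S)"
    using assms by (simp add: sets_restrict_space_iff)
qed

lemma (in complete_measure) borel_measurable_cong_AE_complete:
  assumes g: "g \<in> borel_measurable M" and eq: "AE x in M. g x = f x"
  shows "f \<in> borel_measurable M"
proof (rule measurableI)
  fix A :: "'b set" assume A: "A \<in> sets borel"
  show "f -` A \<inter> space M \<in> sets M"
  proof (rule in_sets_AE)
    show "g -` A \<inter> space M \<in> sets M" using g A by (rule measurable_sets)
    show "AE x in M. x \<in> g -` A \<inter> space M \<longleftrightarrow> x \<in> f -` A \<inter> space M"
      using eq by eventually_elim simp
  qed auto
qed auto

lemma (in complete_measure) strongly_measurable_imp_borel_measurable:
  fixes f :: "'a \<Rightarrow> real"
  assumes "strongly_measurable M f"
  shows "f \<in> borel_measurable M"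
proof -
  obtain s where s: "\<And>n. simple_function M (s n)" "AE x in M. (\<lambda>n. s n x) \<longlonglongrightarrow> f x"
    using assms unfolding strongly_measurable_def by blast
  have "(\<lambda>x. lim (\<lambda>n. s n x)) \<in> borel_measurable M"
    by (intro borel_measurable_lim_metric borel_measurable_simple_function s)
  moreover have "AE x in M. lim (\<lambda>n. s n x) = f x"
    using s(2) by eventually_elim (rule limI)
  ultimately show ?thesis by (rule borel_measurable_cong_AE_complete)
qed

text \<open>
  An approximating sequence is set to \<open>0\<close> wherever it exceeds twice the norm of the limit.  It stays
  simple because the norm of the limit is measurable, and it becomes fit for dominated convergence.
\<close>

lemma (in complete_measure) strongly_measurable_dominated_approx:
  fixes f :: "'a \<Rightarrow> 'b::real_normed_vector"
  assumes "strongly_measurable M f"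
  obtains s where "\<And>n::nat. simple_function M (s n)" "\<And>n x. norm (s n x) \<le> 2 * norm (f x)"
    "AE x in M. (\<lambda>n. s n x) \<longlonglongrightarrow> f x"
proof -
  obtain s where s: "\<And>n::nat. simple_function M (s n)" "AE x in M. (\<lambda>n. s n x) \<longlonglongrightarrow> f x"
    using assms unfolding strongly_measurable_def by blast
  define E where "E n = {x \<in> space M. norm (s n x) \<le> 2 * norm (f x)}" for n
  have [measurable]: "(\<lambda>x. norm (f x)) \<in> borel_measurable M"
    by (rule strongly_measurable_imp_borel_measurable[OF strongly_measurable_norm[OF assms]])
  have [measurable]: "(\<lambda>x. norm (s n x)) \<in> borel_measurable M" for n
    by (rule borel_measurable_simple_function[OF simple_function_compose1[OF s(1)]])
  have E: "E n \<in> sets M" for n unfolding E_def by measurable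
  define s' where "s' n x = indicat_real (E n) x *\<^sub>R s n x" for n x
  have 1: "simple_function M (s' n)" for n
    unfolding s'_def using E[of n] s(1)[of n]
    by (intro simple_function_compose2[where h = scaleR] simple_function_indicator) auto
  have 2: "norm (s' n x) \<le> 2 * norm (f x)" for n x
    by (auto simp: s'_def E_def indicator_def)
  have "AE x in M. (\<lambda>n. s' n x) \<longlonglongrightarrow> f x"
    using s(2) AE_space
  proof eventually_elim
    case (elim x)
    show ?case
    \<comment> \<open>for \<open>f x \<noteq> 0\<close> the truncation is eventually inactive at \<open>x\<close>\<close>
    proof (cases "f x = 0")
      case True
      then have "s' n x = 0" for n using 2[of n x] by simp
      then show ?thesis using True by simp
    next
      case False
      have "(\<lambda>n. norm (s n x)) \<longlonglongrightarrow> norm (f x)" by (intro tendsto_norm elim)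
      then have "eventually (\<lambda>n. norm (s n x) < 2 * norm (f x)) sequentially"
        by (rule order_tendstoD) (use False in auto)
      then have "eventually (\<lambda>n. s n x = s' n x) sequentially"
        by eventually_elim (use elim in \<open>auto simp: s'_def E_def indicator_def\<close>)
      then show ?thesis using elim(1) by (rule Lim_transform_eventually[rotated])
    qed
  qed
  with 1 2 show ?thesis using that by blast
qed

section \<open>Square integrable functions\<close>

lemma complete_measure_interval: "complete_measure (lebesgue_on {a..b::real})"
  by (rule complete_measure_lebesgue_on) simp

lemma finite_measure_interval: "finite_measure (lebesgue_on {a..b::real})"
  by (rule finite_measure_lebesgue_on) simp

lemmas borel_measurable_if_strongly_measurable =
  complete_measure.strongly_measurable_imp_borel_measurable[OF complete_measure_interval]

lemma L2_strongly_measurable: "f \<in> L2 T \<Longrightarrow> strongly_measurable (lebesgue_on {0..T}) f"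
  and L2_integrable_square: "f \<in> L2 T \<Longrightarrow> integrable (lebesgue_on {0..T}) (\<lambda>t. (norm (f t))\<^sup>2)"
  by (auto simp: L2_def)

lemma L2_dominatedI:
  assumes f: "strongly_measurable (lebesgue_on {0..T}) f"
    and h: "integrable (lebesgue_on {0..T}) h"
    and le: "\<And>t. t \<in> {0..T} \<Longrightarrow> (norm (f t))\<^sup>2 \<le> h t"
  shows "f \<in> L2 T"
proof -
  have [measurable]: "(\<lambda>t. norm (f t)) \<in> borel_measurable (lebesgue_on {0..T})"
    by (intro borel_measurable_if_strongly_measurable strongly_measurable_norm f)
  have "integrable (lebesgue_on {0..T}) (\<lambda>t. (norm (f t))\<^sup>2)"
  proof (rule Bochner_Integration.integrable_bound[OF h])
    show "AE t in lebesgue_on {0..T}. norm ((norm (f t))\<^sup>2) \<le> norm (h t)"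
    proof (rule AE_I2)
      fix t assume "t \<in> space (lebesgue_on {0..T})"
      then have "(norm (f t))\<^sup>2 \<le> h t" using le by simp
      then show "norm ((norm (f t))\<^sup>2) \<le> norm (h t)" by simp
    qed
  qed measurable
  then show ?thesis using f by (simp add: L2_def)
qed

lemma norm_comb_square_le:
  fixes a b :: "'a::real_normed_vector"
  shows "(norm (a + r *\<^sub>R b))\<^sup>2 \<le> 2 * (norm a)\<^sup>2 + 2 * r\<^sup>2 * (norm b)\<^sup>2"
proof -
  have "(norm (a + r *\<^sub>R b))\<^sup>2 \<le> (norm a + \<bar>r\<bar> * norm b)\<^sup>2"
    by (intro power_mono) (auto intro: norm_triangle_le)
  also have "\<dots> \<le> 2 * (norm a)\<^sup>2 + 2 * r\<^sup>2 * (norm b)\<^sup>2"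
    using sum_squares_bound[of "norm a" "\<bar>r\<bar> * norm b"]
    by (simp add: power2_sum power_mult_distrib)
  finally show ?thesis .
qed

lemma L2_comb:
  assumes "f \<in> L2 T" "g \<in> L2 T"
  shows "(\<lambda>t. f t + r *\<^sub>R g t) \<in> L2 T"
proof (rule L2_dominatedI)
  show "integrable (lebesgue_on {0..T}) (\<lambda>t. 2 * (norm (f t))\<^sup>2 + 2 * r\<^sup>2 * (norm (g t))\<^sup>2)"
    by (intro Bochner_Integration.integrable_add integrable_mult_right L2_integrable_square assms)
qed (auto intro: strongly_measurable_comb L2_strongly_measurable assms norm_comb_square_le)

lemma L2_zero: "(\<lambda>t. 0) \<in> L2 T"
  by (simp add: L2_def strongly_measurable_const)

lemma L2_diff: "f \<in> L2 T \<Longrightarrow> g \<in> L2 T \<Longrightarrow> (\<lambda>t. f t - g t) \<in> L2 T"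
  using L2_comb[of f T g "-1"] by simp

lemma L2_add: "f \<in> L2 T \<Longrightarrow> g \<in> L2 T \<Longrightarrow> (\<lambda>t. f t + g t) \<in> L2 T"
  using L2_comb[of f T g "1"] by simp

lemma L2_cong_AE:
  assumes "f \<in> L2 T" "AE t in lebesgue_on {0..T}. f t = g t"
  shows "g \<in> L2 T"
proof -
  have g: "strongly_measurable (lebesgue_on {0..T}) g"
    using L2_strongly_measurable[OF assms(1)] assms(2) by (rule strongly_measurable_cong_AE)
  have [measurable]: "(\<lambda>t. norm (f t)) \<in> borel_measurable (lebesgue_on {0..T})"
    "(\<lambda>t. norm (g t)) \<in> borel_measurable (lebesgue_on {0..T})"
    by (intro borel_measurable_if_strongly_measurable strongly_measurable_norm g
        L2_strongly_measurable[OF assms(1)])+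
  have "AE t in lebesgue_on {0..T}. (norm (f t))\<^sup>2 = (norm (g t))\<^sup>2"
    using assms(2) by eventually_elim simp
  then have "integrable (lebesgue_on {0..T}) (\<lambda>t. (norm (g t))\<^sup>2)"
    using L2_integrable_square[OF assms(1)] by (subst integrable_cong_AE[symmetric]) auto
  then show ?thesis using g by (simp add: L2_def)
qed

lemma L2_inner_integrable:
  fixes f g :: "real \<Rightarrow> 'a::real_inner"
  assumes "f \<in> L2 T" "g \<in> L2 T"
  shows "integrable (lebesgue_on {0..T}) (\<lambda>t. inner (f t) (g t))"
proof (rule Bochner_Integration.integrable_bound)
  show "integrable (lebesgue_on {0..T}) (\<lambda>t. (norm (f t))\<^sup>2 + (norm (g t))\<^sup>2)"
    by (intro Bochner_Integration.integrable_add L2_integrable_square assms)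
  show "(\<lambda>t. inner (f t) (g t)) \<in> borel_measurable (lebesgue_on {0..T})"
    by (intro borel_measurable_if_strongly_measurable strongly_measurable_inner
        L2_strongly_measurable assms)
  have "\<bar>inner a b\<bar> \<le> (norm a)\<^sup>2 + (norm b)\<^sup>2" for a b :: 'a
  proof -
    have "0 \<le> (norm a)\<^sup>2" "0 \<le> (norm b)\<^sup>2" by simp_all
    with Cauchy_Schwarz_ineq2[of a b] sum_squares_bound[of "norm a" "norm b"]
      show ?thesis using mult_nonneg_nonneg[of "norm a" "norm b"] by simp
  qed
  then show "AE t in lebesgue_on {0..T}. norm (inner (f t) (g t)) \<le> norm ((norm (f t))\<^sup>2 + (norm (g t))\<^sup>2)"
    by (intro AE_I2) (simp)
qed

lemma L2_norm_integrable:
  assumes "f \<in> L2 T"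
  shows "integrable (lebesgue_on {0..T}) (\<lambda>t. norm (f t))"
proof (rule Bochner_Integration.integrable_bound)
  interpret finite_measure "lebesgue_on {0..T}" by (rule finite_measure_interval)
  show "integrable (lebesgue_on {0..T}) (\<lambda>t. 1 + (norm (f t))\<^sup>2)"
    by (intro Bochner_Integration.integrable_add L2_integrable_square assms integrable_const)
  show "(\<lambda>t. norm (f t)) \<in> borel_measurable (lebesgue_on {0..T})"
    by (intro borel_measurable_if_strongly_measurable strongly_measurable_norm
        L2_strongly_measurable assms)
  have "\<bar>x\<bar> \<le> 1 + x\<^sup>2" for x :: real
    using sum_squares_bound[of 1 "\<bar>x\<bar>"] by simp
  then show "AE t in lebesgue_on {0..T}. norm (norm (f t)) \<le> norm (1 + (norm (f t))\<^sup>2)"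
    by (intro AE_I2) (use abs_ge_self order_trans in \<open>fastforce\<close>)
qed

lemma L2_norm_nonneg: "0 \<le> L2_norm T f"
  by (simp add: L2_norm_def integral_nonneg_AE)

lemma L2_norm_eq_sqrt_inner: "L2_norm T f = sqrt (L2_inner T f f)"
  by (simp add: L2_norm_def L2_inner_def power2_norm_eq_inner)

lemma L2_inner_self: "L2_inner T f f = (L2_norm T f)\<^sup>2"
  by (simp add: L2_norm_def L2_inner_def power2_norm_eq_inner integral_nonneg_AE)

lemma L2_inner_commute: "L2_inner T f g = L2_inner T g f"
  by (simp add: L2_inner_def inner_commute)

lemma L2_inner_comb:
  assumes "f \<in> L2 T" "g \<in> L2 T" "h \<in> L2 T"
  shows "L2_inner T (\<lambda>t. f t + r *\<^sub>R g t) h = L2_inner T f h + r * L2_inner T g h"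
  unfolding L2_inner_def using L2_inner_integrable[OF assms(1,3)] L2_inner_integrable[OF assms(2,3)]
  by (simp add: inner_add_left)

lemma L2_norm_eq_0D:
  assumes "f \<in> L2 T" "L2_norm T f = 0"
  shows "AE t in lebesgue_on {0..T}. f t = 0"
proof -
  have "(LINT t|lebesgue_on {0..T}. (norm (f t))\<^sup>2) = 0"
    using assms(2) by (simp add: L2_norm_def)
  then have "AE t in lebesgue_on {0..T}. (norm (f t))\<^sup>2 = 0"
    using integral_nonneg_eq_0_iff_AE[OF L2_integrable_square[OF assms(1)]] by simp
  then show ?thesis by eventually_elim simp
qed

lemma L2_simple_approx:
  fixes f :: "real \<Rightarrow> 'a::real_normed_vector"
  assumes f: "f \<in> L2 T" and "e > 0"
  obtains s where "simple_function (lebesgue_on {0..T}) s" "s \<in> L2 T" "L2_norm T (\<lambda>t. f t - s t) < e"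
proof -
  let ?M = "lebesgue_on {0..T}"
  interpret complete_measure ?M by (rule complete_measure_interval)
  obtain s where s: "\<And>n::nat. simple_function ?M (s n)" "\<And>n x. norm (s n x) \<le> 2 * norm (f x)"
    "AE x in ?M. (\<lambda>n. s n x) \<longlonglongrightarrow> f x"
    using strongly_measurable_dominated_approx[OF L2_strongly_measurable[OF f]] by blast
  have sL2: "s n \<in> L2 T" for n
  proof (rule L2_dominatedI)
    show "integrable ?M (\<lambda>t. 4 * (norm (f t))\<^sup>2)" using L2_integrable_square[OF f] by simp
    show "(norm (s n t))\<^sup>2 \<le> 4 * (norm (f t))\<^sup>2" for t
      using power_mono[OF s(2)[of n t], of 2] by (simp add: power_mult_distrib)
  qed (simp add: simple_function_imp_strongly_measurable s)
  have "(\<lambda>n. LINT t|?M. (norm (f t - s n t))\<^sup>2) \<longlonglongrightarrow> (LINT t|?M. 0)"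
  proof (rule integral_dominated_convergence[where w = "\<lambda>t. 9 * (norm (f t))\<^sup>2"])
    show "(\<lambda>t. (norm (f t - s n t))\<^sup>2) \<in> borel_measurable ?M" for n
      using L2_integrable_square[OF L2_diff[OF f sL2]] by auto
    show "integrable ?M (\<lambda>t. 9 * (norm (f t))\<^sup>2)" using L2_integrable_square[OF f] by simp
    show "AE t in ?M. (\<lambda>n. (norm (f t - s n t))\<^sup>2) \<longlonglongrightarrow> 0"
      using s(3)
    proof eventually_elim
      case (elim t)
      have "(\<lambda>n. (norm (f t - s n t))\<^sup>2) \<longlonglongrightarrow> (norm (f t - f t))\<^sup>2"
        by (intro tendsto_intros elim)
      then show ?case by simp
    qed
    show "AE t in ?M. norm ((norm (f t - s n t))\<^sup>2) \<le> 9 * (norm (f t))\<^sup>2" for n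
    proof (rule AE_I2)
      fix t
      have "norm (f t - s n t) \<le> 3 * norm (f t)"
        using norm_triangle_ineq4[of "f t" "s n t"] s(2)[of n t] by simp
      from power_mono[OF this, of 2] show "norm ((norm (f t - s n t))\<^sup>2) \<le> 9 * (norm (f t))\<^sup>2"
        by (simp add: power_mult_distrib)
    qed
  qed auto
  from tendsto_real_sqrt[OF this] have "(\<lambda>n. L2_norm T (\<lambda>t. f t - s n t)) \<longlonglongrightarrow> 0"
    by (simp add: L2_norm_def)
  then have "eventually (\<lambda>n. L2_norm T (\<lambda>t. f t - s n t) < e) sequentially"
    by (rule order_tendstoD) (use \<open>e > 0\<close> in auto)
  then obtain n where "L2_norm T (\<lambda>t. f t - s n t) < e"
    using eventually_happens' sequentially_bot by blast
  then show ?thesis using that s(1) sL2 by blast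
qed

interpretation L2: semi_inner "L2 T" "\<lambda>r f g t. f t + r *\<^sub>R g t" "L2_inner T"
  for T :: real
proof
  fix a :: "real \<Rightarrow> 'a"
  show "0 \<le> L2_inner T a a" by (simp add: L2_inner_self)
qed (auto simp: L2_comb L2_inner_comb intro: L2_inner_commute)

lemma L2_norm_triangle_comb:
  fixes f g :: "real \<Rightarrow> 'a::real_inner"
  assumes "f \<in> L2 T" "g \<in> L2 T"
  shows "L2_norm T (\<lambda>t. f t + r *\<^sub>R g t) \<le> L2_norm T f + \<bar>r\<bar> * L2_norm T g"
  unfolding L2_norm_eq_sqrt_inner by (rule L2.triangle_comb[OF assms])

lemma L2_cauchy_schwarz:
  fixes f g :: "real \<Rightarrow> 'a::real_inner"
  assumes "f \<in> L2 T" "g \<in> L2 T"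
  shows "\<bar>L2_inner T f g\<bar> \<le> L2_norm T f * L2_norm T g"
  unfolding L2_norm_eq_sqrt_inner by (rule L2.cauchy_schwarz[OF assms])

lemma L2_norm_diff_commute: "L2_norm T (\<lambda>t. f t - g t) = L2_norm T (\<lambda>t. g t - f t)"
  by (simp add: L2_norm_def norm_minus_commute)

lemma L2_norm_diff_triangle:
  fixes f g h :: "real \<Rightarrow> 'a::real_inner"
  assumes "f \<in> L2 T" "g \<in> L2 T" "h \<in> L2 T"
  shows "L2_norm T (\<lambda>t. f t - h t) \<le> L2_norm T (\<lambda>t. f t - g t) + L2_norm T (\<lambda>t. g t - h t)"
  using L2_norm_triangle_comb[OF L2_diff[OF assms(1,2)] L2_diff[OF assms(2,3)], of 1] by simp

lemma L2_norm_L1_bound: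
  fixes f :: "real \<Rightarrow> 'a::real_inner"
  assumes "f \<in> L2 T"
  shows "(LINT t|lebesgue_on {0..T}. norm (f t)) \<le> L2_norm T f * L2_norm T (\<lambda>_. 1::real)"
proof -
  have "(\<lambda>t. norm (f t)) \<in> L2 T"
    using assms by (simp add: L2_def strongly_measurable_norm)
  moreover have "(\<lambda>_. 1::real) \<in> L2 T"
    by (rule L2_dominatedI[where h = "\<lambda>_. 1"])
       (auto simp: strongly_measurable_const finite_measure.integrable_const[OF finite_measure_interval])
  ultimately have "\<bar>L2_inner T (\<lambda>t. norm (f t)) (\<lambda>_. 1)\<bar> \<le> L2_norm T (\<lambda>t. norm (f t)) * L2_norm T (\<lambda>_. 1::real)"
    by (rule L2_cauchy_schwarz)
  then show ?thesis by (simp add: L2_inner_def L2_norm_def)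
qed

text \<open>
  On a bounded interval the \<open>L\<^sup>2\<close> norm dominates the \<open>L\<^sup>1\<close> norm, so the sum of the norms of the
  increments has a finite integral and is therefore finite almost everywhere.
\<close>

lemma AE_convergent_if_summable_L2_increments:
  fixes s :: "nat \<Rightarrow> real \<Rightarrow> 'a::{real_inner, banach}"
  assumes s: "\<And>n. s n \<in> L2 T"
    and inc: "\<And>n. L2_norm T (\<lambda>t. s (Suc n) t - s n t) \<le> c n" and c: "summable c"
  shows "AE t in lebesgue_on {0..T}. convergent (\<lambda>n. s n t)"
proof -
  let ?M = "lebesgue_on {0..T}"
  define d where "d n t = norm (s (Suc n) t - s n t)" for n t
  define K where "K = L2_norm T (\<lambda>_. 1::real)"
  have dint: "integrable ?M (d n)" for n
    unfolding d_def by (intro L2_norm_integrable L2_diff s)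
  have [measurable]: "d n \<in> borel_measurable ?M" for n
    by (rule borel_measurable_integrable[OF dint])
  have c0: "0 \<le> c n" for n by (rule order_trans[OF L2_norm_nonneg inc])
  have "(\<integral>\<^sup>+t. (\<Sum>n. ennreal (d n t)) \<partial>?M) = (\<Sum>n. \<integral>\<^sup>+t. ennreal (d n t) \<partial>?M)"
    by (intro nn_integral_suminf) measurable
  also have "\<dots> = (\<Sum>n. ennreal (LINT t|?M. d n t))"
    by (intro suminf_cong nn_integral_eq_integral dint AE_I2) (simp add: d_def)
  also have "\<dots> \<le> (\<Sum>n. ennreal (c n * K))"
  proof (intro suminf_le ennreal_leI)
    fix n
    have "(LINT t|?M. d n t) \<le> L2_norm T (\<lambda>t. s (Suc n) t - s n t) * K"
      unfolding d_def K_def by (intro L2_norm_L1_bound L2_diff s)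
    also have "\<dots> \<le> c n * K"
      by (intro mult_right_mono inc) (simp add: K_def L2_norm_nonneg)
    finally show "(LINT t|?M. d n t) \<le> c n * K" .
  qed auto
  also have "\<dots> < \<infinity>"
  proof -
    have "(\<Sum>n. ennreal (c n * K)) \<noteq> top"
      using c0 by (intro ennreal_suminf_neq_top summable_mult2 c) (simp add: K_def L2_norm_nonneg)
    then show ?thesis by (simp add: less_top[symmetric])
  qed
  finally have fin: "(\<integral>\<^sup>+t. (\<Sum>n. ennreal (d n t)) \<partial>?M) < \<infinity>" .
  have "(\<lambda>t. \<Sum>n. ennreal (d n t)) \<in> borel_measurable ?M" by measurable
  then have "AE t in ?M. (\<Sum>n. ennreal (d n t)) \<noteq> \<infinity>"
    by (rule nn_integral_PInf_AE) (use fin in simp)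
  then show ?thesis
  proof eventually_elim
    case (elim t)
    then have "summable (\<lambda>n. norm (s (Suc n) t - s n t))"
      using summable_suminf_not_top[of "\<lambda>n. d n t"] by (simp add: d_def)
    then have "summable (\<lambda>n. s (Suc n) t - s n t)" by (rule summable_norm_cancel)
    then have "(\<lambda>n. (\<Sum>i<n. s (Suc i) t - s i t) + s 0 t) \<longlonglongrightarrow> (\<Sum>i. s (Suc i) t - s i t) + s 0 t"
      by (intro tendsto_intros summable_LIMSEQ)
    then show ?case by (auto simp: sum_lessThan_telescope[of "\<lambda>n. s n t"] convergent_def)
  qed
qed

text \<open>
  This is Fatou's lemma for the squared distance to \<open>g\<close>.  It puts the pointwise limit into \<open>L2 T\<close>, and
  with \<open>g\<close> a member of a Cauchy sequence it turns pointwise convergence into convergence in norm.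
\<close>

lemma L2_lower_semicontinuous:
  fixes s :: "nat \<Rightarrow> real \<Rightarrow> 'a::{real_inner, banach}"
  assumes s: "\<And>n. s n \<in> L2 T" and g: "g \<in> L2 T"
    and u: "strongly_measurable (lebesgue_on {0..T}) u"
    and lim: "AE t in lebesgue_on {0..T}. (\<lambda>n. s n t) \<longlonglongrightarrow> u t"
    and bound: "eventually (\<lambda>n. L2_norm T (\<lambda>t. s n t - g t) \<le> B) sequentially"
  shows "u \<in> L2 T" "L2_norm T (\<lambda>t. u t - g t) \<le> B"
proof -
  let ?M = "lebesgue_on {0..T}"
  have B0: "0 \<le> B"
  proof -
    obtain n where "L2_norm T (\<lambda>t. s n t - g t) \<le> B"
      using eventually_happens'[OF sequentially_bot bound] by blast
    then show ?thesis by (rule order_trans[OF L2_norm_nonneg])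
  qed
  have sint: "integrable ?M (\<lambda>t. (norm (s n t - g t))\<^sup>2)" for n
    by (intro L2_integrable_square L2_diff s g)
  have ug: "strongly_measurable ?M (\<lambda>t. u t - g t)"
    by (intro strongly_measurable_diff u L2_strongly_measurable g)
  have [measurable]: "(\<lambda>t. norm (u t - g t)) \<in> borel_measurable ?M"
    by (intro borel_measurable_if_strongly_measurable strongly_measurable_norm ug)
  have "(\<integral>\<^sup>+t. ennreal ((norm (u t - g t))\<^sup>2) \<partial>?M)
      = (\<integral>\<^sup>+t. liminf (\<lambda>n. ennreal ((norm (s n t - g t))\<^sup>2)) \<partial>?M)"
  proof (rule nn_integral_cong_AE)
    show "AE t in ?M. ennreal ((norm (u t - g t))\<^sup>2) = liminf (\<lambda>n. ennreal ((norm (s n t - g t))\<^sup>2))"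
      using lim
    proof eventually_elim
      case (elim t)
      have "(\<lambda>n. ennreal ((norm (s n t - g t))\<^sup>2)) \<longlonglongrightarrow> ennreal ((norm (u t - g t))\<^sup>2)"
        by (intro tendsto_ennrealI tendsto_intros elim)
      then show ?case by (intro lim_imp_Liminf[symmetric]) auto
    qed
  qed
  also have "\<dots> \<le> liminf (\<lambda>n. \<integral>\<^sup>+t. ennreal ((norm (s n t - g t))\<^sup>2) \<partial>?M)"
    using sint by (intro nn_integral_liminf) auto
  also have "\<dots> \<le> liminf (\<lambda>n. ennreal (B\<^sup>2))"
  proof (rule Liminf_mono)
    show "eventually (\<lambda>n. (\<integral>\<^sup>+t. ennreal ((norm (s n t - g t))\<^sup>2) \<partial>?M) \<le> ennreal (B\<^sup>2)) sequentially"
      using bound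
    proof eventually_elim
      case (elim n)
      have "(\<integral>\<^sup>+t. ennreal ((norm (s n t - g t))\<^sup>2) \<partial>?M) = ennreal ((L2_norm T (\<lambda>t. s n t - g t))\<^sup>2)"
        using sint[of n] by (subst nn_integral_eq_integral) (auto simp: L2_norm_def integral_nonneg_AE)
      also have "\<dots> \<le> ennreal (B\<^sup>2)"
        by (intro ennreal_leI power_mono elim L2_norm_nonneg)
      finally show ?case .
    qed
  qed
  also have "\<dots> = ennreal (B\<^sup>2)" by (simp add: Liminf_const)
  finally have le: "(\<integral>\<^sup>+t. ennreal ((norm (u t - g t))\<^sup>2) \<partial>?M) \<le> ennreal (B\<^sup>2)" .
  have int: "integrable ?M (\<lambda>t. (norm (u t - g t))\<^sup>2)"
  proof (rule integrableI_bounded)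
    show "(\<integral>\<^sup>+t. ennreal (norm ((norm (u t - g t))\<^sup>2)) \<partial>?M) < \<infinity>"
      using order_le_less_trans[OF le, of top] by simp
  qed measurable
  then have "(\<lambda>t. u t - g t) \<in> L2 T" using ug by (simp add: L2_def)
  from L2_add[OF this g] show "u \<in> L2 T" by simp
  have "ennreal (LINT t|?M. (norm (u t - g t))\<^sup>2) \<le> ennreal (B\<^sup>2)"
    using le int by (subst (asm) nn_integral_eq_integral) auto
  then have "(LINT t|?M. (norm (u t - g t))\<^sup>2) \<le> B\<^sup>2" by simp
  then show "L2_norm T (\<lambda>t. u t - g t) \<le> B"
    unfolding L2_norm_def using B0 by (intro real_le_lsqrt) auto
qed

text \<open>
  A rapidly convergent subsequence is first replaced by nearby simple functions. Their almost
  everywhere limit is then strongly measurable by definition.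
\<close>

lemma L2_complete:
  fixes q :: "nat \<Rightarrow> real \<Rightarrow> 'a::{real_inner, banach}"
  assumes q: "\<And>n. q n \<in> L2 T"
    and cau: "\<And>e. e > 0 \<Longrightarrow> \<exists>N. \<forall>m\<ge>N. \<forall>n\<ge>N. L2_norm T (\<lambda>t. q m t - q n t) < e"
  shows "\<exists>u\<in>L2 T. (\<lambda>n. L2_norm T (\<lambda>t. q n t - u t)) \<longlonglongrightarrow> 0"
proof -
  let ?M = "lebesgue_on {0..T}"
  let ?d = "\<lambda>f g. L2_norm T (\<lambda>t. f t - g t)"
  have "\<exists>k. \<forall>i\<ge>k. \<forall>j\<ge>k. ?d (q i) (q j) < (1/2) ^ n" for n
    by (rule cau) simp
  then obtain k where k: "\<And>n i j. k n \<le> i \<Longrightarrow> k n \<le> j \<Longrightarrow> ?d (q i) (q j) < (1/2) ^ n" by metis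
  \<comment> \<open>cumulative sums give indices that increase with \<open>n\<close> and still exceed \<open>k n\<close>\<close>
  define \<kappa> where "\<kappa> n = (\<Sum>i\<le>n. k i)" for n
  have k_le: "k n \<le> \<kappa> m" if "n \<le> m" for n m
    unfolding \<kappa>_def using that by (intro member_le_sum) auto
  have "\<exists>s. simple_function ?M s \<and> s \<in> L2 T \<and> ?d (q (\<kappa> n)) s < (1/2) ^ n" for n
    by (rule L2_simple_approx[OF q[of "\<kappa> n"], of "(1/2) ^ n"]) auto
  then obtain s where s: "\<And>n. simple_function ?M (s n)" "\<And>n. s n \<in> L2 T"
      and qs: "\<And>n. ?d (q (\<kappa> n)) (s n) < (1/2) ^ n" by metis
  have inc: "?d (s (Suc n)) (s n) \<le> 3 * (1/2) ^ n" for n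
  proof -
    have "?d (s (Suc n)) (s n) \<le> ?d (s (Suc n)) (q (\<kappa> (Suc n))) + ?d (q (\<kappa> (Suc n))) (s n)"
      by (intro L2_norm_diff_triangle s q)
    moreover have "?d (q (\<kappa> (Suc n))) (s n) \<le> ?d (q (\<kappa> (Suc n))) (q (\<kappa> n)) + ?d (q (\<kappa> n)) (s n)"
      by (intro L2_norm_diff_triangle s q)
    moreover have "?d (s (Suc n)) (q (\<kappa> (Suc n))) < (1/2) ^ Suc n"
      using qs[of "Suc n"] L2_norm_diff_commute[of T "s (Suc n)"] by simp
    moreover have "?d (q (\<kappa> (Suc n))) (q (\<kappa> n)) < (1/2) ^ n" by (intro k k_le) auto
    moreover have "?d (q (\<kappa> n)) (s n) < (1/2) ^ n" by (rule qs)
    moreover have "(1/2 :: real) ^ Suc n \<le> (1/2) ^ n" by simp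
    ultimately show ?thesis by linarith
  qed
  have far: "?d (s (n + m)) (s n) \<le> 6 * (1/2) ^ n - 6 * (1/2) ^ (n + m)" for n m
  proof (induction m)
    case (Suc m)
    have "?d (s (n + Suc m)) (s n) \<le> ?d (s (Suc (n + m))) (s (n + m)) + ?d (s (n + m)) (s n)"
      using L2_norm_diff_triangle[OF s(2) s(2) s(2)] by simp
    with inc[of "n + m"] Suc show ?case by simp
  qed (simp add: L2_norm_def)
  define u where "u t = lim (\<lambda>n. s n t)" for t
  have "summable (\<lambda>n. 3 * (1/2::real) ^ n)" by (intro summable_mult summable_geometric) simp
  from AE_convergent_if_summable_L2_increments[OF s(2) inc this]
  have lim: "AE t in ?M. (\<lambda>n. s n t) \<longlonglongrightarrow> u t"
    by eventually_elim (simp add: u_def convergent_LIMSEQ_iff)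
  then have u: "strongly_measurable ?M u"
    unfolding strongly_measurable_def using s(1) by blast
  have "eventually (\<lambda>m. ?d (s m) (s n) \<le> 6 * (1/2) ^ n) sequentially" for n
  proof (rule eventually_sequentiallyI[of n])
    fix m assume "n \<le> m"
    then obtain m' where m: "m = n + m'" using le_Suc_ex by blast
    have "0 \<le> (1/2 :: real) ^ (n + m')" by simp
    with far[of n m'] show "?d (s m) (s n) \<le> 6 * (1/2) ^ n" unfolding m by linarith
  qed
  from L2_lower_semicontinuous[OF s(2) s(2) u lim this]
  have uL2: "u \<in> L2 T" and us: "\<And>n. ?d u (s n) \<le> 6 * (1/2) ^ n" by blast+
  have qu: "?d (q i) u \<le> 8 * (1/2) ^ n" if "\<kappa> n \<le> i" for i n
  proof -
    have "?d (q i) u \<le> ?d (q i) (q (\<kappa> n)) + ?d (q (\<kappa> n)) u"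
      by (intro L2_norm_diff_triangle q uL2)
    also have "?d (q (\<kappa> n)) u \<le> ?d (q (\<kappa> n)) (s n) + ?d (s n) u"
      by (intro L2_norm_diff_triangle q uL2 s)
    also have "?d (q i) (q (\<kappa> n)) < (1/2) ^ n"
      using k_le[of n n] that by (intro k) auto
    also have "?d (q (\<kappa> n)) (s n) < (1/2) ^ n" by (rule qs)
    also have "?d (s n) u \<le> 6 * (1/2) ^ n" using us[of n] L2_norm_diff_commute[of T u] by simp
    finally show ?thesis by simp
  qed
  have "(\<lambda>n. ?d (q n) u) \<longlonglongrightarrow> 0"
  proof (rule LIMSEQ_I)
    fix e :: real assume "0 < e"
    then obtain n where n: "(1/2) ^ n < e / 8"
      using real_arch_pow_inv[of "e / 8" "1/2"] by auto
    show "\<exists>N. \<forall>i\<ge>N. norm (?d (q i) u - 0) < e"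
    proof (intro exI[of _ "\<kappa> n"] allI impI)
      fix i assume "\<kappa> n \<le> i"
      from qu[OF this] n L2_norm_nonneg[of T "\<lambda>t. q i t - u t"]
      show "norm (?d (q i) u - 0) < e" by simp
    qed
  qed
  with uL2 show ?thesis by blast
qed

interpretation L2: complete_semi_inner
  "L2 T :: (real \<Rightarrow> 'a::{real_inner, banach}) set" "\<lambda>r f g t. f t + r *\<^sub>R g t" "L2_inner T"
  for T :: real
proof
  fix q :: "nat \<Rightarrow> real \<Rightarrow> 'a"
  assume q: "\<And>n. q n \<in> L2 T"
    and cau: "\<And>e. e > 0 \<Longrightarrow> \<exists>N. \<forall>m\<ge>N. \<forall>n\<ge>N.
        L2_inner T (\<lambda>t. q m t + (-1) *\<^sub>R q n t) (\<lambda>t. q m t + (-1) *\<^sub>R q n t) < e"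
  have "\<exists>u\<in>L2 T. (\<lambda>n. L2_norm T (\<lambda>t. q n t - u t)) \<longlonglongrightarrow> 0"
  proof (rule L2_complete[OF q])
    fix e :: real assume "0 < e"
    then have "0 < e\<^sup>2" by simp
    from cau[OF this] obtain N
      where "\<And>m n. m \<ge> N \<Longrightarrow> n \<ge> N \<Longrightarrow> (L2_norm T (\<lambda>t. q m t - q n t))\<^sup>2 < e\<^sup>2"
      by (auto simp: L2_inner_self)
    then show "\<exists>N. \<forall>m\<ge>N. \<forall>n\<ge>N. L2_norm T (\<lambda>t. q m t - q n t) < e"
      using \<open>0 < e\<close> by (meson power_less_imp_less_base less_imp_le)
  qed
  then obtain u where u: "u \<in> L2 T" "(\<lambda>n. L2_norm T (\<lambda>t. q n t - u t)) \<longlonglongrightarrow> 0" by blast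
  have "(\<lambda>n. (L2_norm T (\<lambda>t. q n t - u t))\<^sup>2) \<longlonglongrightarrow> 0"
    using tendsto_power[OF u(2), of 2] by simp
  with u(1) show "\<exists>u\<in>L2 T. (\<lambda>n. L2_inner T (\<lambda>t. q n t + (-1) *\<^sub>R u t) (\<lambda>t. q n t + (-1) *\<^sub>R u t)) \<longlonglongrightarrow> 0"
    by (intro bexI[of _ u]) (simp_all add: L2_inner_self)
qed

lemma strongly_measurable_ident: "strongly_measurable (lebesgue_on S) (\<lambda>s::real. s)"
  by (rule borel_measurable_imp_strongly_measurable)
     (rule id_borel_measurable_lebesgue_on[unfolded id_def])

lemma L2_inner_cong:
  assumes "\<And>t. t \<in> {0..T} \<Longrightarrow> inner (f t) (g t) = inner (f' t) (g' t)"
  shows "L2_inner T f g = L2_inner T f' g'"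
  unfolding L2_inner_def by (rule Bochner_Integration.integral_cong) (use assms in auto)

lemma L2_norm_cong:
  assumes "\<And>t. t \<in> {0..T} \<Longrightarrow> f t = g t"
  shows "L2_norm T f = L2_norm T g"
  unfolding L2_norm_def
  by (rule arg_cong[where f = sqrt], rule Bochner_Integration.integral_cong) (use assms in auto)

lemma L2_cong:
  assumes "f \<in> L2 T" "\<And>t. t \<in> {0..T} \<Longrightarrow> f t = g t"
  shows "g \<in> L2 T"
  using assms(1) by (rule L2_cong_AE) (use assms(2) in \<open>auto intro!: AE_I2\<close>)

lemma continuous_on_imp_L2:
  fixes h :: "real \<Rightarrow> 'a::real_normed_vector"
  assumes "continuous_on {0..T} h" "0 \<le> T"
  shows "h \<in> L2 T"
proof -
  let ?c = "\<lambda>t. max 0 (min T t)"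
  have "continuous_on UNIV (\<lambda>t. h (?c t))"
    by (rule continuous_on_compose2[OF assms(1)]) (use assms(2) in \<open>auto intro!: continuous_intros\<close>)
  from strongly_measurable_compose[OF this strongly_measurable_ident]
  have "strongly_measurable (lebesgue_on {0..T}) (\<lambda>t. h (?c t))" .
  then have m: "strongly_measurable (lebesgue_on {0..T}) h"
    by (rule strongly_measurable_cong_AE) (auto intro!: AE_I2)
  have "bounded (h ` {0..T})"
    by (intro compact_imp_bounded compact_continuous_image assms) simp
  then obtain K where "\<forall>t\<in>{0..T}. norm (h t) \<le> K" unfolding bounded_iff by blast
  then have K: "norm (h t) \<le> K" if "t \<in> {0..T}" for t using that by blast
  show ?thesis
  proof (rule L2_dominatedI[OF m])
    show "integrable (lebesgue_on {0..T}) (\<lambda>t. K\<^sup>2)"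
      by (rule finite_measure.integrable_const[OF finite_measure_interval])
  qed (intro power_mono K; simp)
qed

lemma L2_inner_comb_right:
  assumes "f \<in> L2 T" "g \<in> L2 T" "h \<in> L2 T"
  shows "L2_inner T h (\<lambda>t. f t + r *\<^sub>R g t) = L2_inner T h f + r * L2_inner T h g"
  using L2_inner_comb[OF assms] by (simp add: L2_inner_commute[of T h])

lemma L2_norm_mono:
  assumes "f \<in> L2 T" "g \<in> L2 T" "\<And>t. norm (f t) \<le> norm (g t)"
  shows "L2_norm T f \<le> L2_norm T g"
  unfolding L2_norm_def
  by (intro real_sqrt_le_mono integral_mono L2_integrable_square assms power_mono) auto

lemma L2_Pair:
  assumes "f \<in> L2 T" "g \<in> L2 T"
  shows "(\<lambda>t. (f t, g t)) \<in> L2 T"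
proof (rule L2_dominatedI)
  show "strongly_measurable (lebesgue_on {0..T}) (\<lambda>t. (f t, g t))"
    by (intro strongly_measurable_Pair L2_strongly_measurable assms)
  show "integrable (lebesgue_on {0..T}) (\<lambda>t. (norm (f t))\<^sup>2 + (norm (g t))\<^sup>2)"
    by (intro Bochner_Integration.integrable_add L2_integrable_square assms)
qed (simp add: norm_Pair)

lemma L2_compose_bounded_linear:
  assumes h: "bounded_linear h" and f: "f \<in> L2 T"
  shows "(\<lambda>t. h (f t)) \<in> L2 T"
proof -
  obtain K where K: "\<And>x. norm (h x) \<le> norm x * K" using bounded_linear.bounded[OF h] by blast
  show ?thesis
  proof (rule L2_dominatedI)
    show "strongly_measurable (lebesgue_on {0..T}) (\<lambda>t. h (f t))"
      by (intro strongly_measurable_compose[OF linear_continuous_on[OF h]] L2_strongly_measurable f)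
    show "integrable (lebesgue_on {0..T}) (\<lambda>t. (norm (f t))\<^sup>2 * K\<^sup>2)"
      by (intro integrable_mult_left L2_integrable_square f)
    show "(norm (h (f t)))\<^sup>2 \<le> (norm (f t))\<^sup>2 * K\<^sup>2" for t
      using power_mono[OF K[of "f t"], of 2] by (simp add: power_mult_distrib)
  qed
qed

lemma L2_inner_prod:
  fixes p q :: "real \<Rightarrow> 'a::real_inner \<times> 'b::real_inner"
  assumes "p \<in> L2 T" "q \<in> L2 T"
  shows "L2_inner T p q = L2_inner T (\<lambda>t. fst (p t)) (\<lambda>t. fst (q t)) + L2_inner T (\<lambda>t. snd (p t)) (\<lambda>t. snd (q t))"
  unfolding L2_inner_def inner_prod_def
  by (intro Bochner_Integration.integral_add L2_inner_integrable
      L2_compose_bounded_linear[OF bounded_linear_fst] L2_compose_bounded_linear[OF bounded_linear_snd] assms)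

lemma closed_L2_subspaceD:
  assumes "closed_L2_subspace T G"
  shows "f \<in> G \<Longrightarrow> f \<in> L2 T" and "(\<lambda>t. 0) \<in> G"
    and "f \<in> G \<Longrightarrow> g \<in> G \<Longrightarrow> (\<lambda>t. f t + c *\<^sub>R g t) \<in> G"
proof -
  note def = assms[unfolded closed_L2_subspace_def]
  note sub = def[THEN conjunct1] and zero = def[THEN conjunct2, THEN conjunct1]
  note add = def[THEN conjunct2, THEN conjunct2, THEN conjunct1]
  note scale = def[THEN conjunct2, THEN conjunct2, THEN conjunct2, THEN conjunct1]
  show "f \<in> L2 T" if "f \<in> G" using sub that by (rule subsetD)
  show "(\<lambda>t. 0) \<in> G" by (rule zero)
  assume f: "f \<in> G" and g: "g \<in> G"
  have "(\<lambda>t. c *\<^sub>R g t) \<in> G" by (rule scale[rule_format, OF g])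
  then show "(\<lambda>t. f t + c *\<^sub>R g t) \<in> G" by (rule add[rule_format, OF f])
qed

text \<open>
  The value of \<^const>\<open>L2_proj\<close> is chosen among the elements of \<open>G\<close> with the defining orthogonality
  property; \<open>p\<close> is one of them, so the choice succeeds, and two of them differ by an element of
  \<open>G\<close> that is orthogonal to itself.
\<close>

lemma L2_proj_eqI:
  fixes u :: "real \<Rightarrow> 'a::real_inner"
  assumes G: "closed_L2_subspace T G" and u: "u \<in> L2 T" and p: "p \<in> G"
    and eq: "\<And>g. g \<in> G \<Longrightarrow> L2_inner T u g = L2_inner T p g"
  shows "L2_eq T (L2_proj T G u) p"
proof -
  note sub = closed_L2_subspaceD(1)[OF G]
  have orth: "L2_inner T (\<lambda>t. u t - q t) g = L2_inner T u g - L2_inner T q g" if "q \<in> G" "g \<in> G" for q g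
    using L2_inner_comb[OF u sub[OF that(1)] sub[OF that(2)], of "-1"] by simp
  define q where "q = L2_proj T G u"
  have "p \<in> G \<and> (\<forall>g\<in>G. L2_inner T (\<lambda>t. u t - p t) g = 0)" using p orth eq by simp
  then have q: "q \<in> G \<and> (\<forall>g\<in>G. L2_inner T (\<lambda>t. u t - q t) g = 0)"
    unfolding q_def L2_proj_def
    by (rule someI[of "\<lambda>q. q \<in> G \<and> (\<forall>g\<in>G. L2_inner T (\<lambda>t. u t - q t) g = 0)"])
  have d: "(\<lambda>t. q t - p t) \<in> G"
    using closed_L2_subspaceD(3)[OF G conjunct1[OF q] p, of "-1"] by simp
  have "L2_inner T (\<lambda>t. q t - p t) (\<lambda>t. q t - p t) = 0"
    using L2_inner_comb[OF sub[OF conjunct1[OF q]] sub[OF p] sub[OF d], of "-1"]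
      orth[OF conjunct1[OF q] d] bspec[OF conjunct2[OF q] d] eq[OF d] by simp
  then have "L2_norm T (\<lambda>t. q t - p t) = 0" by (simp add: L2_inner_self)
  from L2_norm_eq_0D[OF sub[OF d] this] show ?thesis
    unfolding L2_eq_def q_def[symmetric] by simp
qed

section \<open>Integrals of strongly measurable functions\<close>

text \<open>A Riemann sum of \<open>f\<close> differs from that of an integrable approximation by at most a Riemann
  sum of the norm of the error, so approximation in mean passes to the Henstock-Kurzweil integral.\<close>

lemma has_integral_limit_in_mean:
  fixes f :: "real \<Rightarrow> 'a::banach"
  assumes fn: "\<And>n::nat. fn n integrable_on {a..b}"
    and en: "\<And>n. (\<lambda>x. norm (f x - fn n x)) integrable_on {a..b}"
    and lim: "(\<lambda>n. integral {a..b} (\<lambda>x. norm (f x - fn n x))) \<longlonglongrightarrow> 0"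
  shows "f integrable_on {a..b}"
proof -
  define e where "e n = integral {a..b} (\<lambda>x. norm (f x - fn n x))" for n
  define I where "I n = integral {a..b} (fn n)" for n
  have Idiff: "norm (I m - I n) \<le> e m + e n" for m n
  proof -
    have "I m - I n = integral {a..b} (\<lambda>x. fn m x - fn n x)"
      by (simp add: I_def Henstock_Kurzweil_Integration.integral_diff fn)
    also have "norm \<dots> \<le> integral {a..b} (\<lambda>x. norm (f x - fn m x) + norm (f x - fn n x))"
    proof (rule integral_norm_bound_integral)
      fix x
      show "norm (fn m x - fn n x) \<le> norm (f x - fn m x) + norm (f x - fn n x)"
        using norm_triangle_ineq4[of "f x - fn n x" "f x - fn m x"] by simp
    qed (intro Henstock_Kurzweil_Integration.integrable_diff
        Henstock_Kurzweil_Integration.integrable_add fn en)+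
    also have "\<dots> = e m + e n"
      by (simp add: e_def Henstock_Kurzweil_Integration.integral_add en)
    finally show ?thesis .
  qed
  have e_small: "\<exists>N. \<forall>n\<ge>N. e n < \<delta>" if "\<delta> > 0" for \<delta>
    using order_tendstoD(2)[OF lim that] by (simp add: e_def eventually_sequentially)
  have "Cauchy I"
  proof (rule CauchyI)
    fix \<delta> :: real assume "0 < \<delta>"
    then obtain N where "\<And>n. n \<ge> N \<Longrightarrow> e n < \<delta> / 2" using e_small[of "\<delta> / 2"] by auto
    then show "\<exists>N. \<forall>m\<ge>N. \<forall>n\<ge>N. norm (I m - I n) < \<delta>"
      using Idiff by (intro exI[of _ N]) (smt (verit) field_sum_of_halves)
  qed
  then obtain J where J: "I \<longlonglongrightarrow> J" by (auto simp: Cauchy_convergent_iff convergent_def)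
  have "(f has_integral J) (cbox a b)"
    unfolding has_integral
  proof (intro allI impI)
    fix \<delta> :: real assume "0 < \<delta>"
    obtain N where N: "\<And>n. n \<ge> N \<Longrightarrow> e n < \<delta> / 4" using e_small[of "\<delta> / 4"] \<open>0 < \<delta>\<close> by auto
    obtain N' where N': "\<And>n. n \<ge> N' \<Longrightarrow> norm (I n - J) < \<delta> / 4"
      using LIMSEQ_D[OF J, of "\<delta> / 4"] \<open>0 < \<delta>\<close> by auto
    define n where "n = max N N'"
    have en4: "e n < \<delta> / 4" and In: "norm (I n - J) < \<delta> / 4" using N N' by (auto simp: n_def)
    have "(fn n has_integral I n) (cbox a b)"
      using fn[of n] by (simp add: I_def integrable_integral)
    moreover have "0 < \<delta> / 4" using \<open>0 < \<delta>\<close> by simp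
    ultimately obtain \<gamma>1 where g1: "gauge \<gamma>1"
      "\<And>\<D>. \<D> tagged_division_of (cbox a b) \<Longrightarrow> \<gamma>1 fine \<D> \<Longrightarrow>
        norm ((\<Sum>(x, k)\<in>\<D>. measure lborel k *\<^sub>R fn n x) - I n) < \<delta> / 4"
      unfolding has_integral by metis
    have "((\<lambda>x. norm (f x - fn n x)) has_integral e n) (cbox a b)"
      using en[of n] by (simp add: e_def integrable_integral)
    then obtain \<gamma>2 where g2: "gauge \<gamma>2"
      "\<And>\<D>. \<D> tagged_division_of (cbox a b) \<Longrightarrow> \<gamma>2 fine \<D> \<Longrightarrow>
        norm ((\<Sum>(x, k)\<in>\<D>. measure lborel k *\<^sub>R norm (f x - fn n x)) - e n) < \<delta> / 4"
      using \<open>0 < \<delta> / 4\<close> unfolding has_integral by metis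
    show "\<exists>\<gamma>. gauge \<gamma> \<and> (\<forall>\<D>. \<D> tagged_division_of (cbox a b) \<and> \<gamma> fine \<D> \<longrightarrow>
        norm ((\<Sum>(x, k)\<in>\<D>. measure lborel k *\<^sub>R f x) - J) < \<delta>)"
    proof (intro exI[of _ "\<lambda>x. \<gamma>1 x \<inter> \<gamma>2 x"] conjI allI impI)
      show "gauge (\<lambda>x. \<gamma>1 x \<inter> \<gamma>2 x)" using g1(1) g2(1) by (rule gauge_Int)
      fix \<D> assume D: "\<D> tagged_division_of (cbox a b) \<and> (\<lambda>x. \<gamma>1 x \<inter> \<gamma>2 x) fine \<D>"
      then have D1: "\<gamma>1 fine \<D>" and D2: "\<gamma>2 fine \<D>" by (auto simp: fine_Int)
      have "norm ((\<Sum>(x, k)\<in>\<D>. measure lborel k *\<^sub>R f x) - (\<Sum>(x, k)\<in>\<D>. measure lborel k *\<^sub>R fn n x))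
          = norm (\<Sum>(x, k)\<in>\<D>. measure lborel k *\<^sub>R (f x - fn n x))"
        by (simp add: sum_subtractf[symmetric] case_prod_beta scaleR_diff_right)
      also have "\<dots> \<le> (\<Sum>(x, k)\<in>\<D>. measure lborel k *\<^sub>R norm (f x - fn n x))"
        by (rule sum_norm_le) (auto simp: case_prod_beta)
      also have "\<dots> < \<delta> / 4 + \<delta> / 4"
        using g2(2)[OF conjunct1[OF D] D2] en4 unfolding real_norm_def by linarith
      finally have 1: "norm ((\<Sum>(x, k)\<in>\<D>. measure lborel k *\<^sub>R f x) - (\<Sum>(x, k)\<in>\<D>. measure lborel k *\<^sub>R fn n x))
          < \<delta> / 2" by simp
      have 2: "norm ((\<Sum>(x, k)\<in>\<D>. measure lborel k *\<^sub>R fn n x) - I n) < \<delta> / 4"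
        using g1(2)[OF _ D1] D by blast
      from norm_triangle_lt[OF add_strict_mono[OF 2 In]]
      have "norm ((\<Sum>(x, k)\<in>\<D>. measure lborel k *\<^sub>R fn n x) - J) < \<delta> / 2" by simp
      from norm_triangle_lt[OF add_strict_mono[OF 1 this]]
      show "norm ((\<Sum>(x, k)\<in>\<D>. measure lborel k *\<^sub>R f x) - J) < \<delta>" by simp
    qed
  qed
  then show ?thesis by (auto simp: integrable_on_def)
qed

lemma simple_function_integrable_on:
  fixes s :: "real \<Rightarrow> 'a::banach"
  assumes "simple_function (lebesgue_on {a..b}) s"
  shows "s integrable_on {a..b}"
proof -
  let ?M = "lebesgue_on {a..b}"
  interpret finite_measure ?M by (rule finite_measure_interval)
  have fin: "finite (s ` {a..b})" using assms by (simp add: simple_function_def)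
  have E: "s -` {v} \<inter> {a..b} \<in> sets ?M" for v
    using simple_functionD(2)[OF assms, of "{v}"] by simp
  have "(\<lambda>x. \<Sum>v\<in>s ` {a..b}. indicat_real (s -` {v} \<inter> {a..b}) x *\<^sub>R v) integrable_on {a..b}"
  proof (intro Henstock_Kurzweil_Integration.integrable_sum fin)
    fix v
    have "integrable ?M (indicat_real (s -` {v} \<inter> {a..b}))"
      using E[of v] by (simp add: integrable_indicator_iff emeasure_eq_measure)
    then have "indicat_real (s -` {v} \<inter> {a..b}) integrable_on {a..b}"
      by (intro integrable_on_lebesgue_on) auto
    from integrable_linear[OF this bounded_linear_scaleR_left[of v]]
    show "(\<lambda>x. indicat_real (s -` {v} \<inter> {a..b}) x *\<^sub>R v) integrable_on {a..b}"
      by (simp add: o_def)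
  qed
  moreover have "(\<Sum>v\<in>s ` {a..b}. indicat_real (s -` {v} \<inter> {a..b}) x *\<^sub>R v) = s x" if "x \<in> {a..b}" for x
  proof -
    have "(\<Sum>v\<in>s ` {a..b}. indicat_real (s -` {v} \<inter> {a..b}) x *\<^sub>R v)
        = (\<Sum>v\<in>s ` {a..b}. if v = s x then v else 0)"
      using that by (intro sum.cong) (auto simp: indicator_def)
    also have "\<dots> = s x" using that fin by simp
    finally show ?thesis .
  qed
  ultimately show ?thesis by (rule Henstock_Kurzweil_Integration.integrable_eq) simp
qed

text \<open>
  Strongly measurable functions with integrable norm are limits in mean of simple functions, and
  those are integrable because indicators of measurable subsets of an interval are.
\<close>

lemma strongly_measurable_integrable_on:
  fixes f :: "real \<Rightarrow> 'a::banach"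
  assumes f: "strongly_measurable (lebesgue_on {a..b}) f"
    and int: "integrable (lebesgue_on {a..b}) (\<lambda>x. norm (f x))"
  shows "f integrable_on {a..b}"
proof -
  let ?M = "lebesgue_on {a..b}"
  interpret complete_measure ?M by (rule complete_measure_interval)
  obtain s where s: "\<And>n::nat. simple_function ?M (s n)" "\<And>n x. norm (s n x) \<le> 2 * norm (f x)"
    "AE x in ?M. (\<lambda>n. s n x) \<longlonglongrightarrow> f x"
    using strongly_measurable_dominated_approx[OF f] by blast
  have bm: "(\<lambda>x. norm (f x - s n x)) \<in> borel_measurable ?M" for n
    by (intro strongly_measurable_imp_borel_measurable strongly_measurable_norm
        strongly_measurable_diff f simple_function_imp_strongly_measurable s)
  have le: "norm (f x - s n x) \<le> 3 * norm (f x)" for n x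
    using norm_triangle_ineq4[of "f x" "s n x"] s(2)[of n x] by simp
  have w: "integrable ?M (\<lambda>x. 3 * norm (f x))" using int by simp
  have eint: "integrable ?M (\<lambda>x. norm (f x - s n x))" for n
    by (rule Bochner_Integration.integrable_bound[OF w bm]) (use le in \<open>intro AE_I2, simp\<close>)
  have "(\<lambda>n. LINT x|?M. norm (f x - s n x)) \<longlonglongrightarrow> (LINT x|?M. 0)"
  proof (rule integral_dominated_convergence[OF _ bm w])
    show "AE x in ?M. (\<lambda>n. norm (f x - s n x)) \<longlonglongrightarrow> 0"
      using s(3)
    proof eventually_elim
      case (elim x)
      have "(\<lambda>n. norm (f x - s n x)) \<longlonglongrightarrow> norm (f x - f x)" by (intro tendsto_intros elim)
      then show ?case by simp
    qed
    show "AE x in ?M. norm (norm (f x - s n x)) \<le> 3 * norm (f x)" for n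
      using le by (intro AE_I2) simp
  qed simp
  moreover have "(LINT x|?M. norm (f x - s n x)) = integral {a..b} (\<lambda>x. norm (f x - s n x))" for n
    by (intro lebesgue_integral_eq_integral eint) simp
  ultimately have lim: "(\<lambda>n. integral {a..b} (\<lambda>x. norm (f x - s n x))) \<longlonglongrightarrow> 0" by simp
  have en: "(\<lambda>x. norm (f x - s n x)) integrable_on {a..b}" for n
    by (rule integrable_on_lebesgue_on[OF eint]) simp
  show ?thesis
    by (rule has_integral_limit_in_mean[OF simple_function_integrable_on[OF s(1)] en lim])
qed

text \<open>
  This is the bridge from vector-valued integrals to the scalar theorems of integration, Fubini's
  in particular.
\<close>

lemma inner_integral:
  fixes f :: "real \<Rightarrow> 'a::{real_inner, banach}"
  assumes f: "strongly_measurable (lebesgue_on {a..b}) f"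
    and int: "integrable (lebesgue_on {a..b}) (\<lambda>x. norm (f x))"
  shows "inner (integral {a..b} f) v = (LINT x|lebesgue_on {a..b}. inner (f x) v)"
proof -
  have "integrable (lebesgue_on {a..b}) (\<lambda>x. inner (f x) v)"
  proof (rule Bochner_Integration.integrable_bound)
    show "integrable (lebesgue_on {a..b}) (\<lambda>x. norm (f x) * norm v)" using int by simp
    show "(\<lambda>x. inner (f x) v) \<in> borel_measurable (lebesgue_on {a..b})"
      by (intro borel_measurable_if_strongly_measurable strongly_measurable_inner f
          strongly_measurable_const)
  qed (auto simp: Cauchy_Schwarz_ineq2)
  then have "(LINT x|lebesgue_on {a..b}. inner (f x) v) = integral {a..b} (\<lambda>x. inner (f x) v)"
    by (intro lebesgue_integral_eq_integral) auto
  then show ?thesis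
    using integral_linear[OF strongly_measurable_integrable_on[OF assms] bounded_linear_inner_left[of v]]
    by (simp add: o_def)
qed

lemma norm_integral_le:
  fixes f :: "real \<Rightarrow> 'a::banach"
  assumes f: "strongly_measurable (lebesgue_on {a..b}) f"
    and int: "integrable (lebesgue_on {a..b}) (\<lambda>x. norm (f x))"
  shows "norm (integral {a..b} f) \<le> (LINT x|lebesgue_on {a..b}. norm (f x))"
  using integral_norm_bound_integral[OF strongly_measurable_integrable_on[OF assms]
      integrable_on_lebesgue_on[OF int]] lebesgue_integral_eq_integral[OF int] by simp

section \<open>Strongly continuous semigroups\<close>

text \<open>
  The closed sets of points at which all \<open>F i\<close> are bounded by \<open>n\<close> cover a complete space, so by
  Baire's theorem one of them contains a ball.
\<close>

lemma banach_steinhaus: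
  fixes F :: "'i \<Rightarrow> 'a::banach \<Rightarrow>\<^sub>L 'b::real_normed_vector"
  assumes "\<And>x. \<exists>K. \<forall>i\<in>I. norm (blinfun_apply (F i) x) \<le> K"
  shows "\<exists>K. \<forall>i\<in>I. norm (F i) \<le> K"
proof -
  define E where "E n = (\<Inter>i\<in>I. {x. norm (blinfun_apply (F i) x) \<le> real n})" for n
  have clo: "closed (E n)" for n
    unfolding E_def
    by (intro closed_INT ballI closed_Collect_le continuous_on_norm continuous_on_const
        linear_continuous_on blinfun.bounded_linear_right)
  have cover: "x \<in> \<Union>(range E)" for x
  proof -
    obtain K where K: "\<forall>i\<in>I. norm (blinfun_apply (F i) x) \<le> K" using assms by blast
    obtain n where "K \<le> real n" using real_arch_simple by blast
    with K have "x \<in> E n" unfolding E_def by (auto intro: order_trans)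
    then show ?thesis by blast
  qed
  have "\<exists>n. interior (E n) \<noteq> {}"
  proof (rule ccontr)
    assume "\<nexists>n. interior (E n) \<noteq> {}"
    then have "(euclidean :: 'a topology) interior_of \<Union>(range E) = {}"
      by (intro Baire_category_alt disjI1 completely_metrizable_space_euclidean)
         (auto simp: clo)
    moreover have "\<Union>(range E) = UNIV" using cover by blast
    ultimately show False by simp
  qed
  then obtain n where "interior (E n) \<noteq> {}" ..
  then obtain x0 where "x0 \<in> interior (E n)" by blast
  then obtain r where r: "r > 0" "cball x0 r \<subseteq> E n" using mem_interior_cball by blast
  have "norm (F i) \<le> 2 * real n / r" if i: "i \<in> I" for i
  proof (rule norm_blinfun_bound)
    show "0 \<le> 2 * real n / r" using r(1) by simp
    fix x
    show "norm (blinfun_apply (F i) x) \<le> 2 * real n / r * norm x"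
    proof (cases "x = 0")
      case False
      define y where "y = (r / norm x) *\<^sub>R x"
      have "norm y = r" using False r(1) by (simp add: y_def)
      then have "x0 \<in> cball x0 r" "x0 + y \<in> cball x0 r" using r(1) by (auto simp: dist_norm)
      then have "x0 \<in> E n" "x0 + y \<in> E n" using r(2) by blast+
      then have "norm (blinfun_apply (F i) x0) \<le> real n" "norm (blinfun_apply (F i) (x0 + y)) \<le> real n"
        using i by (auto simp: E_def)
      then have "norm (blinfun_apply (F i) y) \<le> 2 * real n"
        using norm_triangle_ineq4[of "blinfun_apply (F i) (x0 + y)" "blinfun_apply (F i) x0"]
        by (simp add: blinfun.add_right)
      then show ?thesis using False r(1) by (simp add: y_def blinfun.scaleR_right field_simps)
    qed simp
  qed
  then show ?thesis by blast
qed

text \<open>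
  The generator is defined by limits at \<open>0\<close> from the right, so the fundamental theorem of calculus
  is needed in the form of a right difference quotient.
\<close>

lemma integral_right_quotient:
  fixes f :: "real \<Rightarrow> 'a::banach"
  assumes f: "continuous_on UNIV f" and "0 \<le> r"
  shows "((\<lambda>h. (integral {0..r + h} f - integral {0..r} f) /\<^sub>R h) \<longlongrightarrow> f r) (at_right 0)"
proof (rule tendstoI)
  fix e :: real assume "0 < e"
  have int: "f integrable_on {a..b}" for a b
    by (intro integrable_continuous_real continuous_on_subset[OF f]) auto
  obtain d where d: "d > 0" "\<And>s. \<bar>s - r\<bar> < d \<Longrightarrow> norm (f s - f r) < e / 2"
    using f[unfolded continuous_on_iff, rule_format, of r "e / 2"] \<open>0 < e\<close>
    by (auto simp: dist_norm)
  show "eventually (\<lambda>h. dist ((integral {0..r + h} f - integral {0..r} f) /\<^sub>R h) (f r) < e) (at_right 0)"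
  proof (rule eventually_at_rightI[of 0 d])
    fix h assume h: "h \<in> {0<..<d}"
    have "integral {0..r + h} f - integral {0..r} f = integral {r..r + h} f"
      using Henstock_Kurzweil_Integration.integral_combine[of 0 r "r + h" f] h \<open>0 \<le> r\<close> int
      by (simp add: algebra_simps)
    moreover have "integral {r..r + h} (\<lambda>s. f s - f r) = integral {r..r + h} f - h *\<^sub>R f r"
      using h Henstock_Kurzweil_Integration.integral_diff[OF int integrable_const_ivl, of r "r + h" "f r"]
      by simp
    ultimately have "(integral {0..r + h} f - integral {0..r} f) /\<^sub>R h - f r
        = integral {r..r + h} (\<lambda>s. f s - f r) /\<^sub>R h"
      using h by (simp add: scaleR_diff_right)
    also have "norm \<dots> \<le> (e / 2 * (r + h - r)) / h"
    proof -
      have "norm (integral {r..r + h} (\<lambda>s. f s - f r)) \<le> e / 2 * (r + h - r)"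
      proof (rule integral_bound)
        show "continuous_on {r..r + h} (\<lambda>s. f s - f r)"
          by (intro continuous_intros continuous_on_subset[OF f]) auto
        show "norm (f s - f r) \<le> e / 2" if "s \<in> {r..r + h}" for s
        proof -
          have "\<bar>s - r\<bar> < d" using that h by auto
          from d(2)[OF this] show ?thesis by simp
        qed
      qed (use h in auto)
      then have "norm (integral {r..r + h} (\<lambda>s. f s - f r)) / h \<le> e / 2 * (r + h - r) / h"
        using h by (intro divide_right_mono) auto
      moreover have "norm (y /\<^sub>R h) = norm y / h" for y :: 'a
        using h by (simp add: divide_inverse mult.commute)
      ultimately show ?thesis by simp
    qed
    also have "\<dots> < e" using h \<open>0 < e\<close> by simp
    finally show "dist ((integral {0..r + h} f - integral {0..r} f) /\<^sub>R h) (f r) < e"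
      by (simp add: dist_norm)
  qed (use d in auto)
qed

locale c0_semigroup =
  fixes S :: "real \<Rightarrow> 'a::banach \<Rightarrow>\<^sub>L 'a"
  assumes C0: "C0_semigroup S"
begin

lemma at_0: "S 0 = id_blinfun"
  using C0 by (simp add: C0_semigroup_def)

lemma add: "0 \<le> s \<Longrightarrow> 0 \<le> t \<Longrightarrow> S (s + t) x = S s (S t x)"
  using C0 by (simp add: C0_semigroup_def)

lemma continuous_at_0: "continuous (at 0 within {0..}) (\<lambda>t. S t x)"
  using C0 by (simp add: C0_semigroup_def continuous_within at_within_Ici_at_right at_0)

lemma tendsto_at_0:
  assumes "\<And>n. 0 \<le> t n" "t \<longlonglongrightarrow> 0"
  shows "(\<lambda>n. S (t n) x) \<longlonglongrightarrow> x"
  using continuous_within_tendsto_compose[OF continuous_at_0 _ assms(2), of x] assms(1) by (simp add: at_0)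

text \<open>
  Otherwise there are times \<open>t n\<close> tending to \<open>0\<close> at which the operator norms are unbounded; but
  every orbit converges along these times, which contradicts the uniform boundedness principle.
\<close>

lemma bounded_near_0: "\<exists>d>0. \<exists>M. \<forall>t\<in>{0..d}. norm (S t) \<le> M"
proof (rule ccontr)
  assume neg: "\<not> ?thesis"
  have "\<exists>t\<in>{0..1 / real (Suc n)}. real n < norm (S t)" for n
    using neg by (metis not_le zero_less_divide_1_iff of_nat_0_less_iff zero_less_Suc)
  then obtain t where t: "\<And>n. 0 \<le> t n" "\<And>n. t n \<le> 1 / real (Suc n)" "\<And>n. real n < norm (S (t n))"
    by (metis atLeastAtMost_iff)
  have "t \<longlonglongrightarrow> 0"
  proof (rule tendsto_sandwich[of "\<lambda>_. 0"])
    show "(\<lambda>n. 1 / real (Suc n)) \<longlonglongrightarrow> 0" using lim_1_over_n[THEN LIMSEQ_Suc] by simp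
  qed (use t in auto)
  have "\<exists>K. \<forall>n\<in>UNIV. norm (S (t n) x) \<le> K" for x
    using convergent_imp_Bseq[of "\<lambda>n. S (t n) x"] tendsto_at_0[OF t(1) \<open>t \<longlonglongrightarrow> 0\<close>, of x]
    by (auto simp: convergent_def Bseq_def)
  from banach_steinhaus[OF this] obtain K where K: "norm (S (t n)) \<le> K" for n by auto
  obtain n where "K \<le> real n" using real_arch_simple by blast
  with K[of n] t(3)[of n] show False by simp
qed

lemma locally_bounded: "\<exists>M\<ge>0. \<forall>t\<in>{0..a}. norm (S t) \<le> M"
proof -
  obtain d M0 where d: "d > 0" "\<And>t. t \<in> {0..d} \<Longrightarrow> norm (S t) \<le> M0"
    using bounded_near_0 by blast
  define M where "M = max M0 1"
  have pow: "norm (S t) \<le> M ^ n" if "t \<in> {0..real n * d}" for t n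
    using that
  proof (induction n arbitrary: t)
    case 0
    then show ?case by (auto simp: at_0 intro: norm_blinfun_id_le)
  next
    case (Suc n)
    \<comment> \<open>a time up to \<open>(n + 1) d\<close> splits into one up to \<open>d\<close> and one up to \<open>n d\<close>\<close>
    define s where "s = min t d"
    have "S t = S s o\<^sub>L S (t - s)"
      using Suc.prems d(1) add[of s "t - s"] by (intro blinfun_eqI) (auto simp: s_def)
    then have "norm (S t) \<le> norm (S s) * norm (S (t - s))" by (simp add: norm_blinfun_compose)
    also have "\<dots> \<le> M * M ^ n"
    proof (intro mult_mono)
      have "norm (S s) \<le> M0" using Suc.prems d(1) by (intro d(2)) (auto simp: s_def)
      then show "norm (S s) \<le> M" by (simp add: M_def)
      show "norm (S (t - s)) \<le> M ^ n"
      proof (cases "t \<le> d")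
        case True
        then show ?thesis using Suc.IH[of 0] d(1) by (simp add: s_def)
      next
        case False
        then show ?thesis using Suc.prems by (intro Suc.IH) (auto simp: s_def algebra_simps)
      qed
    qed (auto simp: M_def)
    finally show ?case by simp
  qed
  obtain n where "a / d \<le> real n" using real_arch_simple by blast
  then have "a \<le> real n * d" using d(1) by (simp add: field_simps)
  then have "\<forall>t\<in>{0..a}. norm (S t) \<le> M ^ n" using pow by force
  moreover have "0 \<le> M ^ n" by (simp add: M_def)
  ultimately show ?thesis by blast
qed

text \<open>Negative times are folded onto positive ones, so that orbits are continuous on the whole line.\<close>

lemma continuous_action: "continuous_on UNIV (\<lambda>p. S \<bar>fst p\<bar> (snd p))"
proof (rule continuous_on_sequentiallyI)
  fix u :: "nat \<Rightarrow> real \<times> 'a" and p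
  assume "u \<longlonglongrightarrow> p"
  define a where "a n = \<bar>fst (u n)\<bar>" for n
  define x where "x n = snd (u n)" for n
  define b where "b = \<bar>fst p\<bar>"
  define y where "y = snd p"
  have a: "a \<longlonglongrightarrow> b" and x: "x \<longlonglongrightarrow> y"
    unfolding a_def x_def b_def y_def using \<open>u \<longlonglongrightarrow> p\<close> by (auto intro!: tendsto_intros)
  obtain M where M: "\<And>t. t \<in> {0..b + 1} \<Longrightarrow> norm (S t) \<le> M" "M \<ge> 0"
    using locally_bounded[of "b + 1"] by blast
  have diff: "norm (S s z - S t z) \<le> M * norm (S \<bar>s - t\<bar> z - z)"
    if "s \<in> {0..b + 1}" "t \<in> {0..b + 1}" for s t z
  proof -
    have *: "norm (S s z - S t z) \<le> M * norm (S (s - t) z - z)"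
      if "s \<in> {0..b + 1}" "t \<in> {0..b + 1}" "t \<le> s" for s t
    proof -
      have "S s z - S t z = S t (S (s - t) z - z)"
        using that add[of t "s - t" z] by (simp add: blinfun.diff_right)
      also have "norm \<dots> \<le> norm (S t) * norm (S (s - t) z - z)" by (rule norm_blinfun)
      also have "\<dots> \<le> M * norm (S (s - t) z - z)" using M(1)[OF that(2)] by (intro mult_right_mono) auto
      finally show ?thesis .
    qed
    show ?thesis
      using *[of s t] *[of t s] that by (cases "t \<le> s") (auto simp: norm_minus_commute abs_minus_commute)
  qed
  have "(\<lambda>n. S \<bar>a n - b\<bar> y) \<longlonglongrightarrow> y"
  proof (rule tendsto_at_0)
    show "(\<lambda>n. \<bar>a n - b\<bar>) \<longlonglongrightarrow> 0" using tendsto_rabs[OF tendsto_diff[OF a tendsto_const[of b]]] by simp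
  qed simp
  then have "(\<lambda>n. M * norm (x n - y) + M * norm (S \<bar>a n - b\<bar> y - y)) \<longlonglongrightarrow> M * norm (y - y) + M * norm (y - y)"
    using x by (intro tendsto_intros)
  then have bound0: "(\<lambda>n. M * norm (x n - y) + M * norm (S \<bar>a n - b\<bar> y - y)) \<longlonglongrightarrow> 0"
    by simp
  have "eventually (\<lambda>n. norm (S (a n) (x n) - S b y)
      \<le> M * norm (x n - y) + M * norm (S \<bar>a n - b\<bar> y - y)) sequentially"
  proof -
    have "eventually (\<lambda>n. a n < b + 1) sequentially" by (rule order_tendstoD(2)[OF a]) simp
    then show ?thesis
    proof eventually_elim
      case (elim n)
      then have an: "a n \<in> {0..b + 1}" "b \<in> {0..b + 1}" by (auto simp: a_def b_def)
      have "norm (S (a n) (x n) - S b y) \<le> norm (S (a n) (x n - y)) + norm (S (a n) y - S b y)"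
        using norm_triangle_ineq[of "S (a n) (x n - y)" "S (a n) y - S b y"]
        by (simp add: blinfun.diff_right)
      also have "\<dots> \<le> M * norm (x n - y) + M * norm (S \<bar>a n - b\<bar> y - y)"
        by (intro add_mono diff an order_trans[OF norm_blinfun] mult_right_mono M) auto
      finally show ?case .
    qed
  qed
  from Lim_null_comparison[OF this bound0]
  have "(\<lambda>n. S (a n) (x n) - S b y) \<longlonglongrightarrow> 0" .
  then show "(\<lambda>n. S \<bar>fst (u n)\<bar> (snd (u n))) \<longlonglongrightarrow> S \<bar>fst p\<bar> (snd p)"
    unfolding a_def x_def b_def y_def by (rule LIM_zero_cancel)
qed

lemma continuous_orbit: "continuous_on UNIV (\<lambda>t. S \<bar>t\<bar> x)"
proof -
  have "continuous_on UNIV (\<lambda>t::real. (t, x))"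
    by (intro continuous_on_Pair continuous_on_id continuous_on_const)
  from continuous_on_compose2[OF continuous_action this] show ?thesis by simp
qed

lemma integrable_orbit: "(\<lambda>t. S \<bar>t\<bar> x) integrable_on {a..b}"
  by (intro integrable_continuous_real continuous_on_subset[OF continuous_orbit]) auto

text \<open>
  Integrals of orbits are the smoothing device for semigroups: they lie in the domain of the
  generator, and after division by \<open>t\<close> they tend to \<open>x\<close> as \<open>t\<close> tends to \<open>0\<close>.
\<close>

definition orbit_integral :: "'a \<Rightarrow> real \<Rightarrow> 'a" where
  "orbit_integral x t = integral {0..t} (\<lambda>s. S \<bar>s\<bar> x)"

lemma orbit_integral_quotient:
  assumes "0 \<le> r"
  shows "((\<lambda>h. (orbit_integral x (r + h) - orbit_integral x r) /\<^sub>R h) \<longlongrightarrow> S r x) (at_right 0)"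
  using integral_right_quotient[OF continuous_orbit assms, of x] assms by (simp add: orbit_integral_def)

lemma orbit_integral_0: "orbit_integral x 0 = 0"
  by (simp add: orbit_integral_def)

lemma orbit_integral_quotient_0:
  "((\<lambda>h. orbit_integral x h /\<^sub>R h) \<longlongrightarrow> x) (at_right 0)"
  using orbit_integral_quotient[of 0 x] by (simp add: orbit_integral_0 at_0)

lemma orbit_integral_increment_bound:
  assumes "0 \<le> r" "0 \<le> h" and M: "\<And>t. t \<in> {0..r + h} \<Longrightarrow> norm (S t) \<le> M"
  shows "norm (orbit_integral x (r + h) - orbit_integral x r) \<le> M * norm x * h"
proof -
  have "orbit_integral x (r + h) - orbit_integral x r = integral {r..r + h} (\<lambda>s. S \<bar>s\<bar> x)"
    using Henstock_Kurzweil_Integration.integral_combine[OF _ _ integrable_orbit[of x 0 "r + h"], of r] assms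
    by (simp add: algebra_simps orbit_integral_def)
  also have "norm \<dots> \<le> M * norm x * (r + h - r)"
  proof (rule integral_bound)
    show "norm (S \<bar>s\<bar> x) \<le> M * norm x" if "s \<in> {r..r + h}" for s
      using that assms by (intro order_trans[OF norm_blinfun] mult_right_mono M) auto
  qed (use assms in \<open>auto intro: continuous_on_subset[OF continuous_orbit]\<close>)
  finally show ?thesis by simp
qed

lemma bounded_linear_orbit_integral:
  assumes "0 \<le> r"
  shows "bounded_linear (\<lambda>x. orbit_integral x r)"
proof -
  obtain M where M: "\<And>t. t \<in> {0..r} \<Longrightarrow> norm (S t) \<le> M" using locally_bounded[of r] by blast
  show ?thesis
  proof (rule bounded_linear_intro)
    show "orbit_integral (x + y) r = orbit_integral x r + orbit_integral y r" for x y
      by (simp add: orbit_integral_def blinfun.add_right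
          Henstock_Kurzweil_Integration.integral_add integrable_orbit)
    show "orbit_integral (c *\<^sub>R x) r = c *\<^sub>R orbit_integral x r" for c x
      by (simp add: orbit_integral_def blinfun.scaleR_right)
    show "norm (orbit_integral x r) \<le> norm x * (M * r)" for x
      using orbit_integral_increment_bound[of 0 r M x] M assms by (simp add: orbit_integral_0 mult_ac)
  qed
qed

lemma orbit_integral_shift:
  assumes "0 \<le> r" "0 \<le> t"
  shows "orbit_integral (S t x) r = orbit_integral x (r + t) - orbit_integral x t"
proof -
  have "orbit_integral (S t x) r = integral {0..r} ((\<lambda>s. S \<bar>s\<bar> x) \<circ> (+) t)"
    unfolding orbit_integral_def
    by (rule integral_cong) (use assms add in \<open>auto simp: add.commute\<close>)
  also have "\<dots> = integral {t..r + t} (\<lambda>s. S \<bar>s\<bar> x)"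
    using integral_shift_Icc_real[of 0 r "\<lambda>s. S \<bar>s\<bar> x" t] by simp
  also have "\<dots> = orbit_integral x (r + t) - orbit_integral x t"
    using Henstock_Kurzweil_Integration.integral_combine[OF _ _ integrable_orbit[of x 0 "r + t"], of t] assms
    by (simp add: algebra_simps orbit_integral_def)
  finally show ?thesis .
qed

lemma apply_orbit_integral:
  assumes "0 \<le> t"
  shows "S t (orbit_integral x r) = orbit_integral (S t x) r"
proof -
  have "S t (orbit_integral x r) = integral {0..r} ((S t) \<circ> (\<lambda>s. S \<bar>s\<bar> x))"
    unfolding orbit_integral_def
    by (rule integral_linear[symmetric, OF integrable_orbit blinfun.bounded_linear_right])
  also have "\<dots> = orbit_integral (S t x) r"
    unfolding orbit_integral_def
  proof (rule integral_cong)
    fix s assume "s \<in> {0..r}"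
    then show "(S t \<circ> (\<lambda>s. S \<bar>s\<bar> x)) s = S \<bar>s\<bar> (S t x)"
      using assms add[of t s x] add[of s t x] by (simp add: add.commute[of s t])
  qed
  finally show ?thesis .
qed

text \<open>
  Applying \<open>S h\<close> shifts the interval of integration, so the difference quotient reduces to
  averages of the orbit over short intervals at its two ends.
\<close>

lemma orbit_integral_in_generator:
  assumes "0 \<le> r"
  shows "(orbit_integral x r, S r x - x) \<in> generator S"
proof -
  have "((\<lambda>h. (orbit_integral x (r + h) - orbit_integral x r) /\<^sub>R h - orbit_integral x h /\<^sub>R h)
      \<longlongrightarrow> S r x - x) (at_right 0)"
    by (intro tendsto_diff orbit_integral_quotient orbit_integral_quotient_0 assms)
  then have "((\<lambda>h. (S h (orbit_integral x r) - orbit_integral x r) /\<^sub>R h) \<longlongrightarrow> S r x - x) (at_right 0)"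
  proof (rule Lim_transform_eventually)
    show "eventually (\<lambda>h. (orbit_integral x (r + h) - orbit_integral x r) /\<^sub>R h - orbit_integral x h /\<^sub>R h
        = (S h (orbit_integral x r) - orbit_integral x r) /\<^sub>R h) (at_right 0)"
      by (rule eventually_at_rightI[of 0 1])
         (use assms in \<open>auto simp: apply_orbit_integral orbit_integral_shift algebra_simps\<close>)
  qed
  then show ?thesis by (simp add: generator_def)
qed

lemma generator_invariant:
  assumes "(x, v) \<in> generator S" "0 \<le> t"
  shows "(S t x, S t v) \<in> generator S"
proof -
  have "((\<lambda>h. S t ((S h x - x) /\<^sub>R h)) \<longlongrightarrow> S t v) (at_right 0)"
    using assms(1) by (intro tendsto_intros) (simp add: generator_def)
  then have "((\<lambda>h. (S h (S t x) - S t x) /\<^sub>R h) \<longlongrightarrow> S t v) (at_right 0)"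
  proof (rule Lim_transform_eventually)
    show "eventually (\<lambda>h. S t ((S h x - x) /\<^sub>R h) = (S h (S t x) - S t x) /\<^sub>R h) (at_right 0)"
    proof (rule eventually_at_rightI[of 0 1])
      fix h :: real assume "h \<in> {0<..<1}"
      then show "S t ((S h x - x) /\<^sub>R h) = (S h (S t x) - S t x) /\<^sub>R h"
        using add[of t h x] add[of h t x] assms(2)
        by (simp add: blinfun.scaleR_right blinfun.diff_right add.commute)
    qed simp
  qed
  then show ?thesis by (simp add: generator_def)
qed

text \<open>
  Both sides are limits of the same quotients: the integral of the orbit of \<open>(S h x - x) / h\<close> over
  \<open>[0, t]\<close> tends to the integral of the orbit of \<open>v\<close> by continuity, and to \<open>S t x - x\<close> by shifting
  the interval of integration. In this way orbits are differentiable from both sides although the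
  generator only involves right difference quotients.
\<close>

lemma orbit_minus_start:
  assumes "(x, v) \<in> generator S" "0 \<le> t"
  shows "S t x - x = orbit_integral v t"
proof (rule tendsto_unique)
  interpret bl: bounded_linear "\<lambda>x. orbit_integral x t" by (rule bounded_linear_orbit_integral[OF assms(2)])
  show "((\<lambda>h. orbit_integral ((S h x - x) /\<^sub>R h) t) \<longlongrightarrow> orbit_integral v t) (at_right 0)"
    using assms(1) by (intro bl.tendsto) (simp add: generator_def)
  have "((\<lambda>h. (orbit_integral x (t + h) - orbit_integral x t) /\<^sub>R h - orbit_integral x h /\<^sub>R h)
      \<longlongrightarrow> S t x - x) (at_right 0)"
    by (intro tendsto_diff orbit_integral_quotient orbit_integral_quotient_0 assms)
  then show "((\<lambda>h. orbit_integral ((S h x - x) /\<^sub>R h) t) \<longlongrightarrow> S t x - x) (at_right 0)"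
  proof (rule Lim_transform_eventually)
    show "eventually (\<lambda>h. (orbit_integral x (t + h) - orbit_integral x t) /\<^sub>R h - orbit_integral x h /\<^sub>R h
        = orbit_integral ((S h x - x) /\<^sub>R h) t) (at_right 0)"
      by (rule eventually_at_rightI[of 0 1])
         (use assms in \<open>auto simp: bl.scaleR bl.diff orbit_integral_shift algebra_simps\<close>)
  qed
qed simp

lemma orbit_has_vector_derivative:
  assumes "(x, v) \<in> generator S" "t \<in> {0..b}"
  shows "((\<lambda>t. S t x) has_vector_derivative S t v) (at t within {0..b})"
proof -
  have "((\<lambda>t. x + orbit_integral v t) has_vector_derivative 0 + S \<bar>t\<bar> v) (at t within {0..b})"
    unfolding orbit_integral_def
    by (intro has_vector_derivative_add has_vector_derivative_const integral_has_vector_derivative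
        continuous_on_subset[OF continuous_orbit] assms) auto
  then have "((\<lambda>t. x + orbit_integral v t) has_vector_derivative S t v) (at t within {0..b})"
    using assms(2) by simp
  then show ?thesis
  proof (rule has_vector_derivative_transform[OF assms(2), rotated])
    show "S t x = x + orbit_integral v t" if "t \<in> {0..b}" for t
      using orbit_minus_start[OF assms(1), of t] that by (simp add: algebra_simps)
  qed
qed

end

section \<open>The adjoint semigroup\<close>

lemma subspace_Domain_generator: "subspace (Domain (generator S))"
proof (rule subspaceI)
  have "(0, 0) \<in> generator S" by (simp add: generator_def)
  then show "0 \<in> Domain (generator S)" by blast
next
  fix x y assume "x \<in> Domain (generator S)" "y \<in> Domain (generator S)"
  then obtain v w where vw: "((\<lambda>h. (S h x - x) /\<^sub>R h) \<longlongrightarrow> v) (at_right 0)"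
    "((\<lambda>h. (S h y - y) /\<^sub>R h) \<longlongrightarrow> w) (at_right 0)"
    by (auto simp: generator_def)
  from tendsto_add[OF this] have "(x + y, v + w) \<in> generator S"
    by (simp add: generator_def blinfun.add_right scaleR_add_right scaleR_diff_right algebra_simps)
  then show "x + y \<in> Domain (generator S)" by blast
next
  fix c x assume "x \<in> Domain (generator S)"
  then obtain v where "((\<lambda>h. (S h x - x) /\<^sub>R h) \<longlongrightarrow> v) (at_right 0)"
    by (auto simp: generator_def)
  from tendsto_scaleR[OF tendsto_const[of c] this] have "(c *\<^sub>R x, c *\<^sub>R v) \<in> generator S"
    by (simp add: generator_def blinfun.scaleR_right scaleR_diff_right mult.commute)
  then show "c *\<^sub>R x \<in> Domain (generator S)" by blast
qed

text \<open>
  A vector \<open>y\<close> orthogonal to the domain is orthogonal to the averages of its own orbit, which tend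
  to \<open>y\<close>.
\<close>

lemma closure_Domain_generator:
  fixes S :: "real \<Rightarrow> 'h::{real_inner, banach} \<Rightarrow>\<^sub>L 'h"
  assumes "c0_semigroup S"
  shows "closure (Domain (generator S)) = UNIV"
proof (rule dense_if_orthogonal_complement_trivial[OF subspace_Domain_generator])
  interpret c0_semigroup S by fact
  fix y assume orth: "\<And>x. x \<in> Domain (generator S) \<Longrightarrow> inner y x = 0"
  have "((\<lambda>h. inner y (orbit_integral y h /\<^sub>R h)) \<longlongrightarrow> inner y y) (at_right 0)"
    by (intro tendsto_inner tendsto_const orbit_integral_quotient_0)
  moreover have "eventually (\<lambda>h. inner y (orbit_integral y h /\<^sub>R h) = 0) (at_right 0)"
  proof (rule eventually_at_rightI[of 0 1])
    fix h :: real assume "h \<in> {0<..<1}"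
    then have "orbit_integral y h \<in> Domain (generator S)"
      using orbit_integral_in_generator[of h y] by auto
    from orth[OF this] show "inner y (orbit_integral y h /\<^sub>R h) = 0" by simp
  qed simp
  ultimately have "((\<lambda>h::real. 0) \<longlongrightarrow> inner y y) (at_right 0)"
    by (rule Lim_transform_eventually)
  then have "inner y y = 0" by (simp add: tendsto_const_iff)
  then show "y = 0" by simp
qed

lemma eq_on_closure:
  fixes f g :: "'a::topological_space \<Rightarrow> real"
  assumes "closure D = UNIV" "continuous_on UNIV f" "continuous_on UNIV g" "\<And>x. x \<in> D \<Longrightarrow> f x = g x"
  shows "f x = g x"
proof -
  have "closed {x. f x = g x}" by (rule closed_Collect_eq[OF assms(2,3)])
  moreover have "D \<subseteq> {x. f x = g x}" using assms(4) by blast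
  ultimately have "closure D \<subseteq> {x. f x = g x}" by (simp add: closure_minimal)
  then show ?thesis using assms(1) by blast
qed

definition adjoint_semigroup ::
  "(real \<Rightarrow> 'h::{real_inner, banach} \<Rightarrow>\<^sub>L 'h) \<Rightarrow> real \<Rightarrow> 'h \<Rightarrow>\<^sub>L 'h" where
  "adjoint_semigroup S t = Blinfun (adjoint (blinfun_apply (S t)))"

lemma adjoint_semigroup_apply: "blinfun_apply (adjoint_semigroup S t) = adjoint (blinfun_apply (S t))"
  unfolding adjoint_semigroup_def
  by (rule bounded_linear_Blinfun_apply[OF bounded_linear_adjoint_blinfun(1)])

lemma inner_adjoint_semigroup: "inner x (adjoint_semigroup S t y) = inner (S t x) y"
  by (simp add: adjoint_semigroup_apply adjoint_blinfun_works)

lemma norm_adjoint_semigroup_le: "norm (adjoint_semigroup S t y) \<le> norm (S t) * norm y"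
  by (simp add: adjoint_semigroup_apply bounded_linear_adjoint_blinfun(2))

lemma closed_strong_continuity_vectors:
  fixes R :: "real \<Rightarrow> 'a::real_normed_vector \<Rightarrow>\<^sub>L 'a"
  assumes M: "0 \<le> M" "\<And>t y. t \<in> {0..1} \<Longrightarrow> norm (R t y) \<le> M * norm y"
  shows "closed {y. ((\<lambda>t. R t y) \<longlongrightarrow> y) (at_right 0)}" (is "closed ?E")
proof (rule closed_sequential_limits[THEN iffD2], safe)
  fix z :: "nat \<Rightarrow> 'a" and y
  assume z: "\<forall>n. z n \<in> ?E" and lim: "z \<longlonglongrightarrow> y"
  show "((\<lambda>t. R t y) \<longlongrightarrow> y) (at_right 0)"
  proof (rule tendstoI)
    fix e :: real assume "0 < e"
    have "(\<lambda>n. (M + 1) * norm (z n - y)) \<longlonglongrightarrow> (M + 1) * norm (y - y)"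
      by (intro tendsto_intros lim)
    then have "eventually (\<lambda>n. (M + 1) * norm (z n - y) < e / 2) sequentially"
      by (rule order_tendstoD) (use \<open>0 < e\<close> in simp)
    then obtain n where n: "(M + 1) * norm (z n - y) < e / 2"
      using eventually_happens' sequentially_bot by blast
    have "((\<lambda>t. R t (z n)) \<longlongrightarrow> z n) (at_right 0)" using z by blast
    then have "eventually (\<lambda>t. dist (R t (z n)) (z n) < e / 2) (at_right 0)"
      by (rule tendstoD) (use \<open>0 < e\<close> in simp)
    moreover have "eventually (\<lambda>t::real. t \<in> {0..1}) (at_right 0)"
      by (rule eventually_at_rightI[of 0 1]) auto
    ultimately show "eventually (\<lambda>t. dist (R t y) y < e) (at_right 0)"
    proof eventually_elim
      case (elim t)
      have "R t y - y = R t (y - z n) + (R t (z n) - z n) + (z n - y)"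
        by (simp add: blinfun.diff_right)
      also have "norm \<dots> \<le> norm (R t (y - z n)) + norm (R t (z n) - z n) + norm (z n - y)"
        by (intro norm_triangle_le add_right_mono norm_triangle_ineq)
      also have "\<dots> \<le> M * norm (z n - y) + norm (R t (z n) - z n) + norm (z n - y)"
        using M(2)[OF elim(2), of "y - z n"] by (simp add: norm_minus_commute)
      also have "\<dots> < e"
        using n elim(1) by (simp add: dist_norm algebra_simps)
      finally show ?case by (simp add: dist_norm)
    qed
  qed
qed

text \<open>
  The vectors with strongly continuous adjoint orbits form a closed subspace \<open>E\<close>. The adjoint of
  the operator that integrates orbits over \<open>[0, r]\<close> has values in \<open>E\<close>, since shifting the interval
  of integration by \<open>t\<close> changes the integral only by a quantity of order \<open>t\<close>. If \<open>z\<close> is orthogonal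
  to \<open>E\<close>, then in particular to the value of this adjoint at \<open>z\<close>, so \<open>z\<close> is orthogonal to the
  integrals of its own orbit; dividing by \<open>r\<close> and letting \<open>r\<close> tend to \<open>0\<close> gives \<open>z = 0\<close>.
\<close>

theorem C0_semigroup_adjoint:
  fixes S :: "real \<Rightarrow> 'h::{real_inner, banach} \<Rightarrow>\<^sub>L 'h"
  assumes "c0_semigroup S"
  shows "C0_semigroup (adjoint_semigroup S)"
  unfolding C0_semigroup_def
proof (intro conjI allI impI)
  interpret c0_semigroup S by fact
  let ?R = "adjoint_semigroup S"
  have eqI: "u = v" if "\<And>x. inner x u = inner x v" for u v :: 'h
    using that vector_eq_ldot by blast
  show "?R 0 = id_blinfun"
    by (intro blinfun_eqI eqI) (simp add: inner_adjoint_semigroup at_0)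
  show "?R (s + t) = ?R s o\<^sub>L ?R t" if "0 \<le> s" "0 \<le> t" for s t
    using that add[of t s]
    by (intro blinfun_eqI eqI) (simp add: inner_adjoint_semigroup add.commute[of s t])
  define E where "E = {y. ((\<lambda>t. ?R t y) \<longlongrightarrow> y) (at_right 0)}"
  have sub: "subspace E"
  proof (rule subspaceI)
    show "x + y \<in> E" if "x \<in> E" "y \<in> E" for x y
      using that tendsto_add[of "\<lambda>t. ?R t x" x "at_right 0" "\<lambda>t. ?R t y" y]
      by (simp add: E_def blinfun.add_right)
    show "c *\<^sub>R x \<in> E" if "x \<in> E" for c x
      using that tendsto_scaleR[of "\<lambda>_. c" c "at_right 0" "\<lambda>t. ?R t x" x]
      by (simp add: E_def blinfun.scaleR_right)
  qed (simp add: E_def)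
  obtain M1 where "M1 \<ge> 0" "\<forall>t\<in>{0..1}. norm (S t) \<le> M1" using locally_bounded by blast
  then have "closed E"
    unfolding E_def
    by (intro closed_strong_continuity_vectors[of M1] order_trans[OF norm_adjoint_semigroup_le]
        mult_right_mono) auto
  \<comment> \<open>\<open>w\<close> is the value at \<open>y\<close> of the adjoint of \<open>\<lambda>x. orbit_integral x r\<close>\<close>
  have average: "w \<in> E" if r: "0 \<le> r" and w: "\<And>x. inner x w = inner (orbit_integral x r) y" for r w y
  proof -
    obtain M where M: "\<And>t. t \<in> {0..r + 1} \<Longrightarrow> norm (S t) \<le> M" "M \<ge> 0"
      using locally_bounded[of "r + 1"] by blast
    have bound: "norm (?R t w - w) \<le> 2 * M * norm y * t" if t: "0 < t" "t < 1" for t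
    proof -
      define d where "d = ?R t w - w"
      have "norm d * norm d = inner d (?R t w) - inner d w"
        by (simp add: d_def inner_diff_right[symmetric] power2_norm_eq_inner[symmetric] power2_eq_square)
      also have "\<dots> = inner (orbit_integral (S t d) r - orbit_integral d r) y"
        by (simp add: inner_adjoint_semigroup w inner_diff_left)
      also have "\<dots> = inner ((orbit_integral d (r + t) - orbit_integral d r)
          - (orbit_integral d (0 + t) - orbit_integral d 0)) y"
        using r t by (simp add: orbit_integral_shift orbit_integral_0 algebra_simps)
      also have "\<dots> \<le> norm ((orbit_integral d (r + t) - orbit_integral d r)
          - (orbit_integral d (0 + t) - orbit_integral d 0)) * norm y"
        by (rule norm_cauchy_schwarz)
      also have "\<dots> \<le> (M * norm d * t + M * norm d * t) * norm y"
        using r t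
        by (intro mult_right_mono order_trans[OF norm_triangle_ineq4] add_mono
            orbit_integral_increment_bound M) auto
      finally have *: "norm d * norm d \<le> norm d * (2 * M * norm y * t)" by (simp add: algebra_simps)
      have "norm d \<le> 2 * M * norm y * t"
      proof (cases "norm d = 0")
        case True
        then show ?thesis using M(2) t by simp
      next
        case False
        then have "0 < norm d" by simp
        with * show ?thesis by (simp only: mult_le_cancel_left_pos)
      qed
      then show ?thesis by (simp add: d_def)
    qed
    have "((\<lambda>t. 2 * M * norm y * t) \<longlongrightarrow> 2 * M * norm y * 0) (at_right 0)"
      by (intro tendsto_intros)
    then have lim: "((\<lambda>t. 2 * M * norm y * t) \<longlongrightarrow> 0) (at_right 0)" by simp
    have "eventually (\<lambda>t. norm (?R t w - w) \<le> 2 * M * norm y * t) (at_right 0)"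
      by (rule eventually_at_rightI[of 0 1]) (use bound in auto)
    from Lim_null_comparison[OF this lim] show "w \<in> E"
      unfolding E_def by (simp add: LIM_zero_iff)
  qed
  have "closure E = UNIV"
  proof (rule dense_if_orthogonal_complement_trivial[OF sub])
    fix z assume orth: "\<And>x. x \<in> E \<Longrightarrow> inner z x = 0"
    have "((\<lambda>h. inner (orbit_integral z h /\<^sub>R h) z) \<longlongrightarrow> inner z z) (at_right 0)"
      by (intro tendsto_inner tendsto_const orbit_integral_quotient_0)
    moreover have "eventually (\<lambda>h. inner (orbit_integral z h /\<^sub>R h) z = 0) (at_right 0)"
    proof (rule eventually_at_rightI[of 0 1])
      fix h :: real assume "h \<in> {0<..<1}"
      then have "bounded_linear (\<lambda>x. orbit_integral x h)" by (intro bounded_linear_orbit_integral) simp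
      then have "bounded_linear (\<lambda>x. inner (orbit_integral x h) z)"
        by (rule bounded_linear_compose[OF bounded_linear_inner_left])
      then obtain w where w: "\<And>x. inner (orbit_integral x h) z = inner w x"
        by (rule riesz_representation) blast
      have "w \<in> E"
        by (rule average[of h w z]) (use w \<open>h \<in> {0<..<1}\<close> in \<open>auto simp: inner_commute\<close>)
      then have "inner w z = 0" using orth by (simp add: inner_commute[of w])
      then have "inner (orbit_integral z h) z = 0" using w[of z] by simp
      then show "inner (orbit_integral z h /\<^sub>R h) z = 0" by simp
    qed simp
    ultimately have "((\<lambda>h::real. 0) \<longlongrightarrow> inner z z) (at_right 0)"
      by (rule Lim_transform_eventually)
    then have "inner z z = 0" by (simp add: tendsto_const_iff)
    then show "z = 0" by simp
  qed
  with \<open>closed E\<close> have "E = UNIV" by (simp add: closure_closed)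
  then show "((\<lambda>t. ?R t x) \<longlongrightarrow> x) (at_right 0)" for x unfolding E_def by blast
qed

text \<open>
  One inclusion passes to the limit in the difference quotients. For the other one, moving the
  generator across the inner product under the integral in \<open>S t x - x = \<integral> S s (A x) ds\<close> gives the
  same formula for the adjoint orbit of an element of the domain of the adjoint, by density of the
  domain.
\<close>

theorem generator_adjoint_semigroup:
  fixes S :: "real \<Rightarrow> 'h::{real_inner, banach} \<Rightarrow>\<^sub>L 'h"
  assumes "c0_semigroup S"
  shows "generator (adjoint_semigroup S) = op_adjoint (generator S)"
proof (intro set_eqI iffI)
  interpret c0_semigroup S by fact
  let ?R = "adjoint_semigroup S"
  interpret R: c0_semigroup ?R by standard (rule C0_semigroup_adjoint[OF assms])
  fix p :: "'h \<times> 'h"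
  {
    assume "p \<in> generator ?R"
    then obtain y z where p: "p = (y, z)" and yz: "((\<lambda>h. (?R h y - y) /\<^sub>R h) \<longlongrightarrow> z) (at_right 0)"
      by (auto simp: generator_def)
    have "inner v y = inner x z" if "(x, v) \<in> generator S" for x v
    proof (rule tendsto_unique)
      show "((\<lambda>h. inner ((S h x - x) /\<^sub>R h) y) \<longlongrightarrow> inner v y) (at_right 0)"
        using that by (intro tendsto_inner tendsto_const) (simp add: generator_def)
      have "((\<lambda>h. inner x ((?R h y - y) /\<^sub>R h)) \<longlongrightarrow> inner x z) (at_right 0)"
        by (intro tendsto_inner tendsto_const yz)
      then show "((\<lambda>h. inner ((S h x - x) /\<^sub>R h) y) \<longlongrightarrow> inner x z) (at_right 0)"
        by (simp add: inner_adjoint_semigroup inner_diff_right inner_diff_left)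
    qed simp
    then show "p \<in> op_adjoint (generator S)" by (auto simp: op_adjoint_def p)
  next
    assume op: "p \<in> op_adjoint (generator S)"
    obtain y z where p: "p = (y, z)" by (cases p)
    have adj: "inner v y = inner x z" if "(x, v) \<in> generator S" for x v
      using op that by (auto simp: op_adjoint_def p)
    have "?R t y - y = R.orbit_integral z t" if t: "0 \<le> t" for t
    proof -
      have "inner (S t x - x) y = inner (orbit_integral x t) z" for x
      proof (rule eq_on_closure[OF closure_Domain_generator[OF assms],
            where f = "\<lambda>x. inner (S t x - x) y" and g = "\<lambda>x. inner (orbit_integral x t) z"])
        show "continuous_on UNIV (\<lambda>x. inner (S t x - x) y)"
          by (intro continuous_on_inner continuous_on_diff continuous_on_const continuous_on_id
              linear_continuous_on blinfun.bounded_linear_right)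
        show "continuous_on UNIV (\<lambda>x. inner (orbit_integral x t) z)"
          by (intro continuous_on_inner continuous_on_const linear_continuous_on
              bounded_linear_orbit_integral t)
        fix x assume "x \<in> Domain (generator S)"
        then obtain v where xv: "(x, v) \<in> generator S" by blast
        have "inner (S t x - x) y = inner (orbit_integral v t) y"
          using orbit_minus_start[OF xv t] by simp
        also have "\<dots> = integral {0..t} (\<lambda>s. inner (S \<bar>s\<bar> v) y)"
          using integral_linear[OF integrable_orbit[of v 0 t] bounded_linear_inner_left[of y]]
          by (simp add: o_def orbit_integral_def)
        also have "\<dots> = integral {0..t} (\<lambda>s. inner (S \<bar>s\<bar> x) z)"
        proof (rule integral_cong)
          fix s
          have "(S \<bar>s\<bar> x, S \<bar>s\<bar> v) \<in> generator S" by (rule generator_invariant[OF xv]) simp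
          then show "inner (S \<bar>s\<bar> v) y = inner (S \<bar>s\<bar> x) z" by (rule adj)
        qed
        also have "\<dots> = inner (orbit_integral x t) z"
          using integral_linear[OF integrable_orbit[of x 0 t] bounded_linear_inner_left[of z]]
          by (simp add: o_def orbit_integral_def)
        finally show "inner (S t x - x) y = inner (orbit_integral x t) z" .
      qed
      moreover have "inner (orbit_integral x t) z = inner x (R.orbit_integral z t)" for x
      proof -
        have "inner (orbit_integral x t) z = integral {0..t} (\<lambda>s. inner (S \<bar>s\<bar> x) z)"
          using integral_linear[OF integrable_orbit[of x 0 t] bounded_linear_inner_left[of z]]
          by (simp add: o_def orbit_integral_def)
        also have "\<dots> = integral {0..t} (\<lambda>s. inner x (?R \<bar>s\<bar> z))"
          by (simp add: inner_adjoint_semigroup)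
        also have "\<dots> = inner x (R.orbit_integral z t)"
          using integral_linear[OF R.integrable_orbit[of z 0 t] bounded_linear_inner_right[of x]]
          by (simp add: o_def R.orbit_integral_def)
        finally show ?thesis .
      qed
      ultimately have "inner x (?R t y - y) = inner x (R.orbit_integral z t)" for x
        by (simp add: inner_diff_right inner_diff_left inner_adjoint_semigroup)
      then show ?thesis using vector_eq_ldot by blast
    qed
    note * = this
    have "((\<lambda>h. (?R h y - y) /\<^sub>R h) \<longlongrightarrow> z) (at_right 0)"
    proof (rule Lim_transform_eventually[OF R.orbit_integral_quotient_0])
      show "eventually (\<lambda>h. R.orbit_integral z h /\<^sub>R h = (?R h y - y) /\<^sub>R h) (at_right 0)"
        by (rule eventually_at_rightI[of 0 1]) (simp_all add: *)
    qed
    then show "p \<in> generator ?R" by (simp add: p generator_def)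
  }
qed

text \<open>
  The function \<open>s \<mapsto> \<langle>S (t - s) x, R s y\<rangle>\<close> has derivative \<open>0\<close> for \<open>x\<close> and \<open>y\<close> in the dense domains
  of the generators. Since only the generators enter, the result applies to whichever semigroups
  the choice operator selects for them.
\<close>

theorem semigroups_of_adjoint_generators:
  fixes S R :: "real \<Rightarrow> 'h::{real_inner, banach} \<Rightarrow>\<^sub>L 'h"
  assumes S: "c0_semigroup S" and R: "c0_semigroup R"
    and adj: "\<And>x v y z. (x, v) \<in> generator S \<Longrightarrow> (y, z) \<in> generator R \<Longrightarrow> inner v y = inner x z"
    and t: "0 \<le> t"
  shows "inner (S t x) y = inner x (R t y)"
proof -
  interpret S: c0_semigroup S by fact
  interpret R: c0_semigroup R by fact
  have core: "inner (S t x) y = inner x (R t y)"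
    if x: "x \<in> Domain (generator S)" and y: "y \<in> Domain (generator R)" for x y
  proof -
    obtain v where v: "(x, v) \<in> generator S" using x by blast
    obtain z where z: "(y, z) \<in> generator R" using y by blast
    define \<phi> where "\<phi> s = inner (S (t - s) x) (R s y)" for s
    have "(\<phi> has_vector_derivative 0) (at s within {0..t})" if s: "s \<in> {0..t}" for s
    proof -
      have "((\<lambda>s. t - s) has_vector_derivative 0 - 1) (at s within {0..t})"
        by (intro has_vector_derivative_diff has_vector_derivative_const has_vector_derivative_id)
      moreover have "((\<lambda>s. S s x) has_vector_derivative S (t - s) v) (at (t - s) within (\<lambda>s. t - s) ` {0..t})"
        by (rule has_vector_derivative_within_subset[OF S.orbit_has_vector_derivative[OF v, of _ t]])
           (use s in auto)
      ultimately have "((\<lambda>s. S (t - s) x) has_vector_derivative - S (t - s) v) (at s within {0..t})"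
        using vector_diff_chain_within by (fastforce simp: o_def)
      moreover have "((\<lambda>s. R s y) has_vector_derivative R s z) (at s within {0..t})"
        by (rule R.orbit_has_vector_derivative[OF z s])
      ultimately have "(\<phi> has_vector_derivative
          inner (S (t - s) x) (R s z) + inner (- S (t - s) v) (R s y)) (at s within {0..t})"
        unfolding \<phi>_def by (rule bounded_bilinear.has_vector_derivative[OF bounded_bilinear_inner])
      moreover have "inner (S (t - s) v) (R s y) = inner (S (t - s) x) (R s z)"
        using s by (intro adj S.generator_invariant R.generator_invariant v z) auto
      ultimately show ?thesis by simp
    qed
    from has_vector_derivative_zero_constant[OF _ this] obtain c where "\<And>s. s \<in> {0..t} \<Longrightarrow> \<phi> s = c"
      by auto
    then have "\<phi> 0 = \<phi> t" using t by simp
    then show ?thesis by (simp add: \<phi>_def S.at_0 R.at_0)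
  qed
  have "inner (S t x) y = inner x (R t y)" if y: "y \<in> Domain (generator R)" for x y
    by (rule eq_on_closure[OF closure_Domain_generator[OF S], where f = "\<lambda>x. inner (S t x) y"
        and g = "\<lambda>x. inner x (R t y)"])
       (intro continuous_on_inner continuous_on_const continuous_on_id linear_continuous_on
          blinfun.bounded_linear_right core y | assumption)+
  note half = this
  show ?thesis
    by (rule eq_on_closure[OF closure_Domain_generator[OF R], where f = "\<lambda>y. inner (S t x) y"
        and g = "\<lambda>y. inner x (R t y)"])
       (intro continuous_on_inner continuous_on_const continuous_on_id linear_continuous_on
          blinfun.bounded_linear_right half | assumption)+
qed

theorem semigroup_of_adjoint:
  fixes A :: "('h::{real_inner, banach} \<times> 'h) set"
  assumes "generates_C0_semigroup A"
  shows "c0_semigroup (semigroup_of A)" "c0_semigroup (semigroup_of (op_adjoint A))"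
    and "0 \<le> t \<Longrightarrow> inner (semigroup_of A t x) y = inner x (semigroup_of (op_adjoint A) t y)"
proof -
  have A: "C0_semigroup (semigroup_of A) \<and> generator (semigroup_of A) = A"
    using assms unfolding generates_C0_semigroup_def semigroup_of_def by (rule someI_ex)
  then show S: "c0_semigroup (semigroup_of A)" by (simp add: c0_semigroup_def)
  have "C0_semigroup (adjoint_semigroup (semigroup_of A)) \<and>
      generator (adjoint_semigroup (semigroup_of A)) = op_adjoint A"
    using C0_semigroup_adjoint[OF S] generator_adjoint_semigroup[OF S] A by simp
  then have A': "C0_semigroup (semigroup_of (op_adjoint A)) \<and> generator (semigroup_of (op_adjoint A)) = op_adjoint A"
    using someI[of "\<lambda>S. C0_semigroup S \<and> generator S = op_adjoint A"]
    unfolding semigroup_of_def[of "op_adjoint A"] by blast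
  then show R: "c0_semigroup (semigroup_of (op_adjoint A))" by (simp add: c0_semigroup_def)
  show "inner (semigroup_of A t x) y = inner x (semigroup_of (op_adjoint A) t y)" if "0 \<le> t"
    by (rule semigroups_of_adjoint_generators[OF S R _ that]) (use A A' in \<open>auto simp: op_adjoint_def\<close>)
qed

section \<open>Exchanging integrals of strongly measurable kernels\<close>

lemma (in complete_measure) integral_cong_AE_complete:
  fixes f g :: "'a \<Rightarrow> real"
  assumes "g \<in> borel_measurable M" "AE x in M. f x = g x"
  shows "(LINT x|M. f x) = (LINT x|M. g x)"
proof (rule integral_cong_AE)
  have "AE x in M. g x = f x" using assms(2) by eventually_elim simp
  then show "f \<in> borel_measurable M" by (rule borel_measurable_cong_AE_complete[OF assms(1)])
qed fact+

lemma strongly_measurable_everywhere_limit: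
  assumes "strongly_measurable M f"
  obtains f' s where "\<And>n::nat. simple_function M (s n)" "\<And>x. (\<lambda>n. s n x) \<longlonglongrightarrow> f' x"
    "AE x in M. f x = f' x"
proof -
  obtain s where s: "\<And>n::nat. simple_function M (s n)" "AE x in M. (\<lambda>n. s n x) \<longlonglongrightarrow> f x"
    using assms unfolding strongly_measurable_def by blast
  from s(2) obtain N where N: "{x \<in> space M. \<not> (\<lambda>n. s n x) \<longlonglongrightarrow> f x} \<subseteq> N" "emeasure M N = 0" "N \<in> sets M"
    by (rule AE_E)
  define s' where "s' n x = indicat_real (space M - N) x *\<^sub>R s n x" for n x
  define f' where "f' x = indicat_real (space M - N) x *\<^sub>R f x" for x
  have "simple_function M (s' n)" for n
    unfolding s'_def using N(3)
    by (intro simple_function_compose2[where h = scaleR] simple_function_indicator s) auto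
  moreover have "(\<lambda>n. s' n x) \<longlonglongrightarrow> f' x" for x
  proof (cases "x \<in> space M - N")
    case True
    then have "(\<lambda>n. s n x) \<longlonglongrightarrow> f x" using N(1) by blast
    then show ?thesis using True by (simp add: s'_def f'_def)
  next
    case False
    then show ?thesis by (simp add: s'_def f'_def)
  qed
  moreover have "AE x in M. f x = f' x"
  proof (rule AE_I[of _ _ N])
    show "{x \<in> space M. f x \<noteq> f' x} \<subseteq> N" by (auto simp: f'_def indicator_def)
  qed (use N in auto)
  ultimately show ?thesis using that by blast
qed

text \<open>
  The product measure is not complete, so the integrand need not be measurable for it. Replacing
  \<open>G\<close> and \<open>F\<close> by everywhere limits of simple functions makes it so, and for almost all sections
  this changes the integrand only on a null set.
\<close>

theorem Fubini_strongly_measurable: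
  fixes \<Phi> :: "'b::real_normed_vector \<Rightarrow> 'c::real_normed_vector \<Rightarrow> real"
  assumes M: "finite_measure M" "complete_measure M"
    and \<Phi>: "continuous_on UNIV (\<lambda>p. \<Phi> (fst p) (snd p))"
    and G: "strongly_measurable M G" and F: "strongly_measurable M F"
    and E: "E \<in> sets (M \<Otimes>\<^sub>M M)"
    and a: "integrable M a" and b: "integrable M b"
    and bound: "\<And>s t. s \<in> space M \<Longrightarrow> t \<in> space M \<Longrightarrow> \<bar>\<Phi> (G s) (F t)\<bar> \<le> a s * b t"
  shows "(LINT t|M. LINT s|M. indicat_real E (s, t) * \<Phi> (G s) (F t))
       = (LINT s|M. LINT t|M. indicat_real E (s, t) * \<Phi> (G s) (F t))"
proof -
  interpret finite_measure M by fact
  interpret complete_measure M by fact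
  interpret P: pair_sigma_finite M M ..
  obtain G' Gn where G': "\<And>n::nat. simple_function M (Gn n)" "\<And>x. (\<lambda>n. Gn n x) \<longlonglongrightarrow> G' x"
    "AE x in M. G x = G' x"
    by (rule strongly_measurable_everywhere_limit[OF G]) (rule that)
  obtain F' Fn where F': "\<And>n::nat. simple_function M (Fn n)" "\<And>x. (\<lambda>n. Fn n x) \<longlonglongrightarrow> F' x"
    "AE x in M. F x = F' x"
    by (rule strongly_measurable_everywhere_limit[OF F]) (rule that)
  define K where "K s t = indicat_real E (s, t) * \<Phi> (G s) (F t)" for s t
  define K' where "K' p = indicat_real E p * \<Phi> (G' (fst p)) (F' (snd p))" for p
  have "(\<lambda>p. \<Phi> (G' (fst p)) (F' (snd p))) \<in> borel_measurable (M \<Otimes>\<^sub>M M)"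
  proof (rule borel_measurable_LIMSEQ_metric)
    show "(\<lambda>p. \<Phi> (Gn n (fst p)) (Fn n (snd p))) \<in> borel_measurable (M \<Otimes>\<^sub>M M)" for n
      by (intro borel_measurable_simple_function simple_function_compose2[where h = \<Phi>]
          simple_function_comp[OF measurable_fst] simple_function_comp[OF measurable_snd] G' F')
    show "(\<lambda>n. \<Phi> (Gn n (fst p)) (Fn n (snd p))) \<longlonglongrightarrow> \<Phi> (G' (fst p)) (F' (snd p))" for p
    proof -
      have "isCont (\<lambda>p. \<Phi> (fst p) (snd p)) (G' (fst p), F' (snd p))"
        using \<Phi> by (simp add: continuous_on_eq_continuous_at)
      from isCont_tendsto_compose[OF this tendsto_Pair[OF G'(2)[of "fst p"] F'(2)[of "snd p"]]]
      show ?thesis by simp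
    qed
  qed
  then have K'[measurable]: "K' \<in> borel_measurable (M \<Otimes>\<^sub>M M)"
    unfolding K'_def using E by measurable
  have sec1: "(\<lambda>s. K' (s, t)) \<in> borel_measurable M" if "t \<in> space M" for t
    using that by measurable
  have sec2: "(\<lambda>t. K' (s, t)) \<in> borel_measurable M" if "s \<in> space M" for s
    using that by measurable
  have bound': "norm (K' (s, t)) \<le> a s * b t"
    if "s \<in> space M" "t \<in> space M" "G s = G' s" "F t = F' t" for s t
    using bound[OF that(1,2)] that(3,4) by (auto simp: K'_def indicator_def intro: order_trans[OF abs_ge_zero])
  have inner_int: "AE s in M. integrable M (\<lambda>t. K' (s, t)) \<and>
      (LINT t|M. norm (K' (s, t))) \<le> a s * (LINT t|M. b t)"
    using G'(3) AE_space
  proof eventually_elim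
    case (elim s)
    have ae: "AE t in M. norm (K' (s, t)) \<le> a s * b t"
      using F'(3) AE_space by eventually_elim (use bound' elim in auto)
    have ab: "integrable M (\<lambda>t. a s * b t)" using b by simp
    have int: "integrable M (\<lambda>t. K' (s, t))"
    proof (rule Bochner_Integration.integrable_bound[OF ab sec2[OF elim(2)]])
      show "AE t in M. norm (K' (s, t)) \<le> norm (a s * b t)"
        using ae by eventually_elim simp
    qed
    have "(LINT t|M. norm (K' (s, t))) \<le> (LINT t|M. a s * b t)"
      by (rule integral_mono_AE[OF integrable_norm[OF int] ab ae])
    with int show ?case by simp
  qed
  have "integrable (M \<Otimes>\<^sub>M M) K'"
  proof (rule P.Fubini_integrable[OF K'])
    show "AE s in M. integrable M (\<lambda>t. K' (s, t))" using inner_int by eventually_elim simp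
    show "integrable M (\<lambda>s. LINT t|M. norm (K' (s, t)))"
    proof (rule Bochner_Integration.integrable_bound)
      show "integrable M (\<lambda>s. a s * (LINT t|M. b t))" using a by simp
      show "(\<lambda>s. LINT t|M. norm (K' (s, t))) \<in> borel_measurable M" by measurable
      show "AE s in M. norm (LINT t|M. norm (K' (s, t))) \<le> norm (a s * (LINT t|M. b t))"
        using inner_int
      proof eventually_elim
        case (elim s)
        have "0 \<le> (LINT t|M. norm (K' (s, t)))" by (rule integral_nonneg_AE) simp
        then have "norm (LINT t|M. norm (K' (s, t))) = (LINT t|M. norm (K' (s, t)))" by simp
        also have "\<dots> \<le> a s * (LINT t|M. b t)" using elim by blast
        also have "\<dots> \<le> norm (a s * (LINT t|M. b t))" by simp
        finally show ?case .
      qed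
    qed
  qed
  then have fub: "(LINT t|M. LINT s|M. K' (s, t)) = (LINT s|M. LINT t|M. K' (s, t))"
    using P.Fubini_integral[of "\<lambda>s t. K' (s, t)"] by simp
  have 1: "(LINT t|M. LINT s|M. K s t) = (LINT t|M. LINT s|M. K' (s, t))"
  proof (rule integral_cong_AE_complete)
    show "(\<lambda>t. LINT s|M. K' (s, t)) \<in> borel_measurable M" by measurable
    show "AE t in M. (LINT s|M. K s t) = (LINT s|M. K' (s, t))"
      using F'(3) AE_space
    proof eventually_elim
      case (elim t)
      have "AE s in M. K s t = K' (s, t)"
        using G'(3) by eventually_elim (simp add: K_def K'_def elim)
      then show ?case by (rule integral_cong_AE_complete[OF sec1[OF elim(2)]])
    qed
  qed
  have 2: "(LINT s|M. LINT t|M. K s t) = (LINT s|M. LINT t|M. K' (s, t))"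
  proof (rule integral_cong_AE_complete)
    show "(\<lambda>s. LINT t|M. K' (s, t)) \<in> borel_measurable M" by measurable
    show "AE s in M. (LINT t|M. K s t) = (LINT t|M. K' (s, t))"
      using G'(3) AE_space
    proof eventually_elim
      case (elim s)
      have "AE t in M. K s t = K' (s, t)"
        using F'(3) by eventually_elim (simp add: K_def K'_def elim)
      then show ?case by (rule integral_cong_AE_complete[OF sec2[OF elim(2)]])
    qed
  qed
  show ?thesis using 1 2 fub by (simp add: K_def)
qed

section \<open>Duhamel integrals\<close>

lemma AE_interval_neq: "AE s in lebesgue_on {a..b::real}. s \<noteq> t"
proof -
  have "AE s in lebesgue. s \<noteq> t" by (rule AE_completion[OF AE_lborel_singleton])
  then have "AE s in lebesgue. s \<in> {a..b} \<longrightarrow> s \<noteq> t" by eventually_elim simp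
  then show ?thesis by (subst AE_restrict_space_iff) auto
qed

text \<open>
  This is dominated convergence along sequences. Convergence of the kernels is required only
  almost everywhere because the kernel \<open>k t\<close> of a Duhamel integral jumps at \<open>s = t\<close>.
\<close>

lemma continuous_on_integral_dominated:
  fixes k :: "real \<Rightarrow> real \<Rightarrow> 'a::banach"
  assumes meas: "\<And>t. t \<in> {0..T} \<Longrightarrow> strongly_measurable (lebesgue_on {0..T}) (k t)"
    and h: "integrable (lebesgue_on {0..T}) h"
    and bound: "\<And>t s. t \<in> {0..T} \<Longrightarrow> s \<in> {0..T} \<Longrightarrow> norm (k t s) \<le> h s"
    and conv: "\<And>\<tau> t. (\<And>n. \<tau> n \<in> {0..T}) \<Longrightarrow> t \<in> {0..T} \<Longrightarrow> \<tau> \<longlonglongrightarrow> t \<Longrightarrow>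
      AE s in lebesgue_on {0..T}. (\<lambda>n::nat. k (\<tau> n) s) \<longlonglongrightarrow> k t s"
  shows "continuous_on {0..T} (\<lambda>t. integral {0..T} (k t))"
proof (rule continuous_on_sequentiallyI)
  let ?M = "lebesgue_on {0..T}"
  fix \<tau> :: "nat \<Rightarrow> real" and t
  assume \<tau>: "\<forall>n. \<tau> n \<in> {0..T}" and t: "t \<in> {0..T}" and lim: "\<tau> \<longlonglongrightarrow> t"
  have mdiff: "strongly_measurable ?M (\<lambda>s. k (\<tau> n) s - k t s)" for n
    using \<tau> t by (intro strongly_measurable_diff meas) auto
  have nint: "integrable ?M (\<lambda>s. norm (k r s))" if "r \<in> {0..T}" for r
  proof (rule Bochner_Integration.integrable_bound[OF h])
    show "(\<lambda>s. norm (k r s)) \<in> borel_measurable ?M"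
      by (intro borel_measurable_if_strongly_measurable strongly_measurable_norm meas that)
    show "AE s in ?M. norm (norm (k r s)) \<le> norm (h s)"
      using bound[OF that] by (intro AE_I2) (auto intro: order_trans[OF _ abs_ge_self])
  qed
  have kint: "k r integrable_on {0..T}" if "r \<in> {0..T}" for r
    by (rule strongly_measurable_integrable_on[OF meas[OF that] nint[OF that]])
  have bm: "(\<lambda>s. norm (k (\<tau> n) s - k t s)) \<in> borel_measurable ?M" for n
    by (intro borel_measurable_if_strongly_measurable strongly_measurable_norm mdiff)
  have h2: "integrable ?M (\<lambda>s. 2 * h s)" using h by simp
  have le2: "norm (k (\<tau> n) s - k t s) \<le> 2 * h s" if "s \<in> {0..T}" for n s
    using norm_triangle_ineq4[of "k (\<tau> n) s" "k t s"] bound[OF t that] bound[of "\<tau> n" s] \<tau> that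
    by (smt (verit, best))
  have "(\<lambda>n. LINT s|?M. norm (k (\<tau> n) s - k t s)) \<longlonglongrightarrow> (LINT s|?M. 0)"
  proof (rule integral_dominated_convergence[OF _ bm h2])
    show "AE s in ?M. (\<lambda>n. norm (k (\<tau> n) s - k t s)) \<longlonglongrightarrow> 0"
    proof -
      have "AE s in ?M. (\<lambda>n. k (\<tau> n) s) \<longlonglongrightarrow> k t s" by (rule conv[OF _ t lim]) (use \<tau> in blast)
      then show ?thesis
      proof eventually_elim
        case (elim s)
        then show ?case by (simp add: LIM_zero_iff tendsto_norm_zero_iff)
      qed
    qed
    show "AE s in ?M. norm (norm (k (\<tau> n) s - k t s)) \<le> 2 * h s" for n
      using le2 by (intro AE_I2) simp
  qed simp
  then have lim0: "(\<lambda>n. LINT s|?M. norm (k (\<tau> n) s - k t s)) \<longlonglongrightarrow> 0" by simp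
  have "norm (integral {0..T} (k (\<tau> n)) - integral {0..T} (k t)) \<le> (LINT s|?M. norm (k (\<tau> n) s - k t s))" for n
  proof -
    have "integral {0..T} (k (\<tau> n)) - integral {0..T} (k t) = integral {0..T} (\<lambda>s. k (\<tau> n) s - k t s)"
      using \<tau> t kint by (simp add: Henstock_Kurzweil_Integration.integral_diff)
    also have "norm \<dots> \<le> (LINT s|?M. norm (k (\<tau> n) s - k t s))"
    proof (rule norm_integral_le[OF mdiff])
      show "integrable ?M (\<lambda>s. norm (k (\<tau> n) s - k t s))"
        by (rule Bochner_Integration.integrable_bound[OF h2 bm])
           (use le2 in \<open>intro AE_I2, fastforce intro: order_trans[OF _ abs_ge_self]\<close>)
    qed
    finally show ?thesis .
  qed
  then have "(\<lambda>n. integral {0..T} (k (\<tau> n)) - integral {0..T} (k t)) \<longlonglongrightarrow> 0"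
    by (intro Lim_null_comparison[OF always_eventually lim0]) simp
  then show "(\<lambda>n. integral {0..T} (k (\<tau> n))) \<longlonglongrightarrow> integral {0..T} (k t)"
    by (rule LIM_zero_cancel)
qed

text \<open>
  One kernel serves both directions of time: \<open>E t\<close> consists of the times before \<open>t\<close> for the forward
  equation and of the times after \<open>t\<close> for the backward equation.
\<close>

definition duhamel_kernel ::
  "(real \<Rightarrow> 'a::real_normed_vector \<Rightarrow>\<^sub>L 'a) \<Rightarrow> (real \<Rightarrow> real set) \<Rightarrow> (real \<Rightarrow> 'a) \<Rightarrow> real \<Rightarrow> real \<Rightarrow> 'a" where
  "duhamel_kernel S E g t s = (if s \<in> E t then S \<bar>t - s\<bar> (g s) else 0)"

context c0_semigroup
begin

lemma strongly_measurable_action: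
  assumes "strongly_measurable (lebesgue_on {0..T}) g"
  shows "strongly_measurable (lebesgue_on {0..T}) (\<lambda>s. S \<bar>t - s\<bar> (g s))"
proof (rule strongly_measurable_compose_Pair[where \<phi> = "\<lambda>s x. S \<bar>t - s\<bar> x"])
  show "continuous_on UNIV (\<lambda>p. S \<bar>t - fst p\<bar> (snd p))"
  proof -
    have "continuous_on UNIV (\<lambda>p::real \<times> 'a. (t - fst p, snd p))"
      by (intro continuous_on_Pair continuous_on_diff continuous_on_const continuous_on_fst
          continuous_on_snd continuous_on_id)
    from continuous_on_compose2[OF continuous_action this] show ?thesis by simp
  qed
  show "strongly_measurable (lebesgue_on {0..T}) (\<lambda>s. s)" by (rule strongly_measurable_ident)
qed fact

lemma duhamel_kernel:
  assumes g: "g \<in> L2 T" and E: "\<And>t. E t \<in> sets (lebesgue_on {0..T})" and t: "t \<in> {0..T}"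
  shows "strongly_measurable (lebesgue_on {0..T}) (duhamel_kernel S E g t)"
    and "integrable (lebesgue_on {0..T}) (\<lambda>s. norm (duhamel_kernel S E g t s))"
    and "duhamel_kernel S E g t integrable_on {0..T}"
proof -
  obtain M where M: "M \<ge> 0" "\<And>t. t \<in> {0..T} \<Longrightarrow> norm (S t) \<le> M" using locally_bounded by blast
  show m: "strongly_measurable (lebesgue_on {0..T}) (duhamel_kernel S E g t)"
    unfolding duhamel_kernel_def
    by (intro strongly_measurable_If strongly_measurable_action L2_strongly_measurable g E)
  have le: "norm (duhamel_kernel S E g t s) \<le> M * norm (g s)" if "s \<in> {0..T}" for s
  proof -
    have "norm (S \<bar>t - s\<bar> (g s)) \<le> M * norm (g s)"
      using t that by (intro order_trans[OF norm_blinfun] mult_right_mono M) auto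
    then show ?thesis using M(1) by (simp add: duhamel_kernel_def)
  qed
  show i: "integrable (lebesgue_on {0..T}) (\<lambda>s. norm (duhamel_kernel S E g t s))"
  proof (rule Bochner_Integration.integrable_bound)
    show "integrable (lebesgue_on {0..T}) (\<lambda>s. M * norm (g s))" using L2_norm_integrable[OF g] by simp
    show "(\<lambda>s. norm (duhamel_kernel S E g t s)) \<in> borel_measurable (lebesgue_on {0..T})"
      by (intro borel_measurable_if_strongly_measurable strongly_measurable_norm m)
    show "AE s in lebesgue_on {0..T}. norm (norm (duhamel_kernel S E g t s)) \<le> norm (M * norm (g s))"
      using le M(1) by (intro AE_I2) (simp add: abs_mult)
  qed
  show "duhamel_kernel S E g t integrable_on {0..T}"
    by (rule strongly_measurable_integrable_on[OF m i])
qed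

lemma continuous_on_duhamel:
  assumes g: "g \<in> L2 T" and E: "\<And>t. E t \<in> sets (lebesgue_on {0..T})"
    and switch: "\<And>\<tau> t s. \<tau> \<longlonglongrightarrow> t \<Longrightarrow> s \<noteq> t \<Longrightarrow> s \<in> {0..T} \<Longrightarrow>
      eventually (\<lambda>n::nat. s \<in> E (\<tau> n) \<longleftrightarrow> s \<in> E t) sequentially"
  shows "continuous_on {0..T} (\<lambda>t. integral {0..T} (duhamel_kernel S E g t))"
proof -
  obtain M where M: "M \<ge> 0" "\<And>t. t \<in> {0..T} \<Longrightarrow> norm (S t) \<le> M" using locally_bounded by blast
  show ?thesis
  proof (rule continuous_on_integral_dominated)
    show "integrable (lebesgue_on {0..T}) (\<lambda>s. M * norm (g s))" using L2_norm_integrable[OF g] by simp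
    show "norm (duhamel_kernel S E g t s) \<le> M * norm (g s)" if "t \<in> {0..T}" "s \<in> {0..T}" for t s
    proof -
      have "norm (S \<bar>t - s\<bar> (g s)) \<le> M * norm (g s)"
        using that by (intro order_trans[OF norm_blinfun] mult_right_mono M) auto
      then show ?thesis using M(1) by (simp add: duhamel_kernel_def)
    qed
    fix \<tau> :: "nat \<Rightarrow> real" and t
    assume lim: "\<tau> \<longlonglongrightarrow> t"
    show "AE s in lebesgue_on {0..T}. (\<lambda>n. duhamel_kernel S E g (\<tau> n) s) \<longlonglongrightarrow> duhamel_kernel S E g t s"
      using AE_interval_neq[where a = 0 and b = T and t = t] AE_space
    proof eventually_elim
      case (elim s)
      have "(\<lambda>n. S \<bar>\<tau> n - s\<bar> (g s)) \<longlonglongrightarrow> S \<bar>t - s\<bar> (g s)"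
        using continuous_on_tendsto_compose[OF continuous_orbit tendsto_diff[OF lim tendsto_const[of s]]]
        by simp
      then have "(\<lambda>n. if s \<in> E t then S \<bar>\<tau> n - s\<bar> (g s) else 0) \<longlonglongrightarrow> duhamel_kernel S E g t s"
        by (simp add: duhamel_kernel_def)
      moreover have "eventually (\<lambda>n. (if s \<in> E t then S \<bar>\<tau> n - s\<bar> (g s) else 0)
          = duhamel_kernel S E g (\<tau> n) s) sequentially"
        using switch[OF lim elim(1)] elim(2) by (auto elim!: eventually_mono simp: duhamel_kernel_def)
      ultimately show ?case by (rule Lim_transform_eventually)
    qed
  qed (rule duhamel_kernel(1)[OF g E])
qed

end

abbreviation before :: "real \<Rightarrow> real \<Rightarrow> real set" where
  "before T t \<equiv> {0..T} \<inter> {..t}"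

abbreviation after :: "real \<Rightarrow> real \<Rightarrow> real set" where
  "after T t \<equiv> {0..T} \<inter> {t..}"

lemma sets_before_after: "before T t \<in> sets (lebesgue_on {0..T})" "after T t \<in> sets (lebesgue_on {0..T})"
  by (simp_all add: sets_restrict_space_iff)

lemma eventually_switch:
  fixes \<tau> :: "nat \<Rightarrow> real"
  assumes "\<tau> \<longlonglongrightarrow> t" "s \<noteq> t"
  shows "eventually (\<lambda>n. s \<in> before T (\<tau> n) \<longleftrightarrow> s \<in> before T t) sequentially"
    and "eventually (\<lambda>n. s \<in> after T (\<tau> n) \<longleftrightarrow> s \<in> after T t) sequentially"
proof -
  have *: "eventually (\<lambda>n. (s < \<tau> n \<longleftrightarrow> s < t) \<and> \<tau> n \<noteq> s) sequentially"
  proof (cases "s < t")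
    case True
    show ?thesis using order_tendstoD(1)[OF assms(1) True] by eventually_elim (use True in auto)
  next
    case False
    then have "t < s" using assms(2) by simp
    show ?thesis using order_tendstoD(2)[OF assms(1) \<open>t < s\<close>] by eventually_elim (use \<open>t < s\<close> in auto)
  qed
  show "eventually (\<lambda>n. s \<in> before T (\<tau> n) \<longleftrightarrow> s \<in> before T t) sequentially"
    using * by eventually_elim (use assms(2) in auto)
  show "eventually (\<lambda>n. s \<in> after T (\<tau> n) \<longleftrightarrow> s \<in> after T t) sequentially"
    using * by eventually_elim (use assms(2) in auto)
qed

lemma integral_duhamel_kernel:
  fixes S :: "real \<Rightarrow> 'a::banach \<Rightarrow>\<^sub>L 'a"
  assumes t: "t \<in> {0..T}"
  shows "integral {0..t} (\<lambda>s. S (t - s) (g s)) = integral {0..T} (duhamel_kernel S (before T) g t)"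
    and "integral {t..T} (\<lambda>s. S (s - t) (g s)) = integral {0..T} (duhamel_kernel S (after T) g t)"
proof -
  have "integral {0..t} (\<lambda>s. S (t - s) (g s)) = integral {0..T} (\<lambda>s. if s \<in> {0..t} then S (t - s) (g s) else 0)"
    unfolding Henstock_Kurzweil_Integration.integral_restrict_Int using t by (simp add: Int_absorb2)
  also have "\<dots> = integral {0..T} (duhamel_kernel S (before T) g t)"
    by (rule integral_cong) (auto simp: duhamel_kernel_def)
  finally show "integral {0..t} (\<lambda>s. S (t - s) (g s)) = integral {0..T} (duhamel_kernel S (before T) g t)" .
  have "integral {t..T} (\<lambda>s. S (s - t) (g s)) = integral {0..T} (\<lambda>s. if s \<in> {t..T} then S (s - t) (g s) else 0)"
    unfolding Henstock_Kurzweil_Integration.integral_restrict_Int using t by (simp add: Int_absorb2)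
  also have "\<dots> = integral {0..T} (duhamel_kernel S (after T) g t)"
    by (rule integral_cong) (auto simp: duhamel_kernel_def)
  finally show "integral {t..T} (\<lambda>s. S (s - t) (g s)) = integral {0..T} (duhamel_kernel S (after T) g t)" .
qed

locale dual_semigroups = S: c0_semigroup S + R: c0_semigroup R
  for S R :: "real \<Rightarrow> 'h::{real_inner, banach} \<Rightarrow>\<^sub>L 'h" +
  assumes dual: "0 \<le> t \<Longrightarrow> inner (S t x) y = inner x (R t y)"
begin

text \<open>
  Both sides integrate \<open>\<langle>S (t - s) (g s), f t\<rangle>\<close> over the triangle \<open>0 \<le> s \<le> t \<le> T\<close>, in different
  orders.
\<close>

lemma duhamel_duality:
  assumes g: "g \<in> L2 T" and f: "f \<in> L2 T"
  shows "L2_inner T (\<lambda>t. integral {0..T} (duhamel_kernel S (before T) g t)) f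
       = L2_inner T g (\<lambda>s. integral {0..T} (duhamel_kernel R (after T) f s))"
proof -
  let ?M = "lebesgue_on {0..T}"
  \<comment> \<open>carrying the time along with the value makes the integrand a continuous function of the data\<close>
  define \<Phi> where "\<Phi> = (\<lambda>(s, x) (t, y). inner (S \<bar>t - s\<bar> x) y)"
  define E where "E = {p \<in> space (?M \<Otimes>\<^sub>M ?M). fst p \<le> snd p}"
  obtain C where C: "C \<ge> 0" "\<And>t. t \<in> {0..T} \<Longrightarrow> norm (S t) \<le> C" using S.locally_bounded by blast
  have id: "(\<lambda>s::real. s) \<in> borel_measurable ?M" by (rule id_borel_measurable_lebesgue_on[unfolded id_def])
  have [measurable]: "fst \<in> borel_measurable (?M \<Otimes>\<^sub>M ?M)" "snd \<in> borel_measurable (?M \<Otimes>\<^sub>M ?M)"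
    by (rule measurable_compose[OF measurable_fst id] measurable_compose[OF measurable_snd id])+
  have "E \<in> sets (?M \<Otimes>\<^sub>M ?M)" unfolding E_def by measurable
  moreover have "continuous_on UNIV (\<lambda>p. \<Phi> (fst p) (snd p))"
  proof -
    have "continuous_on UNIV (\<lambda>p::(real \<times> 'h) \<times> (real \<times> 'h). (fst (snd p) - fst (fst p), snd (fst p)))"
      by (intro continuous_intros)
    from continuous_on_compose2[OF S.continuous_action this]
    have "continuous_on UNIV (\<lambda>p::(real \<times> 'h) \<times> (real \<times> 'h). S \<bar>fst (snd p) - fst (fst p)\<bar> (snd (fst p)))"
      by simp
    then have "continuous_on UNIV (\<lambda>p::(real \<times> 'h) \<times> (real \<times> 'h).
        inner (S \<bar>fst (snd p) - fst (fst p)\<bar> (snd (fst p))) (snd (snd p)))"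
      by (intro continuous_on_inner continuous_on_snd continuous_on_id)
    then show ?thesis by (simp add: \<Phi>_def case_prod_beta)
  qed
  moreover have "\<bar>\<Phi> (s, g s) (t, f t)\<bar> \<le> (C * norm (g s)) * norm (f t)" if "s \<in> space ?M" "t \<in> space ?M" for s t
  proof -
    have "\<bar>\<Phi> (s, g s) (t, f t)\<bar> \<le> norm (S \<bar>t - s\<bar> (g s)) * norm (f t)"
      by (simp add: \<Phi>_def Cauchy_Schwarz_ineq2)
    also have "\<dots> \<le> (C * norm (g s)) * norm (f t)"
      using that by (intro mult_right_mono order_trans[OF norm_blinfun] C) auto
    finally show ?thesis .
  qed
  ultimately have swap: "(LINT t|?M. LINT s|?M. indicat_real E (s, t) * \<Phi> (s, g s) (t, f t))
       = (LINT s|?M. LINT t|?M. indicat_real E (s, t) * \<Phi> (s, g s) (t, f t))"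
    using L2_norm_integrable[OF g] L2_norm_integrable[OF f]
    by (intro Fubini_strongly_measurable[where a = "\<lambda>s. C * norm (g s)" and b = "\<lambda>t. norm (f t)"]
        finite_measure_interval complete_measure_interval strongly_measurable_Pair
        strongly_measurable_ident L2_strongly_measurable g f) simp_all
  have lhs: "inner (integral {0..T} (duhamel_kernel S (before T) g t)) (f t)
      = (LINT s|?M. indicat_real E (s, t) * \<Phi> (s, g s) (t, f t))" if t: "t \<in> {0..T}" for t
  proof -
    have "inner (integral {0..T} (duhamel_kernel S (before T) g t)) (f t)
        = (LINT s|?M. inner (duhamel_kernel S (before T) g t s) (f t))"
      by (rule inner_integral[OF S.duhamel_kernel(1,2)[OF g sets_before_after(1) t]])
    also have "\<dots> = (LINT s|?M. indicat_real E (s, t) * \<Phi> (s, g s) (t, f t))"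
      by (rule Bochner_Integration.integral_cong)
         (use t in \<open>auto simp: duhamel_kernel_def E_def \<Phi>_def indicator_def space_pair_measure\<close>)
    finally show ?thesis .
  qed
  have rhs: "inner (g s) (integral {0..T} (duhamel_kernel R (after T) f s))
      = (LINT t|?M. indicat_real E (s, t) * \<Phi> (s, g s) (t, f t))" if s: "s \<in> {0..T}" for s
  proof -
    have "inner (integral {0..T} (duhamel_kernel R (after T) f s)) (g s)
        = (LINT t|?M. inner (duhamel_kernel R (after T) f s t) (g s))"
      by (rule inner_integral[OF R.duhamel_kernel(1,2)[OF f sets_before_after(2) s]])
    also have "\<dots> = (LINT t|?M. indicat_real E (s, t) * \<Phi> (s, g s) (t, f t))"
      by (rule Bochner_Integration.integral_cong)
         (use s in \<open>auto simp: duhamel_kernel_def E_def \<Phi>_def indicator_def space_pair_measure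
            dual[symmetric] inner_commute abs_minus_commute\<close>)
    finally show ?thesis by (simp add: inner_commute)
  qed
  have "L2_inner T (\<lambda>t. integral {0..T} (duhamel_kernel S (before T) g t)) f
      = (LINT t|?M. LINT s|?M. indicat_real E (s, t) * \<Phi> (s, g s) (t, f t))"
    unfolding L2_inner_def by (rule Bochner_Integration.integral_cong[OF refl]) (rule lhs, simp)
  also have "\<dots> = (LINT s|?M. LINT t|?M. indicat_real E (s, t) * \<Phi> (s, g s) (t, f t))" by (rule swap)
  also have "\<dots> = L2_inner T g (\<lambda>s. integral {0..T} (duhamel_kernel R (after T) f s))"
    unfolding L2_inner_def by (rule Bochner_Integration.integral_cong[OF refl]) (rule rhs[symmetric], simp)
  finally show ?thesis .
qed

end

section \<open>Duality of forward and backward mild solutions\<close>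

lemma mild_solution_eq:
  fixes A :: "('a::banach \<times> 'a) set"
  assumes "t \<in> {0..T}"
  shows "mild_solution A y0 g t = semigroup_of A t y0
    + integral {0..T} (duhamel_kernel (semigroup_of A) (before T) g t)"
  unfolding mild_solution_def integral_duhamel_kernel(1)[OF assms] ..

lemma backward_mild_solution_eq:
  fixes A :: "('a::banach \<times> 'a) set"
  assumes "t \<in> {0..T}"
  shows "backward_mild_solution A T zT f t = semigroup_of A (T - t) zT
    - integral {0..T} (duhamel_kernel (semigroup_of A) (after T) f t)"
  unfolding backward_mild_solution_def integral_duhamel_kernel(2)[OF assms] ..

context c0_semigroup
begin

lemma orbit_L2:
  assumes "0 \<le> T"
  shows "(\<lambda>t. S t x) \<in> L2 T" "(\<lambda>t. S (T - t) x) \<in> L2 T"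
proof -
  have "(\<lambda>t. S \<bar>t\<bar> x) \<in> L2 T" "(\<lambda>t. S \<bar>T - t\<bar> x) \<in> L2 T"
    by (intro continuous_on_imp_L2 assms continuous_on_subset[OF continuous_orbit]
        continuous_on_compose2[OF continuous_orbit] continuous_on_diff continuous_on_const
        continuous_on_id subset_UNIV)+
  from this[THEN L2_cong] show "(\<lambda>t. S t x) \<in> L2 T" "(\<lambda>t. S (T - t) x) \<in> L2 T" by simp_all
qed

lemma duhamel_L2:
  assumes "0 \<le> T" "g \<in> L2 T"
  shows "(\<lambda>t. integral {0..T} (duhamel_kernel S (before T) g t)) \<in> L2 T"
    and "(\<lambda>t. integral {0..T} (duhamel_kernel S (after T) g t)) \<in> L2 T"
proof -
  show "(\<lambda>t. integral {0..T} (duhamel_kernel S (before T) g t)) \<in> L2 T"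
    by (intro continuous_on_imp_L2 assms continuous_on_duhamel sets_before_after eventually_switch)
  show "(\<lambda>t. integral {0..T} (duhamel_kernel S (after T) g t)) \<in> L2 T"
    by (intro continuous_on_imp_L2 assms continuous_on_duhamel sets_before_after eventually_switch)
qed

end

lemma mild_solution_L2:
  assumes "c0_semigroup (semigroup_of A)" "0 \<le> T" "g \<in> L2 T"
  shows "mild_solution A y0 g \<in> L2 T"
proof -
  interpret c0_semigroup "semigroup_of A" by fact
  show ?thesis
    by (rule L2_cong[OF L2_add[OF orbit_L2(1)[OF assms(2)] duhamel_L2(1)[OF assms(2,3)]]])
       (rule mild_solution_eq[symmetric])
qed

lemma backward_mild_solution_L2:
  assumes "c0_semigroup (semigroup_of A)" "0 \<le> T" "f \<in> L2 T"
  shows "backward_mild_solution A T zT f \<in> L2 T"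
proof -
  interpret c0_semigroup "semigroup_of A" by fact
  show ?thesis
    by (rule L2_cong[OF L2_diff[OF orbit_L2(2)[OF assms(2)] duhamel_L2(2)[OF assms(2,3)]]])
       (rule backward_mild_solution_eq[symmetric])
qed

lemma backward_mild_solution_comb:
  assumes "c0_semigroup (semigroup_of A)" and f: "f \<in> L2 T" "f' \<in> L2 T" and t: "t \<in> {0..T}"
  shows "backward_mild_solution A T (zT + c *\<^sub>R zT') (\<lambda>s. f s + c *\<^sub>R f' s) t
    = backward_mild_solution A T zT f t + c *\<^sub>R backward_mild_solution A T zT' f' t"
proof -
  interpret c0_semigroup "semigroup_of A" by fact
  let ?k = "duhamel_kernel (semigroup_of A) (after T)"
  have i: "?k f t integrable_on {0..T}" "?k f' t integrable_on {0..T}"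
    by (rule duhamel_kernel(3)[OF f(1) sets_before_after(2) t] duhamel_kernel(3)[OF f(2) sets_before_after(2) t])+
  have "?k (\<lambda>s. f s + c *\<^sub>R f' s) t = (\<lambda>s. ?k f t s + c *\<^sub>R ?k f' t s)"
    by (auto simp: duhamel_kernel_def blinfun.add_right blinfun.scaleR_right)
  then have "integral {0..T} (?k (\<lambda>s. f s + c *\<^sub>R f' s) t) = integral {0..T} (?k f t) + c *\<^sub>R integral {0..T} (?k f' t)"
    using Henstock_Kurzweil_Integration.integral_add[OF i(1) integrable_cmul[OF i(2), of c]] by simp
  then show ?thesis
    by (simp add: backward_mild_solution_eq[OF t] blinfun.add_right blinfun.scaleR_right algebra_simps)
qed

text \<open>
  Formally this is the integral over \<open>[0, T]\<close> of the derivative of \<open>\<langle>y, z\<rangle>\<close>. Mild solutions need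
  not be differentiable, so both solutions are expanded by Duhamel's formula instead: the
  contributions of the initial and final data match directly, those of \<open>g\<close> and \<open>f\<close> by
  \<open>duhamel_duality\<close>.
\<close>

theorem mild_solution_duality:
  fixes A :: "('h::{real_inner, banach} \<times> 'h) set" and y0 zT :: 'h
  assumes A: "generates_C0_semigroup A" and T: "0 \<le> T" and g: "g \<in> L2 T" and f: "f \<in> L2 T"
  defines "y \<equiv> mild_solution A y0 g" and "z \<equiv> backward_mild_solution (op_adjoint A) T zT f"
  shows "inner (y T) zT - inner y0 (z 0) = L2_inner T g z + L2_inner T y f"
proof -
  let ?M = "lebesgue_on {0..T}"
  let ?S = "semigroup_of A" and ?R = "semigroup_of (op_adjoint A)"
  interpret S: c0_semigroup ?S by (rule semigroup_of_adjoint(1)[OF A])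
  interpret R: c0_semigroup ?R by (rule semigroup_of_adjoint(2)[OF A])
  interpret dual_semigroups ?S ?R by standard (rule semigroup_of_adjoint(3)[OF A])
  define V where "V t = integral {0..T} (duhamel_kernel ?S (before T) g t)" for t
  define Z where "Z t = integral {0..T} (duhamel_kernel ?R (after T) f t)" for t
  have V: "V \<in> L2 T" and Z: "Z \<in> L2 T"
    unfolding V_def Z_def by (intro S.duhamel_L2 R.duhamel_L2 T g f)+
  have y: "y t = ?S t y0 + V t" and z: "z t = ?R (T - t) zT - Z t" if "t \<in> {0..T}" for t
    using that unfolding y_def z_def V_def Z_def
    by (rule mild_solution_eq, rule backward_mild_solution_eq)
  have "inner (V T) zT = (LINT s|?M. inner (duhamel_kernel ?S (before T) g T s) zT)"
    unfolding V_def by (rule inner_integral[OF S.duhamel_kernel(1,2)[OF g sets_before_after(1)]]) (use T in auto)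
  also have "\<dots> = L2_inner T g (\<lambda>t. ?R (T - t) zT)"
    unfolding L2_inner_def
    by (rule Bochner_Integration.integral_cong) (auto simp: duhamel_kernel_def dual)
  finally have VT: "inner (V T) zT = L2_inner T g (\<lambda>t. ?R (T - t) zT)" .
  have "inner (Z 0) y0 = (LINT s|?M. inner (duhamel_kernel ?R (after T) f 0 s) y0)"
    unfolding Z_def by (rule inner_integral[OF R.duhamel_kernel(1,2)[OF f sets_before_after(2)]]) (use T in auto)
  also have "\<dots> = L2_inner T (\<lambda>t. ?S t y0) f"
    unfolding L2_inner_def
    by (rule Bochner_Integration.integral_cong) (auto simp: duhamel_kernel_def dual[symmetric] inner_commute)
  finally have Z0: "inner y0 (Z 0) = L2_inner T (\<lambda>t. ?S t y0) f" by (simp add: inner_commute)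
  have "L2_inner T g z = L2_inner T g (\<lambda>t. ?R (T - t) zT + (-1) *\<^sub>R Z t)"
    by (rule L2_inner_cong) (simp add: z)
  then have gz: "L2_inner T g z = L2_inner T g (\<lambda>t. ?R (T - t) zT) - L2_inner T g Z"
    using L2_inner_comb_right[OF R.orbit_L2(2)[OF T] Z g, of zT "-1"] by simp
  have "L2_inner T y f = L2_inner T (\<lambda>t. ?S t y0 + 1 *\<^sub>R V t) f"
    by (rule L2_inner_cong) (simp add: y)
  then have yf: "L2_inner T y f = L2_inner T (\<lambda>t. ?S t y0) f + L2_inner T V f"
    using L2_inner_comb[OF S.orbit_L2(1)[OF T] V f, of y0 1] by simp
  have "L2_inner T V f = L2_inner T g Z"
    using duhamel_duality[OF g f] unfolding V_def Z_def .
  moreover have "inner (y T) zT = inner (?S T y0) zT + inner (V T) zT"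
    using T by (simp add: y inner_add_left)
  moreover have "inner y0 (z 0) = inner (?S T y0) zT - inner y0 (Z 0)"
    using T by (simp add: z inner_diff_right dual)
  ultimately show ?thesis using VT Z0 gz yf by linarith
qed

section \<open>Control from observability\<close>

theorem theorem1p4:
  fixes A :: "('h::{real_inner, banach} \<times> 'h) set"
    and B :: "'u::{real_inner, banach} \<Rightarrow>\<^sub>L 'h"
    and T :: real
    and G :: "(real \<Rightarrow> 'u) set"
    and W :: "(real \<Rightarrow> 'h) set"
  assumes "generates_C0_semigroup A"
    and "T > 0"
    and "closed_L2_subspace T G"
    and "closed_L2_subspace T W"
    and observability:
      "\<exists>C>0. \<forall>zT. \<forall>g\<in>G. \<forall>w\<in>W. \<forall>f\<in>L2 T.
         (let z = backward_mild_solution (op_adjoint A) T zT f in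
          sqrt ((norm (z 0))\<^sup>2 + (L2_norm T g)\<^sup>2 + (L2_norm T w)\<^sup>2 + (L2_norm T f)\<^sup>2)
            \<le> C * (L2_norm T (\<lambda>t. adjoint (blinfun_apply B) (z t) + g t)
                   + L2_norm T (\<lambda>t. f t + w t)))"
  shows "\<forall>y0. \<forall>gs\<in>G. \<forall>ws\<in>W. \<exists>u\<in>L2 T.
           L2_eq T (L2_proj T G u) gs \<and>
           (let y = mild_solution A y0 (\<lambda>t. blinfun_apply B (u t)) in
            y T = 0 \<and> L2_eq T (L2_proj T W y) ws)"
proof (intro allI ballI)
  fix y0 gs ws assume gs: "gs \<in> G" and ws: "ws \<in> W"
  have T0: "0 \<le> T" using \<open>T > 0\<close> by simp
  note S = semigroup_of_adjoint(1)[OF assms(1)] and R = semigroup_of_adjoint(2)[OF assms(1)]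
  let ?B' = "adjoint (blinfun_apply B)"
  define z where "z zT f = backward_mild_solution (op_adjoint A) T zT f" for zT f
  obtain C where "C > 0" and obs: "\<And>zT g w f. g \<in> G \<Longrightarrow> w \<in> W \<Longrightarrow> f \<in> L2 T \<Longrightarrow>
      sqrt ((norm (z zT f 0))\<^sup>2 + (L2_norm T g)\<^sup>2 + (L2_norm T w)\<^sup>2 + (L2_norm T f)\<^sup>2)
        \<le> C * (L2_norm T (\<lambda>t. ?B' (z zT f t) + g t) + L2_norm T (\<lambda>t. f t + w t))"
    using observability unfolding Let_def z_def by blast
  note GL2 = closed_L2_subspaceD(1)[OF assms(3)] and WL2 = closed_L2_subspaceD(1)[OF assms(4)]
  note G0 = closed_L2_subspaceD(2)[OF assms(3)] and W0 = closed_L2_subspaceD(2)[OF assms(4)]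
  note Gcomb = closed_L2_subspaceD(3)[OF assms(3)] and Wcomb = closed_L2_subspaceD(3)[OF assms(4)]
  have zL2: "z zT f \<in> L2 T" if "f \<in> L2 T" for zT f
    unfolding z_def by (rule backward_mild_solution_L2[OF R T0 that])
  have zcomb: "z (zT + c *\<^sub>R zT') (\<lambda>s. f s + c *\<^sub>R f' s) t = z zT f t + c *\<^sub>R z zT' f' t"
    if "f \<in> L2 T" "f' \<in> L2 T" "t \<in> {0..T}" for zT zT' f f' c t
    unfolding z_def by (rule backward_mild_solution_comb[OF R that])
  have z0: "z 0 (\<lambda>_. 0) t = 0" for t by (simp add: z_def backward_mild_solution_def)
  interpret B': bounded_linear ?B' by (rule bounded_linear_adjoint_blinfun(1))
  have BzL2: "(\<lambda>t. ?B' (z zT f t)) \<in> L2 T" if "f \<in> L2 T" for zT f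
    by (rule L2_compose_bounded_linear[OF bounded_linear_adjoint_blinfun(1) zL2[OF that]])
  define Lam where "Lam zT g w f t = (?B' (z zT f t) + g t, f t + w t)" for zT g w f t
  define ell where "ell zT g w f = - inner y0 (z zT f 0) + L2_inner T g gs + L2_inner T w ws" for zT g w f
  have LamL2: "Lam zT g w f \<in> L2 T" if "g \<in> G" "w \<in> W" "f \<in> L2 T" for zT g w f
    unfolding Lam_def by (intro L2_Pair L2_add BzL2 GL2 WL2 that)
  \<comment> \<open>agreement is required on \<open>[0, T]\<close> only, since mild solutions are linear in the data only there\<close>
  define \<Gamma> where "\<Gamma> = {(a, r). a \<in> L2 T \<and> (\<exists>zT. \<exists>g\<in>G. \<exists>w\<in>W. \<exists>f\<in>L2 T.
      (\<forall>t\<in>{0..T}. a t = Lam zT g w f t) \<and> r = ell zT g w f)}"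
  define N where "N = norm y0 + L2_norm T gs + L2_norm T ws"
  have \<Gamma>I: "(Lam zT g w f, ell zT g w f) \<in> \<Gamma>" if "g \<in> G" "w \<in> W" "f \<in> L2 T" for zT g w f
    unfolding \<Gamma>_def using LamL2 that by blast
  obtain p :: "real \<Rightarrow> 'u \<times> 'h" where pL2: "p \<in> L2 T"
    and p: "\<And>a r. (a, r) \<in> \<Gamma> \<Longrightarrow> L2_inner T p a = r"
  proof (rule L2.riesz_on_graph[of \<Gamma> T "N * (2 * C)"])
    show "a \<in> L2 T" if "(a, r) \<in> \<Gamma>" for a r using that by (simp add: \<Gamma>_def)
    show "\<Gamma> \<noteq> {}" using \<Gamma>I[OF G0 W0 L2_zero] by blast
    show "((\<lambda>t. a t + c *\<^sub>R b t), r + c * s) \<in> \<Gamma>" if ar: "(a, r) \<in> \<Gamma>" and bs: "(b, s) \<in> \<Gamma>" for a r b s c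
    proof -
      obtain zT g w f where 1: "a \<in> L2 T" "g \<in> G" "w \<in> W" "f \<in> L2 T"
        "\<And>t. t \<in> {0..T} \<Longrightarrow> a t = Lam zT g w f t" "r = ell zT g w f"
        using ar unfolding \<Gamma>_def by blast
      obtain zT' g' w' f' where 2: "b \<in> L2 T" "g' \<in> G" "w' \<in> W" "f' \<in> L2 T"
        "\<And>t. t \<in> {0..T} \<Longrightarrow> b t = Lam zT' g' w' f' t" "s = ell zT' g' w' f'"
        using bs unfolding \<Gamma>_def by blast
      let ?g = "\<lambda>t. g t + c *\<^sub>R g' t" and ?w = "\<lambda>t. w t + c *\<^sub>R w' t" and ?f = "\<lambda>t. f t + c *\<^sub>R f' t"
      have "a t + c *\<^sub>R b t = Lam (zT + c *\<^sub>R zT') ?g ?w ?f t" if t: "t \<in> {0..T}" for t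
        by (simp add: 1(5)[OF t] 2(5)[OF t] Lam_def zcomb[OF 1(4) 2(4) t] B'.add B'.scaleR scaleR_add_right)
      moreover have "r + c * s = ell (zT + c *\<^sub>R zT') ?g ?w ?f"
        using T0 L2_inner_comb[OF GL2[OF 1(2)] GL2[OF 2(2)] GL2[OF gs], of c]
          L2_inner_comb[OF WL2[OF 1(3)] WL2[OF 2(3)] WL2[OF ws], of c]
        by (simp add: 1(6) 2(6) ell_def zcomb[OF 1(4) 2(4)] inner_add_right algebra_simps)
      ultimately show ?thesis
        unfolding \<Gamma>_def using L2_comb[OF 1(1) 2(1)] Gcomb[OF 1(2) 2(2)] Wcomb[OF 1(3) 2(3)] L2_comb[OF 1(4) 2(4)]
        by blast
    qed
    show "\<bar>r\<bar> \<le> N * (2 * C) * sqrt (L2_inner T a a)" if ar: "(a, r) \<in> \<Gamma>" for a r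
    proof -
      obtain zT g w f where 1: "a \<in> L2 T" "g \<in> G" "w \<in> W" "f \<in> L2 T"
        "\<And>t. t \<in> {0..T} \<Longrightarrow> a t = Lam zT g w f t" "r = ell zT g w f"
        using ar unfolding \<Gamma>_def by blast
      define Q where "Q = sqrt ((norm (z zT f 0))\<^sup>2 + (L2_norm T g)\<^sup>2 + (L2_norm T w)\<^sup>2 + (L2_norm T f)\<^sup>2)"
      have Q: "norm (z zT f 0) \<le> Q" "L2_norm T g \<le> Q" "L2_norm T w \<le> Q"
        unfolding Q_def by (auto intro!: real_le_rsqrt)
      have "\<bar>r\<bar> \<le> \<bar>inner y0 (z zT f 0)\<bar> + \<bar>L2_inner T g gs\<bar> + \<bar>L2_inner T w ws\<bar>"
        unfolding 1(6) ell_def by linarith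
      also have "\<dots> \<le> norm y0 * norm (z zT f 0) + L2_norm T g * L2_norm T gs + L2_norm T w * L2_norm T ws"
        by (intro add_mono Cauchy_Schwarz_ineq2 L2_cauchy_schwarz GL2 WL2 1 gs ws)
      also have "\<dots> \<le> norm y0 * Q + Q * L2_norm T gs + Q * L2_norm T ws"
        by (intro add_mono mult_left_mono mult_right_mono Q L2_norm_nonneg norm_ge_zero)
      also have "\<dots> = N * Q" by (simp add: N_def algebra_simps)
      also have "\<dots> \<le> N * (C * (L2_norm T a + L2_norm T a))"
      proof (rule mult_left_mono)
        have "L2_norm T (\<lambda>t. ?B' (z zT f t) + g t) = L2_norm T (\<lambda>t. fst (a t))"
          by (rule L2_norm_cong) (simp add: 1(5) Lam_def)
        moreover have "L2_norm T (\<lambda>t. f t + w t) = L2_norm T (\<lambda>t. snd (a t))"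
          by (rule L2_norm_cong) (simp add: 1(5) Lam_def)
        moreover have "L2_norm T (\<lambda>t. fst (a t)) \<le> L2_norm T a"
        proof (rule L2_norm_mono[OF L2_compose_bounded_linear[OF bounded_linear_fst 1(1)] 1(1)])
          show "norm (fst (a t)) \<le> norm (a t)" for t by (cases "a t") (simp add: norm_fst_le)
        qed
        moreover have "L2_norm T (\<lambda>t. snd (a t)) \<le> L2_norm T a"
        proof (rule L2_norm_mono[OF L2_compose_bounded_linear[OF bounded_linear_snd 1(1)] 1(1)])
          show "norm (snd (a t)) \<le> norm (a t)" for t by (cases "a t") (simp add: norm_snd_le)
        qed
        ultimately have "C * (L2_norm T (\<lambda>t. ?B' (z zT f t) + g t) + L2_norm T (\<lambda>t. f t + w t))
            \<le> C * (L2_norm T a + L2_norm T a)"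
          using \<open>C > 0\<close> by (intro mult_left_mono) auto
        with obs[OF 1(2,3,4)] show "Q \<le> C * (L2_norm T a + L2_norm T a)"
          unfolding Q_def by (rule order_trans)
        show "0 \<le> N" by (simp add: N_def L2_norm_nonneg)
      qed
      finally show ?thesis by (simp add: L2_norm_eq_sqrt_inner algebra_simps)
    qed
  qed (rule that)
  define u where "u = (\<lambda>t. fst (p t))"
  define v where "v = (\<lambda>t. snd (p t))"
  have uL2: "u \<in> L2 T" and vL2: "v \<in> L2 T"
    unfolding u_def v_def
    by (intro L2_compose_bounded_linear[OF bounded_linear_fst] L2_compose_bounded_linear[OF bounded_linear_snd] pL2)+
  \<comment> \<open>the identity represented by \<open>(u, v)\<close>; the next facts choose special data in it\<close>
  have key: "L2_inner T u (\<lambda>t. ?B' (z zT f t) + g t) + L2_inner T v (\<lambda>t. f t + w t) = ell zT g w f"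
    if "g \<in> G" "w \<in> W" "f \<in> L2 T" for zT g w f
    using p[OF \<Gamma>I[OF that]] unfolding L2_inner_prod[OF pL2 LamL2[OF that]] by (simp add: u_def v_def Lam_def)
  have ug: "L2_inner T u g = L2_inner T gs g" if "g \<in> G" for g
    using key[OF that W0 L2_zero, of 0] by (simp add: z0 B'.zero ell_def L2_inner_def inner_commute)
  have vw: "L2_inner T v w = L2_inner T ws w" if "w \<in> W" for w
    using key[OF G0 that L2_zero, of 0] by (simp add: z0 B'.zero ell_def L2_inner_def inner_commute)
  define y where "y = mild_solution A y0 (\<lambda>t. B (u t))"
  have BuL2: "(\<lambda>t. B (u t)) \<in> L2 T"
    by (rule L2_compose_bounded_linear[OF blinfun.bounded_linear_right uL2])
  have yL2: "y \<in> L2 T" unfolding y_def by (rule mild_solution_L2[OF S T0 BuL2])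
  \<comment> \<open>the Riesz identity with \<open>g = w = 0\<close>, inserted into the duality of mild solutions\<close>
  have yT: "inner (y T) zT = L2_inner T y f - L2_inner T v f" if f: "f \<in> L2 T" for zT f
  proof -
    have "inner (y T) zT - inner y0 (z zT f 0) = L2_inner T (\<lambda>t. B (u t)) (z zT f) + L2_inner T y f"
      unfolding y_def z_def by (rule mild_solution_duality[OF assms(1) T0 BuL2 f])
    moreover have "L2_inner T (\<lambda>t. B (u t)) (z zT f) = L2_inner T u (\<lambda>t. ?B' (z zT f t))"
      by (rule L2_inner_cong) (rule adjoint_blinfun_works)
    moreover have "L2_inner T u (\<lambda>t. ?B' (z zT f t)) + L2_inner T v f = - inner y0 (z zT f 0)"
      using key[OF G0 W0 f, of zT] by (simp add: ell_def L2_inner_def)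
    ultimately show ?thesis by linarith
  qed
  have "inner (y T) (y T) = 0" using yT[OF L2_zero, of "y T"] by (simp add: L2_inner_def)
  then have "y T = 0" by simp
  have yw: "L2_inner T y w = L2_inner T ws w" if w: "w \<in> W" for w
    using yT[OF WL2[OF w], of 0] vw[OF w] by simp
  have "L2_eq T (L2_proj T G u) gs" by (rule L2_proj_eqI[OF assms(3) uL2 gs ug])
  moreover have "L2_eq T (L2_proj T W y) ws" by (rule L2_proj_eqI[OF assms(4) yL2 ws yw])
  ultimately show "\<exists>u\<in>L2 T. L2_eq T (L2_proj T G u) gs \<and>
      (let y = mild_solution A y0 (\<lambda>t. blinfun_apply B (u t)) in y T = 0 \<and> L2_eq T (L2_proj T W y) ws)"
    using uL2 \<open>y T = 0\<close> unfolding y_def Let_def by blast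
qed

end
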